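(* Let $N\geq 11$, let $B_1$ be the open unit ball of $\mathbb{R}^N$, and let $\Psi\in C(\overline{B_1}\setminus\{0\})$ be a radially symmetric decreasing function satisfying $$\frac{2(N-2)}{r^2}\leq\Psi(r)\leq\frac{(N-2)^2}{4r^2}\quad\text{for every } 0<r\leq 1.$$ Then there exists $f\in C^1([0,+\infty))$, nondecreasing and convex with $f(0)>0$ and $\lim_{t\to+\infty} f(t)/t=+\infty$, such that, for the problem $-\Delta u=\lambda f(u)$ in $B_1$, $u>0$ in $B_1$, $u=0$ on $\partial B_1$, the extremal parameter is $\lambda^\ast=1$ and the extremal solution $u^\ast$ satisfies $$f'(u^\ast(x))=\Psi(x)\quad\text{for every } x\in\overline{B_1}\setminus\{0\}.$$ Moreover, this function $f$ is unique up to a multiplicative constant, in the following sense: if $g\in C^1([0,+\infty))$ is nondecreasing and convex with $g(0)>0$ and $\lim_{t\to+\infty}g(t)/t=+\infty$, the extremal parameter of the corresponding problem with $g$ in place of $f$ is $1$, and its extremal solution $v^\ast$ satisfies $g'(v^\ast(x))=\Psi(x)$ for every $x\in\overline{B_1}\setminus\{0\}$, then there exists $\alpha>0$ such that $g=\alpha f(\cdot/\alpha)$ (whose extremal solution is $\alpha u^\ast$).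
   Context: For $f:[0,\infty)\to\mathbb{R}$ which is $C^1$, nondecreasing and convex with $f(0)>0$ and $\lim_{t\to+\infty}f(t)/t=+\infty$, consider for $\lambda\ge 0$ the problem $(P_\lambda)$: $-\Delta u=\lambda f(u)$ in $B_1$, $u>0$ in $B_1$, $u=0$ on $\partial B_1$. It is well known that there is a finite number $\lambda^\ast>0$ (the extremal parameter) such that for $0<\lambda<\lambda^\ast$ the problem $(P_\lambda)$ has a minimal (i.e. pointwise smallest) classical solution $u_\lambda\in C^0(\overline{B_1})\cap C^2(B_1)$, while for $\lambda>\lambda^\ast$ there is no solution, even in the weak sense. The functions $u_\lambda$ are increasing in $\lambda$, and the extremal solution is the pointwise limit $u^\ast(x):=\lim_{\lambda\uparrow\lambda^\ast}u_\lambda(x)$, a weak solution of $(P_{\lambda^\ast})$. For a radially symmetric function $\Psi$, $\Psi(r)$ denotes its value at points with $|x|=r$; "decreasing" refers to the dependence on $r$. *)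

theory Defs
  imports "HOL-Analysis.Analysis"
begin

text \<open>
  Everything lives on \<open>B\<^sub>1 = ball 0 1\<close> in \<open>\<real>\<^sup>N\<close>, written \<open>real ^ 'n\<close> with \<open>N = CARD('n)\<close>.
  Nonlinearities \<open>f\<close> matter only on \<open>{0..}\<close>, functions on the ball only on \<open>cball 0 1\<close>.
\<close>

definition partial_deriv :: "'n \<Rightarrow> (real ^ 'n \<Rightarrow> real) \<Rightarrow> real ^ 'n \<Rightarrow> real"
  where "partial_deriv i u x = deriv (\<lambda>t. u (x + t *\<^sub>R axis i 1)) 0"

definition laplacian :: "(real ^ 'n \<Rightarrow> real) \<Rightarrow> real ^ 'n \<Rightarrow> real"
  where "laplacian u x = (\<Sum>i\<in>UNIV. partial_deriv i (partial_deriv i u) x)"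

text \<open>\<open>C\<^sup>2(S)\<close> for open \<open>S\<close>; \<open>D\<close> is the gradient and \<open>H\<close> the Hessian matrix.\<close>

definition C2_on :: "(real ^ 'n) set \<Rightarrow> (real ^ 'n \<Rightarrow> real) \<Rightarrow> bool"
  where "C2_on S u \<longleftrightarrow> (\<exists>D H :: real ^ 'n \<Rightarrow> real ^ 'n ^ 'n.
    (\<forall>x\<in>S. GDERIV u x :> D x \<and> (D has_derivative (\<lambda>h. H x *v h)) (at x)) \<and>
    continuous_on S H)"

text \<open>
  \<open>C\<^sup>2\<close> up to the boundary for open \<open>S\<close>: the function, its gradient and its Hessian on \<open>S\<close>
  extend continuously to \<open>closure S\<close>. On the boundary, \<open>D\<close> and \<open>H\<close> are just these extensions.
\<close>

definition C2_on_closure :: "(real ^ 'n) set \<Rightarrow> (real ^ 'n \<Rightarrow> real) \<Rightarrow> bool"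
  where "C2_on_closure S u \<longleftrightarrow> (\<exists>D H :: real ^ 'n \<Rightarrow> real ^ 'n ^ 'n.
    (\<forall>x\<in>S. GDERIV u x :> D x \<and> (D has_derivative (\<lambda>h. H x *v h)) (at x)) \<and>
    continuous_on (closure S) u \<and> continuous_on (closure S) D \<and> continuous_on (closure S) H)"

text \<open>The derivative at the endpoint \<open>0\<close> is the one-sided one.\<close>

definition C1_halfline :: "(real \<Rightarrow> real) \<Rightarrow> bool"
  where "C1_halfline f \<longleftrightarrow> (\<exists>f'. (\<forall>t\<ge>0. (f has_real_derivative f' t) (at t within {0..})) \<and>
    continuous_on {0..} f')"

definition admissible :: "(real \<Rightarrow> real) \<Rightarrow> bool"
  where "admissible f \<longleftrightarrow>
    C1_halfline f \<and> mono_on {0..} f \<and> convex_on {0..} f \<and> f 0 > 0 \<and>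
    filterlim (\<lambda>t. f t / t) at_top at_top"

definition classical_solution :: "(real \<Rightarrow> real) \<Rightarrow> real \<Rightarrow> (real ^ 'n \<Rightarrow> real) \<Rightarrow> bool"
  where "classical_solution f l u \<longleftrightarrow>
    continuous_on (cball 0 1) u \<and> C2_on (ball 0 1) u \<and>
    (\<forall>x\<in>ball 0 1. - laplacian u x = l * f (u x)) \<and>
    (\<forall>x\<in>ball 0 1. u x > 0) \<and>
    (\<forall>x\<in>sphere 0 1. u x = 0)"

definition minimal_solution :: "(real \<Rightarrow> real) \<Rightarrow> real \<Rightarrow> (real ^ 'n \<Rightarrow> real) \<Rightarrow> bool"
  where "minimal_solution f l u \<longleftrightarrow>
    classical_solution f l u \<and>
    (\<forall>v. classical_solution f l v \<longrightarrow> (\<forall>x\<in>cball 0 1. u x \<le> v x))"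

text \<open>
  The usual \<open>L\<^sup>1\<close> notion (Brezis, Cazenave, Martel and Ramiandrisoana): \<open>u \<ge> 0\<close> is in
  \<open>L\<^sup>1(B\<^sub>1)\<close>, \<open>f(u) \<delta>\<close> is in \<open>L\<^sup>1(B\<^sub>1)\<close> with \<open>\<delta>(x) = 1 - norm x\<close> the distance to the boundary, and
  the equation holds against all test functions that are \<open>C\<^sup>2\<close> up to the boundary and vanish there.
\<close>

definition weak_solution :: "(real \<Rightarrow> real) \<Rightarrow> real \<Rightarrow> (real ^ 'n \<Rightarrow> real) \<Rightarrow> bool"
  where "weak_solution f l u \<longleftrightarrow>
    set_integrable lebesgue (ball 0 1) u \<and>
    (AE x in lebesgue. x \<in> ball 0 1 \<longrightarrow> u x \<ge> 0) \<and>
    set_integrable lebesgue (ball 0 1) (\<lambda>x. f (u x) * (1 - norm x)) \<and>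
    (\<forall>\<zeta>. C2_on_closure (ball 0 1) \<zeta> \<and> (\<forall>x\<in>sphere 0 1. \<zeta> x = 0) \<longrightarrow>
      (LINT x:ball 0 1|lebesgue. u x * (- laplacian \<zeta> x)) =
      l * (LINT x:ball 0 1|lebesgue. f (u x) * \<zeta> x))"

text \<open>The type argument carries the dimension, which \<open>f\<close> and \<open>L\<close> do not determine.\<close>

definition extremal_parameter :: "'n::finite itself \<Rightarrow> (real \<Rightarrow> real) \<Rightarrow> real \<Rightarrow> bool"
  where "extremal_parameter N f L \<longleftrightarrow>
    L > 0 \<and>
    (\<forall>l. 0 < l \<and> l < L \<longrightarrow> (\<exists>u :: real ^ 'n \<Rightarrow> real. minimal_solution f l u)) \<and>
    (\<forall>l>L. \<not> (\<exists>u :: real ^ 'n \<Rightarrow> real. classical_solution f l u \<or> weak_solution f l u))"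

text \<open>
  The pointwise limit of the minimal solutions as the parameter increases to the extremal
  parameter \<open>L\<close>. It is extended-real valued because it may be infinite at some points (at the
  origin, for singular extremal solutions).
\<close>

definition extremal_solution :: "(real \<Rightarrow> real) \<Rightarrow> real \<Rightarrow> (real ^ 'n \<Rightarrow> ereal) \<Rightarrow> bool"
  where "extremal_solution f L U \<longleftrightarrow>
    (\<exists>u. (\<forall>l. 0 < l \<and> l < L \<longrightarrow> minimal_solution f l (u l)) \<and>
      (\<forall>x\<in>cball 0 1. ((\<lambda>l. ereal (u l x)) \<longlongrightarrow> U x) (at_left L)))"

text \<open>
  The identity \<open>f'(U(x)) = \<Psi>(x)\<close>, including that \<open>U\<close> is finite away from the origin. On the unit
  sphere, where \<open>U = 0\<close>, the derivative is one-sided.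
\<close>

definition derivative_along :: "(real \<Rightarrow> real) \<Rightarrow> (real ^ 'n \<Rightarrow> ereal) \<Rightarrow> (real ^ 'n \<Rightarrow> real) \<Rightarrow> bool"
  where "derivative_along f U \<Psi> \<longleftrightarrow>
    (\<forall>x\<in>cball 0 1 - {0}. \<exists>t\<ge>0. U x = ereal t \<and>
      (f has_real_derivative \<Psi> x) (at t within {0..}))"

end

theory Submission
  imports Defs
begin

text \<open>
  If \<open>u\<close> is a radial solution and \<open>\<eta> = - u'\<close>, then differentiating the equation gives the linear equation
  \<open>\<eta>'' + (k / r) \<eta>' + (\<Psi> - k / r\<^sup>2) \<eta> = 0\<close> with \<open>k = N - 1\<close>. The bounds on \<open>\<Psi>\<close> make the less singular
  positive solution \<open>\<eta>\<close> comparable with powers between \<open>r\<^bsup>-1\<^esup>\<close> and \<open>r\<^bsup>- (N - 4) / 2\<^esup>\<close>; then \<open>u = \<integral>\<^bsub>r\<^esub>\<^bsup>1\<^esup> \<eta>\<close> is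
  unbounded, and \<open>f\<close> is defined by \<open>f \<circ> u = - \<Delta> u\<close>, so that \<open>f' \<circ> u = \<Psi>\<close>.

  Minimal solutions are limits of radial iterates. If \<open>z\<close> solves the problem with parameter \<open>l\<close>, then
  \<open>z (sqrt (1 - b + b r\<^sup>2))\<close> is a bounded supersolution for \<open>b l\<close> whenever \<open>b < 1\<close>: hence classical
  solutions exist for \<open>l < 1\<close>, and any solution with \<open>l > 1\<close> would give a bounded one for \<open>l = 1\<close>.
  The latter is impossible: \<open>\<Psi> \<le> (N - 2)\<^sup>2 / (4 r\<^sup>2)\<close> (Hardy) forces every radial solution below \<open>u\<close> to equal \<open>u\<close>.

  For uniqueness, Sturm comparison of \<open>\<eta>\<close> with the derivatives of the (regular) minimal solutions shows
  that these are bounded by a multiple of \<open>\<eta>\<close> and, as their Wronskians with \<open>\<eta>\<close> tend to \<open>0\<close>, converge to one.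
\<close>

section \<open>Radial averages and the radial Poisson problem\<close>

text \<open>The two bounds on \<Psi> act in opposite directions. The lower one is the linearized
  potential of the profile \<open>- 2 * ln r\<close> of the exponential (Gelfand) problem, whose
  slope is a multiple of \<open>1 / r\<close>; it keeps \<eta> above \<open>1 / r\<close> and thus
  makes \<open>u\<close> singular. The upper one carries the Hardy constant and makes
  \<open>u\<close> stable although it is unbounded. Competing solutions may be nonradial, and weak
  ones are merely integrable. Both kinds are compared with radial iterates started at 0, so that
  existence, minimality and nonexistence all turn into one question: do the iterates stay bounded at
  the origin? A weak solution bounds them only away from the origin. The change of variables sends
  the origin to \<open>sqrt (1 - b) > 0\<close> and so repairs this at the cost of a slightly
  smaller parameter. In the uniqueness part \<open>g' (V x) = \<Psi> x\<close> cannot be inverted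
  for \<open>V\<close>, because \<open>g\<close> is unknown too, and the linear equation for the
  slope of \<open>V\<close> has a second, more singular solution. Working with the bounded minimal
  solutions below \<open>V\<close>, instead of \<open>V\<close> itself, discards that
  solution.\<close>

text \<open>\<open>avg k g s\<close> is \<open>s\<^bsup>- k - 1\<^esup> \<integral>\<^bsub>0\<^esub>\<^bsup>s\<^esup> t\<^bsup>k\<^esup> g(t) dt\<close>, rescaled so that it is continuous at \<open>s = 0\<close>; with \<open>k = N - 1\<close>,
  \<open>green k g\<close> is the radial solution of \<open>- \<Delta> u = g\<close> vanishing on the unit sphere.\<close>

definition avg :: "nat \<Rightarrow> (real \<Rightarrow> real) \<Rightarrow> real \<Rightarrow> real"
  where "avg k g s = integral {0..1} (\<lambda>t. t ^ k * g (s * t))"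

definition green :: "nat \<Rightarrow> (real \<Rightarrow> real) \<Rightarrow> real \<Rightarrow> real"
  where "green k g r = integral {r..1} (\<lambda>s. s * avg k g s)"

lemma mult_unit_Icc: "s * t \<in> {0..1}" if "s \<in> {0..1}" "t \<in> {0..1}" for s t :: real
  using that by (auto intro: mult_le_one)

lemma continuous_on_dilation:
  fixes g :: "real \<Rightarrow> real"
  assumes "continuous_on {0..1} g" "s \<in> {0..1}"
  shows "continuous_on {0..1} (\<lambda>t. t ^ k * g (s * t))"
  using mult_unit_Icc[OF assms(2)]
  by (intro continuous_intros continuous_on_compose2[OF assms(1)]) auto

lemma avg_integrable:
  fixes g :: "real \<Rightarrow> real"
  assumes "continuous_on {0..1} g" "s \<in> {0..1}"
  shows "(\<lambda>t. t ^ k * g (s * t)) integrable_on {0..1}"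
  using continuous_on_dilation[OF assms] by (rule integrable_continuous_real)

lemma continuous_on_avg:
  assumes "continuous_on {0..1} g"
  shows "continuous_on {0..1} (avg k g)"
proof -
  have "continuous_on ({0..1} \<times> cbox 0 1) (\<lambda>(s, t). t ^ k * g (s * t))"
    unfolding split_beta
    by (intro continuous_intros continuous_on_compose2[OF assms]) (auto intro: mult_le_one)
  from integral_continuous_on_param[OF this] show ?thesis
    by (simp add: avg_def[abs_def])
qed

lemma avg_mono:
  assumes "continuous_on {0..1} g" "continuous_on {0..1} h" "s \<in> {0..1}"
    and "\<And>t. t \<in> {0..1} \<Longrightarrow> g t \<le> h t"
  shows "avg k g s \<le> avg k h s"
  unfolding avg_def
  by (intro integral_le avg_integrable assms mult_left_mono mult_unit_Icc[OF assms(3)]) auto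

lemma integral_power_unit: "integral {0..1} (\<lambda>t::real. t ^ k) = 1 / (real k + 1)"
proof -
  have "((\<lambda>t::real. t ^ k) has_integral (1 ^ (k + 1) / (k + 1) - 0 ^ (k + 1) / (k + 1))) {0..1}"
  proof (rule fundamental_theorem_of_calculus)
    fix t :: real
    have "((\<lambda>t. t ^ (k + 1)) has_real_derivative real (k + 1) * t ^ (k + 1 - Suc 0)) (at t within {0..1})"
      by (rule DERIV_subset[OF DERIV_pow subset_UNIV])
    from DERIV_cdivide[OF this, of "real (k + 1)"]
    show "((\<lambda>t. t ^ (k + 1) / (k + 1)) has_vector_derivative t ^ k) (at t within {0..1})"
      by (simp add: has_real_derivative_iff_has_vector_derivative[symmetric] del: power_Suc of_nat_Suc)
  qed simp
  then show ?thesis by (simp add: integral_unique)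
qed

lemma avg_const [simp]: "avg k (\<lambda>_. c) s = c / (real k + 1)"
  by (simp add: avg_def integral_power_unit add.commute)

lemma avg_at_zero [simp]: "avg k g 0 = g 0 / (real k + 1)"
  by (simp add: avg_def integral_power_unit add.commute)

lemma avg_nonneg:
  assumes "continuous_on {0..1} g" "s \<in> {0..1}" "\<And>t. t \<in> {0..1} \<Longrightarrow> 0 \<le> g t"
  shows "0 \<le> avg k g s"
  using avg_mono[of "\<lambda>_. 0" g s k] assms by simp

lemma avg_antimono:
  assumes "continuous_on {0..1} g" "0 \<le> s" "s \<le> r" "r \<le> 1"
    and anti: "\<And>a b. 0 \<le> a \<Longrightarrow> a \<le> b \<Longrightarrow> b \<le> 1 \<Longrightarrow> g b \<le> g a"
  shows "avg k g r \<le> avg k g s"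
  unfolding avg_def
proof (intro integral_le avg_integrable assms mult_left_mono)
  fix t :: real assume "t \<in> {0..1}"
  then show "s * t \<le> r * t" "0 \<le> s * t" "r * t \<le> 1" "0 \<le> t ^ k"
    using assms mult_unit_Icc[of r t] by (auto intro: mult_right_mono)
qed (use assms in auto)

lemma avg_cmult: "avg k (\<lambda>r. c * g r) s = c * avg k g s"
  by (simp add: avg_def mult.left_commute)

lemma power_avg:
  assumes "0 \<le> r"
  shows "r ^ (k + 1) * avg k g r = integral {0..r} (\<lambda>t. t ^ k * g t)"
proof (cases "r = 0")
  case False
  then have r: "r > 0" using assms by simp
  have eq: "integral {0..1} (\<lambda>t. (r * t) ^ k * g (r * t)) = (1 / r) *\<^sub>R integral {0..r} (\<lambda>t. t ^ k * g t)"
  proof -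
    have "integral ((\<lambda>x. x / r) ` {0..r}) (\<lambda>x. (\<lambda>t. t ^ k * g t) (r * x)) = (1 / \<bar>r\<bar>) *\<^sub>R integral {0..r} (\<lambda>t. t ^ k * g t)"
      using integral_stretch_real[of r 0 r "\<lambda>t. t ^ k * g t"] r by (simp add: mult.commute)
    moreover have "(\<lambda>x. x / r) ` {0..r} = {0..1}"
      using r by (simp add: image_divide_atLeastAtMost)
    ultimately show ?thesis using r by simp
  qed
  have "r * (r ^ k * avg k g r) = r * integral {0..1} (\<lambda>t. (r * t) ^ k * g (r * t))"
    by (simp add: avg_def power_mult_distrib mult.assoc)
  also have "\<dots> = integral {0..r} (\<lambda>t. t ^ k * g t)"
    using r by (simp add: eq)
  finally show ?thesis by simp
qed simp

text \<open>The radial Poisson equation in divergence form: \<open>r ^ (k + 1) * avg k g r\<close>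
  is the flux \<open>- r ^ k * z'\<close> of \<open>z = green k g\<close>.\<close>

lemma power_avg_deriv:
  assumes "continuous_on {0..1} g" "0 < r" "r < 1"
  shows "((\<lambda>r. r ^ (k + 1) * avg k g r) has_real_derivative r ^ k * g r) (at r)"
proof -
  have "continuous_on {0..1} (\<lambda>t. t ^ k * g t)"
    by (intro continuous_intros assms)
  from integral_has_real_derivative[OF this, of r]
  have "((\<lambda>x. integral {0..x} (\<lambda>t. t ^ k * g t)) has_real_derivative r ^ k * g r) (at r)"
    using assms by (simp add: at_within_Icc_at)
  then show ?thesis
    by (rule has_field_derivative_transform_within_open[where S="{0<..<1}"])
      (use assms in \<open>auto simp: power_avg[symmetric]\<close>)
qed

lemma avg_deriv:
  assumes "continuous_on {0..1} g" "0 < r" "r < 1"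
  shows "(avg k g has_real_derivative (g r - (k + 1) * avg k g r) / r) (at r)"
proof -
  have "((\<lambda>s. (s ^ (k + 1) * avg k g s) / s ^ (k + 1)) has_real_derivative
      ((r ^ k * g r) * r ^ (k + 1) - (r ^ (k + 1) * avg k g r) * (real (k + 1) * r ^ k)) / (r ^ (k + 1) * r ^ (k + 1))) (at r)"
    using assms(2) DERIV_pow[of "k + 1" r]
    by (intro DERIV_divide power_avg_deriv assms) auto
  also have "((r ^ k * g r) * r ^ (k + 1) - (r ^ (k + 1) * avg k g r) * (real (k + 1) * r ^ k)) / (r ^ (k + 1) * r ^ (k + 1))
      = (g r - (k + 1) * avg k g r) / r"
    using assms(2) by (simp add: divide_simps) (simp add: algebra_simps)
  finally have "((\<lambda>s. (s ^ (k + 1) * avg k g s) / s ^ (k + 1)) has_real_derivative (g r - (real k + 1) * avg k g r) / r) (at r)"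
    by (simp add: add.commute)
  then show ?thesis
    by (rule has_field_derivative_transform_within_open[where S="{0<..<1}"]) (use assms in auto)
qed

lemma continuous_on_id_avg:
  "continuous_on {0..1} g \<Longrightarrow> continuous_on {0..1} (\<lambda>s. s * avg k g s)"
  by (intro continuous_intros continuous_on_avg)

lemma green_eq:
  assumes "continuous_on {0..1} g" "r \<in> {0..1}"
  shows "green k g r = green k g 0 - integral {0..r} (\<lambda>s. s * avg k g s)"
  using Henstock_Kurzweil_Integration.integral_combine[OF _ _ integrable_continuous_real[OF continuous_on_id_avg[OF assms(1)]], of r k]
    assms(2) by (simp add: green_def)

lemma green_deriv_within:
  assumes "continuous_on {0..1} g" "r \<in> {0..1}"
  shows "(green k g has_real_derivative - (r * avg k g r)) (at r within {0..1})"
proof -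
  have "((\<lambda>r. green k g 0 - integral {0..r} (\<lambda>s. s * avg k g s)) has_real_derivative 0 - r * avg k g r)
      (at r within {0..1})"
    by (intro derivative_intros integral_has_real_derivative continuous_on_id_avg assms)
  then have "((\<lambda>r. green k g 0 - integral {0..r} (\<lambda>s. s * avg k g s)) has_real_derivative - (r * avg k g r))
      (at r within {0..1})" by simp
  then show ?thesis
    using zero_less_one assms(2) green_eq[OF assms(1), symmetric]
    by (rule has_field_derivative_transform_within)
qed

lemma green_deriv:
  assumes "continuous_on {0..1} g" "0 < r" "r < 1"
  shows "(green k g has_real_derivative - (r * avg k g r)) (at r)"
  using green_deriv_within[OF assms(1), of r k] at_within_Icc_at[of 0 r 1] assms(2,3) by simp

lemma continuous_on_green: "continuous_on {0..1} g \<Longrightarrow> continuous_on {0..1} (green k g)"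
  by (rule DERIV_continuous_on[OF green_deriv_within])

lemma green_at_one [simp]: "green k g 1 = 0"
  by (simp add: green_def)

lemma green_mono:
  assumes "continuous_on {0..1} g" "continuous_on {0..1} h" "r \<in> {0..1}"
    and "\<And>t. t \<in> {0..1} \<Longrightarrow> g t \<le> h t"
  shows "green k g r \<le> green k h r"
  unfolding green_def using assms(3)
  by (intro integral_le integrable_continuous_real continuous_on_subset[OF continuous_on_id_avg]
      assms mult_left_mono avg_mono) auto

lemma green_zero [simp]: "green k (\<lambda>_. 0) r = 0"
  by (simp add: green_def)

lemma green_nonneg:
  assumes "continuous_on {0..1} g" "r \<in> {0..1}" "\<And>t. t \<in> {0..1} \<Longrightarrow> 0 \<le> g t"
  shows "0 \<le> green k g r"
  using green_mono[of "\<lambda>_. 0" g r k] assms by simp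

lemma green_antimono:
  assumes "continuous_on {0..1} g" "0 \<le> r" "r \<le> s" "s \<le> 1" "\<And>t. t \<in> {0..1} \<Longrightarrow> 0 \<le> g t"
  shows "green k g s \<le> green k g r"
proof -
  have "green k g r - green k g s = integral {r..s} (\<lambda>s. s * avg k g s)"
    using Henstock_Kurzweil_Integration.integral_combine[of r s 1 "\<lambda>s. s * avg k g s"] assms
      integrable_continuous_real[OF continuous_on_subset[OF continuous_on_id_avg[OF assms(1)], of "{r..1}" k]]
    by (simp add: green_def)
  also have "\<dots> \<ge> 0"
    using assms by (intro integral_nonneg integrable_continuous_real mult_nonneg_nonneg avg_nonneg
        continuous_on_subset[OF continuous_on_id_avg]) auto
  finally show ?thesis by simp
qed

lemma power_avg_tendsto_0:
  assumes "continuous_on {0..1} g"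
  shows "((\<lambda>r. r ^ (k + 1) * avg k g r) \<longlongrightarrow> 0) (at_right 0)"
proof -
  have "continuous_on {0..1} (\<lambda>r. r ^ (k + 1) * avg k g r)"
    by (intro continuous_intros continuous_on_avg assms)
  then have "((\<lambda>r. r ^ (k + 1) * avg k g r) \<longlongrightarrow> 0 ^ (k + 1) * avg k g 0) (at 0 within {0..1})"
    unfolding continuous_on_def by (metis (no_types) atLeastAtMost_iff order_refl zero_le_one)
  then show ?thesis by (simp add: at_within_Icc_at_right)
qed

text \<open>Made for fluxes and Wronskians built from singular functions, for which only a one-sided
  limit at 0 can replace an initial value.\<close>

lemma incseq_from_zero:
  fixes \<phi> :: "real \<Rightarrow> real"
  assumes "continuous_on {0<..1} \<phi>" "(\<phi> \<longlongrightarrow> 0) (at_right 0)"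
    and "\<And>t. 0 < t \<Longrightarrow> t < 1 \<Longrightarrow> \<exists>D. (\<phi> has_real_derivative D) (at t) \<and> 0 \<le> D"
    and "0 < r" "r \<le> 1"
  shows "0 \<le> \<phi> r"
proof (rule tendsto_upperbound[OF assms(2)])
  show "\<forall>\<^sub>F s in at_right 0. \<phi> s \<le> \<phi> r"
    unfolding eventually_at_right_field
  proof (intro exI[of _ r] conjI allI impI)
    fix s assume "0 < s" "s < r"
    then show "\<phi> s \<le> \<phi> r"
      using assms by (intro DERIV_nonneg_imp_increasing_open[of s r \<phi>])
        (auto intro: continuous_on_subset[OF assms(1)])
  qed (use assms in auto)
qed simp

section \<open>Radial functions on the ball and the maximum principle\<close>

lemma GDERIV_along:
  assumes "GDERIV u (x + s *\<^sub>R e) :> d"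
  shows "((\<lambda>t. u (x + t *\<^sub>R e)) has_real_derivative d \<bullet> e) (at s)"
proof -
  have "(u has_derivative (\<lambda>h. h \<bullet> d)) (at (x + s *\<^sub>R e))"
    using assms by (simp add: gderiv_def)
  moreover have "((\<lambda>t. x + t *\<^sub>R e) has_derivative (\<lambda>t. t *\<^sub>R e)) (at s)"
    by (auto intro!: derivative_eq_intros)
  ultimately have "((\<lambda>t. u (x + t *\<^sub>R e)) has_derivative (\<lambda>t. (t *\<^sub>R e) \<bullet> d)) (at s)"
    by (rule has_derivative_compose[rotated])
  then show ?thesis
    by (simp add: has_field_derivative_def inner_commute mult_commute_abs)
qed

lemma partial_deriv_GDERIV:
  assumes "GDERIV u x :> d"
  shows "partial_deriv i u x = d $ i"
  using GDERIV_along[of u x 0 "axis i 1" d] assms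
  by (simp add: partial_deriv_def DERIV_imp_deriv inner_axis)

lemma gradient_component_deriv:
  fixes D :: "real ^ 'n \<Rightarrow> real ^ 'n"
  assumes "(D has_derivative (\<lambda>h. H *v h)) (at x)"
  shows "((\<lambda>t. D (x + t *\<^sub>R axis i 1) $ i) has_real_derivative H $ i $ i) (at 0)"
proof -
  have "((\<lambda>t::real. x + t *\<^sub>R axis i 1) has_derivative (\<lambda>t. t *\<^sub>R axis i 1)) (at 0)"
    by (auto intro!: derivative_eq_intros)
  moreover have "(D has_derivative (\<lambda>h. H *v h)) (at (x + 0 *\<^sub>R axis i 1))"
    using assms by simp
  ultimately have "((\<lambda>t. D (x + t *\<^sub>R axis i 1)) has_derivative (\<lambda>t. H *v (t *\<^sub>R axis i 1))) (at 0)"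
    by (rule has_derivative_compose)
  then have "((\<lambda>t. D (x + t *\<^sub>R axis i 1) $ i) has_derivative (\<lambda>t. (H *v (t *\<^sub>R axis i 1)) $ i)) (at 0)"
    by (rule bounded_linear.has_derivative[OF bounded_linear_vec_nth])
  moreover have "(\<lambda>t. (H *v (t *\<^sub>R axis i 1)) $ i) = (\<lambda>t. H $ i $ i * t)"
    by (auto simp: matrix_vector_mul_component inner_axis)
  ultimately show ?thesis
    by (simp add: has_field_derivative_def)
qed

lemma axis_segment_eventually:
  fixes x :: "real ^ 'n"
  assumes "open S" "x \<in> S"
  obtains e where "0 < e" "\<And>t. \<bar>t\<bar> < e \<Longrightarrow> x + t *\<^sub>R axis i 1 \<in> S"
proof -
  from assms obtain e where e: "0 < e" "\<And>y. dist y x < e \<Longrightarrow> y \<in> S"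
    by (auto simp: open_dist)
  then show ?thesis
    by (intro that[of e]) (auto simp: dist_norm)
qed

lemma laplacian_trace:
  fixes D :: "real ^ 'n \<Rightarrow> real ^ 'n"
  assumes "open S" "x \<in> S" "\<And>y. y \<in> S \<Longrightarrow> GDERIV u y :> D y"
    and "(D has_derivative (\<lambda>h. H *v h)) (at x)"
  shows "laplacian u x = (\<Sum>i\<in>UNIV. H $ i $ i)"
  unfolding laplacian_def
proof (rule sum.cong[OF refl])
  fix i
  obtain e where e: "0 < e" "\<And>t. \<bar>t\<bar> < e \<Longrightarrow> x + t *\<^sub>R axis i 1 \<in> S"
    using axis_segment_eventually[OF assms(1,2)] by blast
  have "((\<lambda>t. partial_deriv i u (x + t *\<^sub>R axis i 1)) has_real_derivative H $ i $ i) (at 0)"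
  proof (rule has_field_derivative_transform_within_open[OF gradient_component_deriv[OF assms(4)]])
    fix t :: real assume "t \<in> {-e<..<e}"
    then show "D (x + t *\<^sub>R axis i 1) $ i = partial_deriv i u (x + t *\<^sub>R axis i 1)"
      by (intro partial_deriv_GDERIV[symmetric] assms(3) e(2)) auto
  qed (use e in auto)
  then show "partial_deriv i (partial_deriv i u) x = H $ i $ i"
    by (simp add: partial_deriv_def[of i "partial_deriv i u"] DERIV_imp_deriv)
qed

lemma GDERIV_lincomb:
  assumes "GDERIV u x :> d" "GDERIV v x :> d'"
  shows "GDERIV (\<lambda>x. u x + c * v x) x :> d + c *\<^sub>R d'"
proof -
  have "((\<lambda>x. u x + c * v x) has_derivative (\<lambda>h. h \<bullet> d + c * (h \<bullet> d'))) (at x)"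
    using assms unfolding gderiv_def by (intro derivative_intros)
  then show ?thesis
    by (simp add: gderiv_def inner_add_right)
qed

lemma gradient_lincomb_deriv:
  fixes D D' :: "real ^ 'n \<Rightarrow> real ^ 'n"
  assumes "(D has_derivative (\<lambda>h. H *v h)) (at x)" "(D' has_derivative (\<lambda>h. H' *v h)) (at x)"
  shows "((\<lambda>x. D x + c *\<^sub>R D' x) has_derivative (\<lambda>h. (H + c *\<^sub>R H') *v h)) (at x)"
proof -
  have "((\<lambda>x. D x + c *\<^sub>R D' x) has_derivative (\<lambda>h. H *v h + c *\<^sub>R (H' *v h))) (at x)"
    by (intro derivative_intros assms)
  then show ?thesis
    by (simp add: matrix_vector_mult_add_rdistrib scaleR_matrix_vector_assoc)
qed

lemma C2_on_lincomb:
  assumes "C2_on S u" "C2_on S v"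
  shows "C2_on S (\<lambda>x. u x + c * v x)"
proof -
  obtain D H D' H' where DH: "\<And>x. x \<in> S \<Longrightarrow> GDERIV u x :> D x" "continuous_on S H"
    "\<And>x. x \<in> S \<Longrightarrow> (D has_derivative (\<lambda>h. H x *v h)) (at x)"
    and DH': "\<And>x. x \<in> S \<Longrightarrow> GDERIV v x :> D' x" "continuous_on S H'"
    "\<And>x. x \<in> S \<Longrightarrow> (D' has_derivative (\<lambda>h. H' x *v h)) (at x)"
    using assms unfolding C2_on_def by metis
  show ?thesis
    unfolding C2_on_def
  proof (intro exI[of _ "\<lambda>x. D x + c *\<^sub>R D' x"] exI[of _ "\<lambda>x. H x + c *\<^sub>R H' x"] conjI ballI)
    fix x assume x: "x \<in> S"
    show "GDERIV (\<lambda>x. u x + c * v x) x :> D x + c *\<^sub>R D' x"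
      by (intro GDERIV_lincomb DH DH' x)
    show "((\<lambda>x. D x + c *\<^sub>R D' x) has_derivative (\<lambda>h. (H x + c *\<^sub>R H' x) *v h)) (at x)"
      by (intro gradient_lincomb_deriv DH DH' x)
  next
    show "continuous_on S (\<lambda>x. H x + c *\<^sub>R H' x)"
      by (intro continuous_intros DH DH')
  qed
qed

lemma laplacian_lincomb:
  assumes "C2_on S u" "C2_on S v" "open S" "x \<in> S"
  shows "laplacian (\<lambda>x. u x + c * v x) x = laplacian u x + c * laplacian v x"
proof -
  obtain D H D' H' where DH: "\<And>x. x \<in> S \<Longrightarrow> GDERIV u x :> D x"
    "\<And>x. x \<in> S \<Longrightarrow> (D has_derivative (\<lambda>h. H x *v h)) (at x)"
    and DH': "\<And>x. x \<in> S \<Longrightarrow> GDERIV v x :> D' x"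
    "\<And>x. x \<in> S \<Longrightarrow> (D' has_derivative (\<lambda>h. H' x *v h)) (at x)"
    using assms(1,2) unfolding C2_on_def by metis
  have "laplacian (\<lambda>x. u x + c * v x) x = (\<Sum>i\<in>UNIV. (H x + c *\<^sub>R H' x) $ i $ i)"
    by (rule laplacian_trace[OF assms(3,4) GDERIV_lincomb[OF DH(1) DH'(1)]
          gradient_lincomb_deriv[OF DH(2) DH'(2)]]) (use assms(4) in auto)
  also have "\<dots> = laplacian u x + c * laplacian v x"
    using laplacian_trace[OF assms(3,4) DH] laplacian_trace[OF assms(3,4) DH'] assms(4)
    by (simp add: sum.distrib sum_distrib_left)
  finally show ?thesis .
qed

text \<open>If \<open>l < 0\<close>, the derivative, which vanishes at the minimum, is negative just
  to the right of it, and the mean value theorem produces a smaller value.\<close>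

lemma second_derivative_at_min:
  fixes \<phi> \<phi>' :: "real \<Rightarrow> real"
  assumes "0 < e" "\<And>t. \<bar>t\<bar> < e \<Longrightarrow> (\<phi> has_real_derivative \<phi>' t) (at t)"
    and "(\<phi>' has_real_derivative l) (at 0)" "\<And>t. \<bar>t\<bar> < e \<Longrightarrow> \<phi> 0 \<le> \<phi> t"
  shows "0 \<le> l"
proof (rule ccontr)
  assume "\<not> 0 \<le> l"
  then obtain d where d: "0 < d" "\<And>h. 0 < h \<Longrightarrow> h < d \<Longrightarrow> \<phi>' (0 + h) < \<phi>' 0"
    using DERIV_neg_dec_right[OF assms(3)] by (auto simp: not_le)
  have "\<phi>' 0 = 0"
    using assms(1) assms(2)[of 0] assms(4) by (intro DERIV_local_min[of \<phi> "\<phi>' 0" 0 e]) auto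
  define h where "h = min d e / 2"
  have h: "0 < h" "h < d" "h < e"
    using d assms(1) by (auto simp: h_def)
  have "\<exists>z. 0 < z \<and> z < h \<and> \<phi> h - \<phi> 0 = (h - 0) * \<phi>' z"
    using h by (intro MVT2 assms(2)) auto
  then obtain z where z: "0 < z" "z < h" "\<phi> h - \<phi> 0 = h * \<phi>' z" by auto
  then have "\<phi>' z < 0" using d(2)[of z] h \<open>\<phi>' 0 = 0\<close> by auto
  then have "h * \<phi>' z < 0" using h by (simp add: mult_pos_neg)
  with z have "\<phi> h < \<phi> 0" by simp
  with assms(4)[of h] h show False by simp
qed

lemma laplacian_at_min:
  fixes w :: "real ^ 'n \<Rightarrow> real"
  assumes "C2_on S w" "open S" "x \<in> S" "\<And>y. y \<in> S \<Longrightarrow> w x \<le> w y"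
  shows "0 \<le> laplacian w x"
proof -
  obtain D H where DH: "\<And>x. x \<in> S \<Longrightarrow> GDERIV w x :> D x"
    "\<And>x. x \<in> S \<Longrightarrow> (D has_derivative (\<lambda>h. H x *v h)) (at x)"
    using assms(1) unfolding C2_on_def by metis
  have "0 \<le> H x $ i $ i" for i
  proof -
    obtain e where e: "0 < e" "\<And>t. \<bar>t\<bar> < e \<Longrightarrow> x + t *\<^sub>R axis i 1 \<in> S"
      using axis_segment_eventually[OF assms(2,3)] by blast
    show ?thesis
    proof (rule second_derivative_at_min[OF e(1) _ gradient_component_deriv])
      show "((\<lambda>t. w (x + t *\<^sub>R axis i 1)) has_real_derivative D (x + t *\<^sub>R axis i 1) $ i) (at t)"
        if "\<bar>t\<bar> < e" for t
        using GDERIV_along[OF DH(1)[OF e(2)[OF that]]] by (simp add: inner_axis)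
      show "(D has_derivative (\<lambda>h. H x *v h)) (at x)" by (rule DH) fact
    qed (use e assms in auto)
  qed
  then show ?thesis
    using laplacian_trace[OF assms(2,3) DH] assms(3) by (simp add: sum_nonneg)
qed

section \<open>Gradient and Hessian of radial Green potentials\<close>

definition radial_gradient :: "nat \<Rightarrow> (real \<Rightarrow> real) \<Rightarrow> real ^ 'n \<Rightarrow> real ^ 'n"
  where "radial_gradient k g x = - (avg k g (norm x) *\<^sub>R x)"

text \<open>The derivative of \<open>avg k g (norm x)\<close> comes from \<open>avg_deriv\<close>.
  At \<open>x = 0\<close> the division by zero yields 0, which is the correct value of the second
  term there.\<close>

definition radial_hessian :: "nat \<Rightarrow> (real \<Rightarrow> real) \<Rightarrow> real ^ 'n \<Rightarrow> real ^ 'n ^ 'n"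
  where "radial_hessian k g x = (\<chi> i j. - (if i = j then avg k g (norm x) else 0)
    - (g (norm x) - (real k + 1) * avg k g (norm x)) * (x $ i * x $ j / (norm x)\<^sup>2))"

lemma radial_hessian_mult:
  "radial_hessian k g x *v h = - (avg k g (norm x) *\<^sub>R h)
     - ((g (norm x) - (real k + 1) * avg k g (norm x)) * (x \<bullet> h) / (norm x)\<^sup>2) *\<^sub>R x"
proof (rule vec_eq_iff[THEN iffD2, OF allI])
  fix i
  define a b where "a = avg k g (norm x)" and "b = (g (norm x) - (real k + 1) * avg k g (norm x)) / (norm x)\<^sup>2"
  have "(radial_hessian k g x *v h) $ i = (\<Sum>j\<in>UNIV. (if i = j then - a * h $ j else 0) - b * x $ i * (x $ j * h $ j))"
    unfolding matrix_vector_mult_def radial_hessian_def a_def[symmetric]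
    by (auto intro!: sum.cong simp: left_diff_distrib b_def a_def)
  also have "\<dots> = - a * h $ i - b * x $ i * (x \<bullet> h)"
    by (simp add: sum_subtractf sum_distrib_left inner_vec_def)
  finally show "(radial_hessian k g x *v h) $ i = (- (avg k g (norm x) *\<^sub>R h)
     - ((g (norm x) - (real k + 1) * avg k g (norm x)) * (x \<bullet> h) / (norm x)\<^sup>2) *\<^sub>R x) $ i"
    by (simp add: a_def b_def)
qed

lemma continuous_on_compose_norm:
  assumes "continuous_on {0..1} g"
  shows "continuous_on (cball 0 1) (\<lambda>x::real ^ 'n. g (norm x))"
  by (rule continuous_on_compose2[OF assms]) (auto intro: continuous_intros)

lemma continuous_on_radial_gradient:
  assumes "continuous_on {0..1} g"
  shows "continuous_on (cball 0 1) (radial_gradient k g)"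
  unfolding radial_gradient_def[abs_def]
  by (intro continuous_intros continuous_on_compose_norm continuous_on_avg assms)

text \<open>The quotient \<open>x $ i * x $ j / (norm x)\<^sup>2\<close> has no limit at the origin
  in general, but it is bounded by 1, and its coefficient tends to
  \<open>g 0 - (real k + 1) * avg k g 0 = 0\<close>.\<close>

lemma continuous_on_radial_hessian:
  assumes g: "continuous_on {0..1} g"
  shows "continuous_on (cball 0 1) (radial_hessian k g :: real ^ 'n \<Rightarrow> _)"
proof -
  let ?c = "\<lambda>x::real ^ 'n. g (norm x) - (real k + 1) * avg k g (norm x)"
  have c: "continuous_on (cball 0 1) ?c"
    by (intro continuous_intros continuous_on_compose_norm continuous_on_avg g)
  have "continuous_on (cball 0 1) (\<lambda>x. ?c x * (x $ i * x $ j / (norm x)\<^sup>2))" for i j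
    unfolding continuous_on
  proof
    fix x :: "real ^ 'n" assume x: "x \<in> cball 0 1"
    show "((\<lambda>x. ?c x * (x $ i * x $ j / (norm x)\<^sup>2)) \<longlongrightarrow> ?c x * (x $ i * x $ j / (norm x)\<^sup>2)) (at x within cball 0 1)"
    proof (cases "x = 0")
      case True
      have "(?c \<longlongrightarrow> ?c x) (at x within cball 0 1)"
        using c x unfolding continuous_on by blast
      then have c0: "(?c \<longlongrightarrow> 0) (at x within cball 0 1)"
        using True by simp
      have "((\<lambda>x. ?c x * (x $ i * x $ j / (norm x)\<^sup>2)) \<longlongrightarrow> 0) (at x within cball 0 1)"
      proof (rule tendsto_0_le[OF c0, of _ 1], rule always_eventually, rule allI)
        fix y :: "real ^ 'n"
        have "\<bar>y $ i * y $ j\<bar> \<le> (norm y)\<^sup>2"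
          by (simp add: abs_mult power2_eq_square mult_mono component_le_norm_cart)
        then have "\<bar>y $ i * y $ j / (norm y)\<^sup>2\<bar> \<le> 1"
          by (simp add: divide_le_eq_1 abs_divide)
        then show "norm (?c y * (y $ i * y $ j / (norm y)\<^sup>2)) \<le> norm (?c y) * 1"
          by (simp only: abs_mult real_norm_def) (intro mult_left_mono abs_ge_zero)
      qed
      then show ?thesis using True by simp
    next
      case False
      have "(?c \<longlongrightarrow> ?c x) (at x within cball 0 1)"
        using c x unfolding continuous_on by blast
      then show ?thesis
        by (rule tendsto_mult) (use False in \<open>intro tendsto_intros; simp\<close>)
    qed
  qed
  moreover have "continuous_on (cball 0 1) (\<lambda>x :: real ^ 'n. - (if i = j then avg k g (norm x) else 0))" for i j :: 'n
    by (cases "i = j") (auto intro!: continuous_intros continuous_on_compose_norm continuous_on_avg g)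
  ultimately show ?thesis
    unfolding radial_hessian_def by (intro continuous_on_vec_lambda continuous_on_diff)
qed

lemma GDERIV_green:
  assumes g: "continuous_on {0..1} g" and x: "x \<in> ball 0 1"
  shows "GDERIV (\<lambda>x. green k g (norm x)) x :> (radial_gradient k g x :: real ^ 'n)"
proof (cases "x = 0")
  case True
  have "(green k g has_derivative (\<lambda>h. 0)) (at 0 within {0..1})"
    using green_deriv_within[OF g, of 0 k] by (simp add: has_field_derivative_def mult_zero_left[abs_def])
  then have *: "\<forall>e>0. \<exists>d>0. \<forall>y\<in>{0..1}. norm (y - 0) < d \<longrightarrow> norm (green k g y - green k g 0 - 0) \<le> e * norm (y - 0)"
    unfolding has_derivative_within_alt by blast
  have "((\<lambda>x. green k g (norm x)) has_derivative (\<lambda>h. 0)) (at (0 :: real ^ 'n))"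
    unfolding has_derivative_at_alt
  proof (intro conjI allI impI)
    fix e :: real assume "0 < e"
    with * obtain d where d: "d > 0" "\<And>y. y \<in> {0..1} \<Longrightarrow> norm (y - 0) < d \<Longrightarrow> norm (green k g y - green k g 0 - 0) \<le> e * norm (y - 0)"
      by meson
    show "\<exists>d>0. \<forall>y::real ^ 'n. norm (y - 0) < d \<longrightarrow>
       norm (green k g (norm y) - green k g (norm 0) - 0) \<le> e * norm (y - 0)"
      using d(1) d(2)[of "norm y" for y :: "real ^ 'n"] by (intro exI[of _ "min d 1"]) auto
  qed simp
  then show ?thesis
    using True by (simp add: gderiv_def radial_gradient_def)
next
  case False
  with x have "0 < norm x" "norm x < 1" by auto
  from GDERIV_DERIV_compose[OF GDERIV_norm[OF False] green_deriv[OF g this, of k]] show ?thesis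
    using False by (simp add: radial_gradient_def sgn_div_norm field_simps)
qed

text \<open>At the origin continuity of \<open>avg k g\<close> suffices: a continuous factor times
  \<open>x\<close> is differentiable at 0, the derivative being multiplication by the value of that
  factor at 0.\<close>

lemma radial_gradient_deriv:
  assumes g: "continuous_on {0..1} g" and x: "x \<in> ball 0 1"
  shows "(radial_gradient k g has_derivative (\<lambda>h. radial_hessian k g x *v h)) (at (x :: real ^ 'n))"
proof (cases "x = 0")
  case True
  have "(avg k g \<longlongrightarrow> avg k g 0) (at 0 within {0..1})"
    using continuous_on_avg[OF g] unfolding continuous_on
    by (metis atLeastAtMost_iff order_refl zero_le_one)
  then have *: "\<forall>e>0. \<exists>d>0. \<forall>s\<in>{0..1}. s \<noteq> 0 \<and> dist s 0 < d \<longrightarrow> dist (avg k g s) (avg k g 0) < e"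
    unfolding Lim_within zero_less_dist_iff .
  have "(radial_gradient k g has_derivative (\<lambda>h. - (avg k g 0 *\<^sub>R h))) (at (0 :: real ^ 'n))"
    unfolding has_derivative_at_alt
  proof (intro conjI allI impI)
    show "bounded_linear (\<lambda>h :: real ^ 'n. - (avg k g 0 *\<^sub>R h))"
      by (intro bounded_linear_minus bounded_linear_scaleR_right)
    fix e :: real assume "0 < e"
    with * obtain d where d: "d > 0"
      "\<And>s. s \<in> {0..1} \<Longrightarrow> s \<noteq> 0 \<Longrightarrow> dist s 0 < d \<Longrightarrow> dist (avg k g s) (avg k g 0) < e"
      by meson
    show "\<exists>d>0. \<forall>y::real ^ 'n. norm (y - 0) < d \<longrightarrow>
       norm (radial_gradient k g y - radial_gradient k g 0 - - (avg k g 0 *\<^sub>R (y - 0))) \<le> e * norm (y - 0)"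
    proof (intro exI[of _ "min d 1"] conjI allI impI)
      fix y :: "real ^ 'n" assume y: "norm (y - 0) < min d 1"
      have "norm (radial_gradient k g y - radial_gradient k g 0 - - (avg k g 0 *\<^sub>R (y - 0)))
          = norm ((avg k g 0 - avg k g (norm y)) *\<^sub>R y)"
        by (simp add: radial_gradient_def scaleR_diff_left)
      also have "\<dots> \<le> e * norm y"
        using d(2)[of "norm y"] y by (cases "y = 0") (auto simp: dist_norm abs_minus_commute intro!: mult_right_mono)
      finally show "norm (radial_gradient k g y - radial_gradient k g 0 - - (avg k g 0 *\<^sub>R (y - 0))) \<le> e * norm (y - 0)"
        by simp
    qed (use d in auto)
  qed
  then show ?thesis
    using True by (simp add: radial_hessian_mult)
next
  case False
  with x have nx: "0 < norm x" "norm x < 1" by auto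
  let ?A' = "(g (norm x) - (real k + 1) * avg k g (norm x)) / norm x"
  have "GDERIV (\<lambda>x. avg k g (norm x)) x :> ?A' *\<^sub>R sgn x"
    by (rule GDERIV_DERIV_compose[OF GDERIV_norm[OF False] avg_deriv[OF g nx]])
  then have "((\<lambda>x. avg k g (norm x)) has_derivative (\<lambda>h. h \<bullet> ?A' *\<^sub>R sgn x)) (at x)"
    by (simp add: gderiv_def)
  then have "((\<lambda>x. - (avg k g (norm x) *\<^sub>R x)) has_derivative
      (\<lambda>h. - (avg k g (norm x) *\<^sub>R h + (h \<bullet> ?A' *\<^sub>R sgn x) *\<^sub>R x))) (at x)"
    by (intro derivative_intros)
  moreover have "h \<bullet> ?A' *\<^sub>R sgn x = (g (norm x) - (real k + 1) * avg k g (norm x)) * (x \<bullet> h) / (norm x)\<^sup>2" for h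
    by (simp add: sgn_div_norm inner_commute power2_eq_square field_simps)
  ultimately show ?thesis
    by (simp add: radial_hessian_mult radial_gradient_def[abs_def])
qed

text \<open>This makes radial Green potentials admissible test functions in
  \<open>weak_solution\<close>, for every continuous \<open>g\<close>.\<close>

lemma C2_on_closure_green:
  assumes "continuous_on {0..1} g"
  shows "C2_on_closure (ball 0 1) (\<lambda>x :: real ^ 'n. green k g (norm x))"
  unfolding C2_on_closure_def
proof (intro exI conjI ballI)
  show "continuous_on (closure (ball 0 1)) (\<lambda>x :: real ^ 'n. green k g (norm x))"
    by (simp add: continuous_on_compose_norm continuous_on_green assms)
  show "continuous_on (closure (ball 0 1)) (radial_gradient k g :: real ^ 'n \<Rightarrow> _)"
    by (simp add: continuous_on_radial_gradient assms)
  show "continuous_on (closure (ball 0 1)) (radial_hessian k g :: real ^ 'n \<Rightarrow> _)"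
    by (simp add: continuous_on_radial_hessian assms)
qed (intro GDERIV_green radial_gradient_deriv assms, assumption)+

lemma C2_on_green:
  assumes "continuous_on {0..1} g"
  shows "C2_on (ball 0 1) (\<lambda>x :: real ^ 'n. green k g (norm x))"
  unfolding C2_on_def
  by (intro exI[of _ "radial_gradient k g"] exI[of _ "radial_hessian k g"] conjI ballI
      GDERIV_green radial_gradient_deriv assms continuous_on_subset[OF continuous_on_radial_hessian]) auto

lemma laplacian_green:
  assumes "continuous_on {0..1} g" "x \<in> ball 0 1" "k + 1 = CARD('n)"
  shows "laplacian (\<lambda>x :: real ^ 'n. green k g (norm x)) x = - g (norm x)"
proof -
  have "laplacian (\<lambda>x :: real ^ 'n. green k g (norm x)) x = (\<Sum>i\<in>UNIV. radial_hessian k g x $ i $ i)"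
    by (rule laplacian_trace[OF open_ball assms(2) GDERIV_green radial_gradient_deriv]) (use assms in auto)
  also have "\<dots> = - (real CARD('n) * avg k g (norm x))
      - (g (norm x) - (real k + 1) * avg k g (norm x)) * ((\<Sum>i\<in>UNIV. x $ i * x $ i) / (norm x)\<^sup>2)"
    unfolding radial_hessian_def
    by (simp add: sum_subtractf sum_distrib_left sum_divide_distrib sum_negf add.commute)
  also have "(\<Sum>i\<in>UNIV. x $ i * x $ i) = (norm x)\<^sup>2"
    by (simp add: power2_norm_eq_inner inner_vec_def)
  also have "- (real CARD('n) * avg k g (norm x)) - (g (norm x) - (real k + 1) * avg k g (norm x)) * ((norm x)\<^sup>2 / (norm x)\<^sup>2)
      = - g (norm x)"
    using assms(3)[symmetric] by (cases "x = 0") (auto simp: field_simps)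
  finally show ?thesis .
qed

text \<open>Adding \<open>e * z\<close> with \<open>laplacian z = -1\<close> makes the inequality
  strict, which rules out an interior minimum; then \<open>e\<close> tends to 0.\<close>

lemma superharmonic_nonneg:
  fixes w :: "real ^ 'n \<Rightarrow> real"
  assumes cont: "continuous_on (cball 0 1) w" and C2: "C2_on (ball 0 1) w"
    and super: "\<And>x. x \<in> ball 0 1 \<Longrightarrow> laplacian w x \<le> 0"
    and bdry: "\<And>x. x \<in> sphere 0 1 \<Longrightarrow> 0 \<le> w x"
    and x: "x \<in> cball 0 1"
  shows "0 \<le> w x"
proof -
  define k where "k = CARD('n) - 1"
  have k: "k + 1 = CARD('n)" by (simp add: k_def)
  define z where "z x = green k (\<lambda>_. 1) (norm x)" for x :: "real ^ 'n"
  have zc: "continuous_on (cball 0 1) z"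
    unfolding z_def[abs_def] by (intro continuous_on_compose_norm continuous_on_green) simp
  have zC2: "C2_on (ball 0 1) z"
    unfolding z_def[abs_def] by (rule C2_on_green) simp
  have lz: "laplacian z x = -1" if "x \<in> ball 0 1" for x
    unfolding z_def[abs_def] using that k by (subst laplacian_green) auto
  have pos: "0 \<le> w y + e * z y" if e: "0 < e" and y: "y \<in> cball 0 1" for e y
  proof -
    let ?h = "\<lambda>x. w x + e * z x"
    have "continuous_on (cball 0 1) ?h"
      by (intro continuous_intros cont zc)
    then obtain m where m: "m \<in> cball 0 1" "\<And>y. y \<in> cball 0 1 \<Longrightarrow> ?h m \<le> ?h y"
      using continuous_attains_inf[of "cball 0 1" ?h] by auto
    have "m \<notin> ball 0 1"
    proof
      assume mb: "m \<in> ball 0 1"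
      have "0 \<le> laplacian ?h m"
        by (rule laplacian_at_min[OF C2_on_lincomb[OF C2 zC2] _ mb]) (auto intro: m(2))
      also have "laplacian ?h m = laplacian w m - e"
        using laplacian_lincomb[OF C2 zC2 _ mb] lz[OF mb] by simp
      also have "\<dots> < 0" using super[OF mb] e by simp
      finally show False by simp
    qed
    then have "m \<in> sphere 0 1" using m(1) by (auto simp: less_le)
    then have "0 \<le> ?h m"
      using bdry[of m] by (simp add: z_def)
    also have "\<dots> \<le> ?h y" by (rule m(2)[OF y])
    finally show ?thesis .
  qed
  have "((\<lambda>e. w x + e * z x) \<longlongrightarrow> w x + 0 * z x) (at_right 0)"
    by (intro tendsto_intros)
  then show ?thesis
    using pos[OF _ x] by (intro tendsto_lowerbound[of "\<lambda>e. w x + e * z x" _ "at_right 0"])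
       (auto simp: eventually_at_right_less intro: eventually_mono[OF eventually_at_right_less])
qed

section \<open>Monotone iteration\<close>

lemma green_const: "green k (\<lambda>_. c) r = c * (1 - r\<^sup>2) / (2 * (real k + 1))" if "r \<le> 1"
proof -
  define a where "a = c / (real k + 1)"
  have "((\<lambda>s. s * a) has_integral (a * 1\<^sup>2 / 2 - a * r\<^sup>2 / 2)) {r..1}"
    using that by (intro fundamental_theorem_of_calculus)
      (auto simp flip: has_real_derivative_iff_has_vector_derivative intro!: derivative_eq_intros)
  from integral_unique[OF this] have "green k (\<lambda>_. c) r = a * 1\<^sup>2 / 2 - a * r\<^sup>2 / 2"
    unfolding green_def avg_const a_def .
  then have "green k (\<lambda>_. c) r = a * (1 - r\<^sup>2) / 2"
    by (simp add: right_diff_distrib diff_divide_distrib)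
  then show ?thesis
    by (simp add: a_def)
qed

text \<open>For \<open>\<rho> r = sqrt (1 - b + b * r\<^sup>2)\<close> the product of \<rho> and its
  derivative is \<open>b * r\<close>, so \<open>green k G (\<rho> r)\<close> has the derivative
  \<open>- b * r * avg k G (\<rho> r)\<close>. Since \<rho> fixes 1, only averages remain to be
  compared, and for these \<open>\<rho> s * t \<le> \<rho> (s * t)\<close> and the monotonicity of
  \<open>G\<close> are enough.\<close>

lemma green_scaling:
  assumes G: "continuous_on {0..1} G" and b: "0 < b" "b < 1" and r: "r \<in> {0..1}"
    and anti: "\<And>x y. 0 \<le> x \<Longrightarrow> x \<le> y \<Longrightarrow> y \<le> 1 \<Longrightarrow> G y \<le> G x"
  shows "green k (\<lambda>r. b * G (sqrt (1 - b + b * r\<^sup>2))) r \<le> green k G (sqrt (1 - b + b * r\<^sup>2))"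
proof -
  define \<rho> where "\<rho> r = sqrt (1 - b + b * r\<^sup>2)" for r
  have \<rho>pos: "0 < 1 - b + b * s\<^sup>2" for s
    using b by (simp add: add_pos_nonneg)
  have \<rho>1: "1 - b + b * s\<^sup>2 \<le> 1" if "s \<in> {0..1}" for s
    using b that by (simp add: mult_left_le power_le_one)
  have \<rho>_unit: "\<rho> s \<in> {0..1}" "0 < \<rho> s" if "s \<in> {0..1}" for s
    using \<rho>pos[of s] \<rho>1[OF that] by (auto simp: \<rho>_def)
  have \<rho>_less: "\<rho> s < 1" if "s \<in> {0<..<1}" for s
  proof -
    have "s\<^sup>2 < 1" using that by (simp add: power_less_one_iff)
    then have "b * s\<^sup>2 < b * 1" using b by (intro mult_strict_left_mono)
    then show ?thesis by (simp add: \<rho>_def real_sqrt_lt_1_iff)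
  qed
  have \<rho>_cont: "continuous_on {0..1} \<rho>"
    unfolding \<rho>_def[abs_def] by (intro continuous_intros)
  have \<rho>_mono: "\<rho> s \<le> \<rho> t" if "0 \<le> s" "s \<le> t" for s t
    using that b by (simp add: \<rho>_def power_mono)
  have Gc: "continuous_on {0..1} (\<lambda>r. G (\<rho> r))"
    using \<rho>_unit by (intro continuous_on_compose2[OF G \<rho>_cont]) auto
  then have bGc: "continuous_on {0..1} (\<lambda>r. b * G (\<rho> r))"
    by (intro continuous_intros)
  have avg_le: "avg k (\<lambda>r. G (\<rho> r)) s \<le> avg k G (\<rho> s)" if s: "s \<in> {0..1}" for s
    unfolding avg_def
  proof (rule integral_le[OF avg_integrable[OF Gc s] avg_integrable[OF G \<rho>_unit(1)[OF s]]])
    fix t :: real assume t: "t \<in> {0..1}"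
    \<comment> \<open>The squares of \<open>\<rho> (s * t)\<close> and \<open>\<rho> s * t\<close>
      differ by exactly \<open>(1 - b) * (1 - t\<^sup>2)\<close>.\<close>
    have "(1 - b) * t\<^sup>2 \<le> (1 - b) * 1"
      using t b by (intro mult_left_mono) (auto simp: power_le_one)
    then have "sqrt ((1 - b + b * s\<^sup>2) * t\<^sup>2) \<le> \<rho> (s * t)"
      unfolding \<rho>_def by (simp add: algebra_simps power_mult_distrib)
    moreover have "\<rho> s * t = sqrt ((1 - b + b * s\<^sup>2) * t\<^sup>2)"
      using t by (simp add: \<rho>_def real_sqrt_mult)
    ultimately have "\<rho> s * t \<le> \<rho> (s * t)" by simp
    moreover have "0 \<le> \<rho> s * t" "\<rho> (s * t) \<le> 1"
      using t \<rho>_unit[OF s] \<rho>_unit[OF mult_unit_Icc[OF s t]] by auto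
    ultimately show "t ^ k * G (\<rho> (s * t)) \<le> t ^ k * G (\<rho> s * t)"
      using t by (intro mult_left_mono anti) auto
  qed
  define \<phi> where "\<phi> r = green k G (\<rho> r) - green k (\<lambda>r. b * G (\<rho> r)) r" for r
  have "\<phi> 1 \<le> \<phi> r"
  proof (rule DERIV_nonpos_imp_decreasing_open[of r 1 \<phi>])
    show "r \<le> 1" using r by simp
    show "continuous_on {r..1} \<phi>"
      unfolding \<phi>_def[abs_def]
      by (rule continuous_on_subset[where s="{0..1}"])
        (use r \<rho>_unit in \<open>auto intro!: continuous_intros continuous_on_green bGc continuous_on_compose2[OF continuous_on_green[OF G] \<rho>_cont]\<close>)
    fix s assume "r < s" "s < 1"
    then have s: "0 < s" "s < 1" "s \<in> {0..1}" "s \<in> {0<..<1}" using r by auto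
    have "(\<rho> has_real_derivative b * s / \<rho> s) (at s)"
      unfolding \<rho>_def[abs_def] using \<rho>pos[of s]
      by (auto intro!: derivative_eq_intros simp: field_simps)
    then have "((\<lambda>r. green k G (\<rho> r)) has_real_derivative (- (\<rho> s * avg k G (\<rho> s))) * (b * s / \<rho> s)) (at s)"
      by (intro DERIV_chain2[OF green_deriv[OF G]]) (use \<rho>_unit[OF s(3)] \<rho>_less[OF s(4)] in auto)
    then have "(\<phi> has_real_derivative (- (\<rho> s * avg k G (\<rho> s))) * (b * s / \<rho> s)
        - - (s * avg k (\<lambda>r. b * G (\<rho> r)) s)) (at s)"
      unfolding \<phi>_def[abs_def] by (intro DERIV_diff green_deriv[OF bGc s(1,2)])
    moreover have "(- (\<rho> s * avg k G (\<rho> s))) * (b * s / \<rho> s) - - (s * avg k (\<lambda>r. b * G (\<rho> r)) s)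
        = b * s * (avg k (\<lambda>r. G (\<rho> r)) s - avg k G (\<rho> s))"
      using \<rho>_unit[OF s(3)] unfolding avg_cmult by (simp add: algebra_simps)
    moreover have "\<dots> \<le> 0"
      using b s avg_le[OF s(3)] by (intro mult_nonneg_nonpos) auto
    ultimately show "\<exists>D. (\<phi> has_real_derivative D) (at s) \<and> D \<le> 0"
      by metis
  qed
  then show ?thesis
    by (simp add: \<phi>_def \<rho>_def)
qed

section \<open>Radial iterates and their limits\<close>

primrec radial_iterate :: "nat \<Rightarrow> (real \<Rightarrow> real) \<Rightarrow> real \<Rightarrow> nat \<Rightarrow> real \<Rightarrow> real" where
  "radial_iterate k f l 0 = (\<lambda>_. 0)"
| "radial_iterate k f l (Suc m) = green k (\<lambda>r. l * f (radial_iterate k f l m r))"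

text \<open>Iterates decrease in \<open>r\<close>, so the value at 0 controls them on the whole
  ball. This condition is the radial substitute for solvability.\<close>

definition iterates_bounded :: "nat \<Rightarrow> (real \<Rightarrow> real) \<Rightarrow> real \<Rightarrow> bool"
  where "iterates_bounded k f l \<longleftrightarrow> (\<exists>K. \<forall>m. radial_iterate k f l m 0 \<le> K)"

definition radial_limit :: "nat \<Rightarrow> (real \<Rightarrow> real) \<Rightarrow> real \<Rightarrow> real \<Rightarrow> real"
  where "radial_limit k f l r = lim (\<lambda>m. radial_iterate k f l m r)"

context
  fixes f :: "real \<Rightarrow> real"
  assumes adm: "admissible f"
begin

lemma admissible_derivE:
  obtains f' where "\<And>t. 0 \<le> t \<Longrightarrow> (f has_real_derivative f' t) (at t within {0..})" "continuous_on {0..} f'"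
  using adm by (auto simp: admissible_def C1_halfline_def)

lemma admissible_continuous: "continuous_on {0..} f"
  by (rule admissible_derivE) (auto intro: DERIV_continuous_on)

lemma admissible_mono: "0 \<le> a \<Longrightarrow> a \<le> b \<Longrightarrow> f a \<le> f b"
  using adm by (auto simp: admissible_def mono_on_def)

lemma admissible_pos: "0 \<le> a \<Longrightarrow> 0 < f a"
  using admissible_mono[of 0 a] adm by (simp add: admissible_def)

lemma continuous_on_source:
  assumes "continuous_on {0..1} z" "\<And>r. r \<in> {0..1} \<Longrightarrow> 0 \<le> z r"
  shows "continuous_on {0..1} (\<lambda>r. l * f (z r))"
  by (intro continuous_intros continuous_on_compose2[OF admissible_continuous assms(1)]) (use assms(2) in auto)

lemma radial_iterate_regular:
  assumes "0 \<le> l"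
  shows "continuous_on {0..1} (radial_iterate k f l m) \<and> (\<forall>r\<in>{0..1}. 0 \<le> radial_iterate k f l m r)"
proof (induction m)
  case (Suc m)
  then have c: "continuous_on {0..1} (\<lambda>r. l * f (radial_iterate k f l m r))"
    by (intro continuous_on_source) auto
  then show ?case
    using Suc assms admissible_pos
    by (auto intro!: continuous_on_green green_nonneg mult_nonneg_nonneg simp: less_imp_le)
qed auto

context
  fixes l :: real
  assumes l: "0 \<le> l"
begin

lemma continuous_on_iterate: "continuous_on {0..1} (radial_iterate k f l m)"
  and iterate_nonneg: "r \<in> {0..1} \<Longrightarrow> 0 \<le> radial_iterate k f l m r"
  using radial_iterate_regular[OF l] by auto

lemma continuous_on_iterate_source: "continuous_on {0..1} (\<lambda>r. c * f (radial_iterate k f l m r))"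
  by (intro continuous_on_source continuous_on_iterate iterate_nonneg)

lemma iterate_source_nonneg: "r \<in> {0..1} \<Longrightarrow> 0 \<le> l * f (radial_iterate k f l m r)"
  using l admissible_pos[OF iterate_nonneg] by (simp add: less_imp_le)

lemma iterate_antimono:
  assumes "0 \<le> r" "r \<le> s" "s \<le> 1"
  shows "radial_iterate k f l m s \<le> radial_iterate k f l m r"
  using assms by (cases m) (auto intro!: green_antimono continuous_on_iterate_source iterate_source_nonneg)

lemma iterate_le_Suc: "r \<in> {0..1} \<Longrightarrow> radial_iterate k f l m r \<le> radial_iterate k f l (Suc m) r"
proof (induction m arbitrary: r)
  case 0
  then show ?case using iterate_nonneg[OF 0, of k "Suc 0"] by simp
next
  case (Suc m)
  have "green k (\<lambda>r. l * f (radial_iterate k f l m r)) r \<le> green k (\<lambda>r. l * f (radial_iterate k f l (Suc m) r)) r"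
    using Suc l by (intro green_mono continuous_on_iterate_source mult_left_mono admissible_mono iterate_nonneg) auto
  then show ?case by simp
qed

end

lemma iterate_mono_parameter:
  assumes "0 \<le> l" "l \<le> l'"
  shows "r \<in> {0..1} \<Longrightarrow> radial_iterate k f l m r \<le> radial_iterate k f l' m r"
proof (induction m arbitrary: r)
  case (Suc m)
  have l': "0 \<le> l'" using assms by simp
  have "l * f (radial_iterate k f l m t) \<le> l' * f (radial_iterate k f l' m t)" if "t \<in> {0..1}" for t
    using assms l' Suc.IH[OF that] iterate_nonneg[OF assms(1) that] iterate_nonneg[OF l' that]
    by (intro mult_mono admissible_mono) (auto intro: less_imp_le admissible_pos)
  then show ?case
    using Suc.prems assms l' by (auto intro!: green_mono continuous_on_iterate_source)
qed simp

text \<open>Induction along \<open>green_scaling\<close>, whose factor \<open>b\<close> is absorbed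
  into the parameter. At \<open>r = 0\<close> a bound at the positive radius
  \<open>sqrt (1 - b)\<close> for \<open>l\<close> becomes a bound at the origin for
  \<open>b * l\<close>.\<close>

lemma iterate_scaling:
  assumes "0 \<le> l" "0 < b" "b < 1"
  shows "r \<in> {0..1} \<Longrightarrow> radial_iterate k f (b * l) m r \<le> radial_iterate k f l m (sqrt (1 - b + b * r\<^sup>2))"
proof (induction m arbitrary: r)
  case (Suc m)
  let ?\<rho> = "\<lambda>r. sqrt (1 - b + b * r\<^sup>2)" and ?G = "\<lambda>r. l * f (radial_iterate k f l m r)"
  have bl: "0 \<le> b * l" using assms by simp
  have \<rho>: "?\<rho> t \<in> {0..1}" if "t \<in> {0..1}" for t
    using assms that by (auto simp: mult_left_le power_le_one)
  have Gc: "continuous_on {0..1} ?G"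
    by (intro continuous_on_iterate_source assms)
  have "green k (\<lambda>r. (b * l) * f (radial_iterate k f (b * l) m r)) r \<le> green k (\<lambda>r. b * ?G (?\<rho> r)) r"
  proof (rule green_mono)
    show "continuous_on {0..1} (\<lambda>r. b * ?G (?\<rho> r))"
      using \<rho> by (intro continuous_intros continuous_on_compose2[OF Gc, where f="?\<rho>"]) auto
    fix t :: real assume "t \<in> {0..1}"
    then show "(b * l) * f (radial_iterate k f (b * l) m t) \<le> b * ?G (?\<rho> t)"
      using assms Suc.IH by (auto simp: mult.assoc intro!: mult_left_mono admissible_mono iterate_nonneg)
  qed (use Suc bl in \<open>auto intro!: continuous_on_iterate_source\<close>)
  also have "\<dots> \<le> green k ?G (?\<rho> r)"
    using assms Suc.prems
    by (intro green_scaling Gc) (auto intro!: mult_left_mono admissible_mono iterate_antimono iterate_nonneg)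
  finally show ?case by simp
qed simp

context
  fixes l :: real and k :: nat
  assumes l: "0 \<le> l" and bdd: "iterates_bounded k f l"
begin

lemma iterates_tendsto:
  assumes "r \<in> {0..1}"
  shows "(\<lambda>m. radial_iterate k f l m r) \<longlonglongrightarrow> radial_limit k f l r"
proof -
  obtain K where K: "\<And>m. radial_iterate k f l m 0 \<le> K"
    using bdd by (auto simp: iterates_bounded_def)
  have "radial_iterate k f l m r \<le> K" for m
    using iterate_antimono[OF l, of 0 r k m] K[of m] assms by auto
  then have "\<exists>L. (\<lambda>m. radial_iterate k f l m r) \<longlonglongrightarrow> L"
    using incseq_convergent[of "\<lambda>m. radial_iterate k f l m r" K] iterate_le_Suc[OF l assms]
    by (metis incseq_SucI)
  then show ?thesis
    by (simp add: radial_limit_def convergent_def convergent_LIMSEQ_iff[symmetric])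
qed

lemma iterate_le_limit: "r \<in> {0..1} \<Longrightarrow> radial_iterate k f l m r \<le> radial_limit k f l r"
  by (rule incseq_le[OF incseq_SucI iterates_tendsto]) (rule iterate_le_Suc[OF l])

lemma radial_limit_nonneg: "r \<in> {0..1} \<Longrightarrow> 0 \<le> radial_limit k f l r"
  using iterate_le_limit[of r 0] by simp

lemma radial_limit_antimono: "0 \<le> r \<Longrightarrow> r \<le> s \<Longrightarrow> s \<le> 1 \<Longrightarrow> radial_limit k f l s \<le> radial_limit k f l r"
  by (rule LIMSEQ_le[OF iterates_tendsto iterates_tendsto]) (auto intro: iterate_antimono l)

text \<open>The constant \<open>l * f (?Z 0)\<close> dominates all sources, so the integral equation
  passes to the limit, first inside \<open>avg\<close> and then inside \<open>green\<close>.
  Continuity comes last: it is not automatic for a monotone limit, but holds for the indefinite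
  integral on the right.\<close>

lemma radial_limit_regular:
  "continuous_on {0..1} (radial_limit k f l)"
  "r \<in> {0..1} \<Longrightarrow> radial_limit k f l r = green k (\<lambda>r. l * f (radial_limit k f l r)) r"
proof -
  let ?Z = "radial_limit k f l" and ?u = "radial_iterate k f l"
  define C where "C = l * f (?Z 0)"
  have C: "0 \<le> l * f (?u m r)" "l * f (?u m r) \<le> C" if "r \<in> {0..1}" for m r
  proof -
    have "?u m r \<le> ?Z 0"
      using iterate_le_limit[OF that, of m] radial_limit_antimono[of 0 r] that by auto
    then show "l * f (?u m r) \<le> C"
      using l iterate_nonneg[OF l that] by (auto simp: C_def intro!: mult_left_mono admissible_mono)
  qed (rule iterate_source_nonneg[OF l that])
  have source: "(\<lambda>m. l * f (?u m r)) \<longlonglongrightarrow> l * f (?Z r)" if "r \<in> {0..1}" for r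
    using iterate_nonneg[OF l that] radial_limit_nonneg[OF that]
    by (intro tendsto_mult_left continuous_on_tendsto_compose[OF admissible_continuous iterates_tendsto[OF that]])
      auto
  have avg_lim: "(\<lambda>m. avg k (\<lambda>r. l * f (?u m r)) s) \<longlonglongrightarrow> avg k (\<lambda>r. l * f (?Z r)) s" if s: "s \<in> {0..1}" for s
    unfolding avg_def
  proof (rule dominated_convergence(2)[where h="\<lambda>_. C"])
    fix m and t :: real assume t: "t \<in> {0..1}"
    show "norm (t ^ k * (l * f (?u m (s * t)))) \<le> C"
    proof -
      have "norm (t ^ k * (l * f (?u m (s * t)))) = t ^ k * (l * f (?u m (s * t)))"
        using t C(1)[OF mult_unit_Icc[OF s t]] by simp
      also have "\<dots> \<le> 1 * C"
        using t C[OF mult_unit_Icc[OF s t]] by (intro mult_mono power_le_one) auto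
      finally show ?thesis by simp
    qed
    show "(\<lambda>m. t ^ k * (l * f (?u m (s * t)))) \<longlonglongrightarrow> t ^ k * (l * f (?Z (s * t)))"
      by (intro tendsto_mult_left source mult_unit_Icc s t)
  qed (intro avg_integrable continuous_on_iterate_source l s integrable_const_ivl)+
  have avg_bound: "norm (s * avg k (\<lambda>r. l * f (?u m r)) s) \<le> C" if s: "s \<in> {0..1}" for s m
  proof -
    have c: "continuous_on {0..1} (\<lambda>r. l * f (?u m r))" by (rule continuous_on_iterate_source[OF l])
    have "0 \<le> avg k (\<lambda>r. l * f (?u m r)) s"
      by (intro avg_nonneg c C s)
    moreover have "avg k (\<lambda>r. l * f (?u m r)) s \<le> avg k (\<lambda>_. C) s"
      by (intro avg_mono c C s) auto
    moreover have "avg k (\<lambda>_. C) s \<le> C"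
      using C[of 0 0] by (auto simp: divide_le_eq distrib_left)
    moreover have "s * avg k (\<lambda>r. l * f (?u m r)) s \<le> 1 * avg k (\<lambda>r. l * f (?u m r)) s"
      using s calculation by (intro mult_right_mono) auto
    ultimately show ?thesis using s by auto
  qed
  have green_lim:
    "(\<lambda>s. s * avg k (\<lambda>r. l * f (?Z r)) s) integrable_on {r..1}"
    "(\<lambda>m. green k (\<lambda>r. l * f (?u m r)) r) \<longlonglongrightarrow> green k (\<lambda>r. l * f (?Z r)) r" if "r \<in> {0..1}" for r
  proof -
    have 1: "(\<lambda>s. s * avg k (\<lambda>r. l * f (?u m r)) s) integrable_on {r..1}" for m
      using that by (intro integrable_continuous_real continuous_on_subset[OF continuous_on_id_avg]
        continuous_on_iterate_source l) auto
    have 2: "norm (s * avg k (\<lambda>r. l * f (?u m r)) s) \<le> C" if "s \<in> {r..1}" for s m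
      using that \<open>r \<in> {0..1}\<close> by (intro avg_bound) auto
    have 3: "(\<lambda>m. s * avg k (\<lambda>r. l * f (?u m r)) s) \<longlonglongrightarrow> s * avg k (\<lambda>r. l * f (?Z r)) s" if "s \<in> {r..1}" for s
      using that \<open>r \<in> {0..1}\<close> by (intro tendsto_mult_left avg_lim) auto
    show "(\<lambda>s. s * avg k (\<lambda>r. l * f (?Z r)) s) integrable_on {r..1}"
      "(\<lambda>m. green k (\<lambda>r. l * f (?u m r)) r) \<longlonglongrightarrow> green k (\<lambda>r. l * f (?Z r)) r"
      unfolding green_def using dominated_convergence[OF 1 integrable_const_ivl 2 3] by blast+
  qed
  show eq: "?Z r = green k (\<lambda>r. l * f (?Z r)) r" if "r \<in> {0..1}" for r
    using LIMSEQ_unique[OF LIMSEQ_Suc[OF iterates_tendsto[OF that]]] green_lim(2)[OF that] by simp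
  have "continuous_on {0..1} (green k (\<lambda>r. l * f (?Z r)))"
    unfolding green_def[abs_def]
    by (rule indefinite_integral_continuous_1'[OF green_lim(1)]) simp
  then show "continuous_on {0..1} ?Z"
    by (rule continuous_on_eq) (rule eq[symmetric])
qed

end

text \<open>Each step is the maximum principle on the ball for \<open>v\<close> minus the next
  iterate, so \<open>v\<close> need not be radial; the sign of the Laplacian comes from the
  monotonicity of \<open>f\<close>.\<close>

lemma iterate_le_classical:
  fixes v :: "real ^ 'n \<Rightarrow> real"
  assumes k: "k + 1 = CARD('n)" and l: "0 \<le> l" and v: "classical_solution f l v"
  shows "x \<in> cball 0 1 \<Longrightarrow> radial_iterate k f l m (norm x) \<le> v x"
proof (induction m arbitrary: x)
  case 0
  then show ?case
    using v unfolding classical_solution_def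
    by (cases "norm x = 1") (auto simp: less_le)
next
  case (Suc m)
  let ?u = "\<lambda>x :: real ^ 'n. green k (\<lambda>r. l * f (radial_iterate k f l m r)) (norm x)"
  note c = continuous_on_iterate_source[OF l, of l k m]
  have v': "continuous_on (cball 0 1) v" "C2_on (ball 0 1) v"
    "\<And>x. x \<in> ball 0 1 \<Longrightarrow> laplacian v x = - (l * f (v x))" "\<And>x. x \<in> sphere 0 1 \<Longrightarrow> v x = 0"
    using v unfolding classical_solution_def by (fastforce simp: equation_minus_iff)+
  have "0 \<le> v x + (-1) * ?u x"
  proof (rule superharmonic_nonneg)
    show "continuous_on (cball 0 1) (\<lambda>x. v x + (-1) * ?u x)"
      by (intro continuous_intros v' continuous_on_compose_norm continuous_on_green c)
    show "C2_on (ball 0 1) (\<lambda>x. v x + (-1) * ?u x)"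
      by (intro C2_on_lincomb v' C2_on_green c)
    show "0 \<le> v x + (-1) * ?u x" if "x \<in> sphere 0 1" for x
      using v'(4)[OF that] that by simp
    show "laplacian (\<lambda>x. v x + (-1) * ?u x) x \<le> 0" if x: "x \<in> ball 0 1" for x
    proof -
      have "laplacian (\<lambda>x. v x + (-1) * ?u x) x = laplacian v x + (-1) * laplacian ?u x"
        by (rule laplacian_lincomb[OF v'(2) C2_on_green[OF c] open_ball x])
      also have "laplacian ?u x = - (l * f (radial_iterate k f l m (norm x)))"
        by (intro laplacian_green c x k)
      also have "laplacian v x + (-1) * - (l * f (radial_iterate k f l m (norm x)))
          = l * (f (radial_iterate k f l m (norm x)) - f (v x))"
        using v'(3)[OF x] by (simp add: algebra_simps)
      also have "\<dots> \<le> 0"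
        using Suc.IH[of x] x l
        by (intro mult_nonneg_nonpos) (auto intro!: admissible_mono iterate_nonneg)
      finally show ?thesis .
    qed
  qed (rule Suc.prems)
  then show ?case by simp
qed

lemma classical_iterates_bounded:
  fixes v :: "real ^ 'n \<Rightarrow> real"
  assumes "k + 1 = CARD('n)" "0 \<le> l" "classical_solution f l v"
  shows "iterates_bounded k f l"
  using iterate_le_classical[OF assms, of 0] by (auto simp: iterates_bounded_def)

lemma radial_limit_minimal:
  assumes k: "k + 1 = CARD('n)" and l: "0 < l" and bdd: "iterates_bounded k f l"
  shows "minimal_solution f l (\<lambda>x :: real ^ 'n. radial_limit k f l (norm x))"
proof -
  let ?Z = "radial_limit k f l"
  have l0: "0 \<le> l" using l by simp
  note Z = radial_limit_regular[OF l0 bdd]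
  let ?z = "\<lambda>x :: real ^ 'n. green k (\<lambda>r. l * f (?Z r)) (norm x)"
  have c: "continuous_on {0..1} (\<lambda>r. l * f (?Z r))"
    by (intro continuous_on_source Z radial_limit_nonneg l0 bdd)
  have zZ: "?z x = ?Z (norm x)" if "x \<in> cball 0 1" for x
    using Z(2)[of "norm x"] that by auto
  \<comment> \<open>\<open>?Z\<close> agrees with a Green potential only for radii up to 1, so
    derivatives are transferred on the open ball instead of rewriting the function.\<close>
  have eq: "GDERIV (\<lambda>x. ?Z (norm x)) x :> d \<longleftrightarrow> GDERIV ?z x :> d" if "x \<in> ball 0 1" for x d
    unfolding gderiv_def
    by (intro iffI; erule has_derivative_transform_within_open[OF _ open_ball that]) (simp_all add: zZ)
  have C2: "C2_on (ball 0 1) (\<lambda>x :: real ^ 'n. ?Z (norm x))"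
    using C2_on_green[OF c, where 'n='n and k=k] eq unfolding C2_on_def by metis
  have lap: "laplacian (\<lambda>x :: real ^ 'n. ?Z (norm x)) x = - (l * f (?Z (norm x)))" if x: "x \<in> ball 0 1" for x
  proof -
    have "laplacian (\<lambda>x :: real ^ 'n. ?Z (norm x)) x = (\<Sum>i\<in>UNIV. radial_hessian k (\<lambda>r. l * f (?Z r)) x $ i $ i)"
      by (rule laplacian_trace[OF open_ball x _ radial_gradient_deriv[OF c x]]) (simp add: eq GDERIV_green c)
    also have "\<dots> = laplacian ?z x"
      by (rule laplacian_trace[OF open_ball x GDERIV_green radial_gradient_deriv, symmetric]) (use c x in auto)
    also have "\<dots> = - (l * f (?Z (norm x)))"
      by (intro laplacian_green c x k)
    finally show ?thesis .
  qed
  \<comment> \<open>The first iterate has the constant source \<open>l * f 0\<close> and is an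
    explicit positive paraboloid.\<close>
  have pos: "0 < ?Z r" if "r \<in> {0..<1}" for r
  proof -
    have "r\<^sup>2 < 1" using that by (simp add: power_less_one_iff)
    then have "0 < green k (\<lambda>_. l * f 0) r"
      using that l admissible_pos[of 0] by (simp add: green_const)
    also have "green k (\<lambda>_. l * f 0) r \<le> ?Z r"
      using iterate_le_limit[OF l0 bdd, of r "Suc 0"] that by simp
    finally show ?thesis .
  qed
  have classical: "classical_solution f l (\<lambda>x :: real ^ 'n. ?Z (norm x))"
    unfolding classical_solution_def
    using C2 lap pos Z(2)[of 1] by (auto intro: continuous_on_compose_norm Z)
  moreover have "?Z (norm x) \<le> v x" if v: "classical_solution f l v" and x: "x \<in> cball 0 1" for v and x :: "real ^ 'n"
    by (rule LIMSEQ_le_const2[OF iterates_tendsto[OF l0 bdd]])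
      (use x iterate_le_classical[OF k l0 v x] in auto)
  ultimately show ?thesis
    by (simp add: minimal_solution_def)
qed

text \<open>Two minimal solutions bound each other, so the family chosen in
  \<open>extremal_solution\<close> can always be replaced by radial limits.\<close>

lemma minimal_solution_radial:
  fixes u :: "real ^ 'n \<Rightarrow> real"
  assumes k: "k + 1 = CARD('n)" and l: "0 < l" and u: "minimal_solution f l u"
  shows "iterates_bounded k f l" "x \<in> cball 0 1 \<Longrightarrow> u x = radial_limit k f l (norm x)"
proof -
  show bdd: "iterates_bounded k f l"
    using u l classical_iterates_bounded[OF k] by (auto simp: minimal_solution_def)
  show "u x = radial_limit k f l (norm x)" if "x \<in> cball 0 1"
    using radial_limit_minimal[OF k l bdd] u that
    by (intro antisym) (auto simp: minimal_solution_def)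
qed

end

section \<open>Weak solutions\<close>

text \<open>As much of polar coordinates as radial integrands require: both measures assign to each
  ray \<open>{x<..}\<close> the volume of a spherical shell, and finite measures on the line are
  determined by their values on rays.\<close>

lemma distr_norm_unit_ball:
  assumes k: "k + 1 = CARD('n)"
  shows "distr (density lborel (indicator (ball (0 :: real ^ 'n) 1))) borel norm =
    density lborel (\<lambda>t. ennreal ((real k + 1) * measure lborel (ball (0 :: real ^ 'n) 1) * t ^ k) * indicator {0..1} t)"
    (is "?M = ?N")
proof -
  define B where "B = ball (0 :: real ^ 'n) 1"
  define \<omega> where "\<omega> = measure lborel B"
  have \<omega>: "0 \<le> \<omega>" by (simp add: \<omega>_def)
  \<comment> \<open>Clamping to the unit interval covers all rays by one formula.\<close>
  define a where "a x = min 1 (max 0 x)" for x :: real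
  have DIM: "DIM(real ^ 'n) = Suc k" using k by simp
  have M: "emeasure ?M {x<..} = ennreal (\<omega> * (1 - a x ^ (k + 1)))" for x
  proof -
    have "emeasure ?M {x<..} = emeasure (density lborel (indicator B)) (norm -` {x<..} \<inter> UNIV)"
      unfolding B_def by (subst emeasure_distr) (auto simp: space_density)
    also have "\<dots> = emeasure lborel (B \<inter> (norm -` {x<..}))"
    proof -
      have "(norm :: real ^ 'n \<Rightarrow> real) -` {x<..} \<in> sets lborel"
        using borel_open[OF open_vimage[OF open_greaterThan continuous_on_norm_id, of x]] by simp
      then show ?thesis
        using emeasure_restricted[of B lborel "norm -` {x<..}"] by (simp add: B_def)
    qed
    also have "\<dots> = ennreal (\<omega> * (1 - a x ^ (k + 1)))"
    proof -
      consider "x < 0" | "0 \<le> x" "x < 1" | "1 \<le> x" by linarith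
      then show ?thesis
      proof cases
        case 1
        then have "B \<inter> (norm -` {x<..}) = B" using less_le_trans[OF _ norm_ge_zero] by blast
        moreover have "a x = 0" using 1 by (simp add: a_def)
        ultimately show ?thesis
          using emeasure_lborel_ball_finite[of "0 :: real ^ 'n" 1]
          by (simp add: \<omega>_def B_def emeasure_eq_ennreal_measure)
      next
        case 2
        then have eq: "B \<inter> (norm -` {x<..}) = B - cball 0 x" by (auto simp: B_def)
        have "measure lborel (B - cball 0 x) = measure lborel B - measure lborel (cball (0 :: real ^ 'n) x)"
          using 2 emeasure_lborel_ball_finite[of "0 :: real ^ 'n" 1]
          by (intro measure_Diff) (auto simp: B_def)
        also have "\<dots> = \<omega> * (1 - a x ^ (k + 1))"
          using 2 content_ball_conv_unit_ball[of x "0 :: real ^ 'n"] DIM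
          by (simp add: content_cball_conv_ball a_def \<omega>_def B_def algebra_simps)
        finally have "measure lborel (B - cball 0 x) = \<omega> * (1 - a x ^ (k + 1))" .
        moreover have "emeasure lborel (B - cball 0 x) < \<infinity>"
          using emeasure_lborel_ball_finite[of "0 :: real ^ 'n" 1]
          by (rule le_less_trans[OF emeasure_mono, rotated 2]) (auto simp: B_def)
        ultimately show ?thesis
          unfolding eq by (simp add: emeasure_eq_ennreal_measure)
      next
        case 3
        then have "B \<inter> (norm -` {x<..}) = {}" by (auto simp: B_def)
        then show ?thesis using 3 by (simp add: a_def)
      qed
    qed
    finally show ?thesis .
  qed
  have N: "emeasure ?N {x<..} = ennreal (\<omega> * (1 - a x ^ (k + 1)))" for x
  proof -
    let ?c = "\<lambda>t. (real k + 1) * \<omega> * t ^ k"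
    have "emeasure ?N {x<..} = (\<integral>\<^sup>+t. ennreal (?c t) * indicator {0..1} t * indicator {x<..} t \<partial>lborel)"
      by (subst emeasure_density) (auto simp: \<omega>_def B_def)
    also have "\<dots> = (\<integral>\<^sup>+t. ennreal (?c t) * indicator {a x..1} t \<partial>lborel)"
      using AE_lborel_singleton[of "a x"]
      by (intro nn_integral_cong_AE, eventually_elim) (auto simp: a_def split: split_indicator)
    also have "\<dots> = ennreal (\<omega> * 1 ^ (k + 1) - \<omega> * a x ^ (k + 1))"
    proof (rule nn_integral_FTC_Icc[where F="\<lambda>t. \<omega> * t ^ (k + 1)"])
      show "((\<lambda>t. \<omega> * t ^ (k + 1)) has_real_derivative ?c t) (at t)" for t
        by (rule DERIV_cong[OF DERIV_cmult[OF DERIV_pow]]) (simp add: algebra_simps)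
      show "0 \<le> ?c t" if "t \<in> {a x..1}" for t
        using that \<omega> by (auto simp: a_def)
    qed (auto simp: a_def)
    finally show ?thesis
      by (simp add: right_diff_distrib)
  qed
  show ?thesis
    by (rule measure_eqI_lessThan) (simp_all add: M N)
qed

lemma integral_unit_ball_radial:
  assumes k: "k + 1 = CARD('n)" and g: "continuous_on {0..1} g"
  shows "(LINT x:ball (0 :: real ^ 'n) 1|lebesgue. g (norm x)) =
    (real k + 1) * measure lborel (ball (0 :: real ^ 'n) 1) * integral {0..1} (\<lambda>t. t ^ k * g t)"
proof -
  define B where "B = ball (0 :: real ^ 'n) 1"
  define c where "c = (real k + 1) * measure lborel (ball (0 :: real ^ 'n) 1)"
  have c: "0 \<le> c" by (simp add: c_def)
  define h where "h t = indicator {0..1} t *\<^sub>R g t" for t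
  have h: "h \<in> borel_measurable borel"
    unfolding h_def[abs_def] by (rule borel_measurable_continuous_on_indicator[OF _ g]) simp
  have "(LINT x:B|lebesgue. g (norm x)) = (LINT x|lebesgue. indicator B x *\<^sub>R h (norm x))"
    unfolding set_lebesgue_integral_def B_def
    by (intro Bochner_Integration.integral_cong) (auto simp: h_def split: split_indicator)
  also have "\<dots> = (LINT x|lborel. indicator B x *\<^sub>R h (norm x))"
  proof (rule integral_completion)
    have [measurable]: "B \<in> sets borel" "h \<in> borel_measurable borel"
      using h by (auto simp: B_def)
    show "(\<lambda>x. indicator B x *\<^sub>R h (norm x)) \<in> borel_measurable lborel"
      by measurable
  qed
  also have "\<dots> = (LINT x|density lborel (indicator B). h (norm x))"
  proof -
    have "density lborel (indicator B) = density lborel (\<lambda>x. ennreal (indicator B x))"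
      by (simp add: ennreal_indicator)
    then show ?thesis
      using h by (simp only:) (subst integral_density; auto simp: B_def intro!: borel_measurable_indicator)
  qed
  also have "\<dots> = (LINT t|distr (density lborel (indicator B)) borel norm. h t)"
    using h by (subst integral_distr) auto
  also have "\<dots> = (LINT t|density lborel (\<lambda>t. ennreal (c * t ^ k * indicator {0..1} t)). h t)"
    unfolding B_def distr_norm_unit_ball[OF k] c_def
    by (simp add: ennreal_mult'' ennreal_indicator)
  also have "\<dots> = (LINT t|lborel. (c * t ^ k * indicator {0..1} t) *\<^sub>R h t)"
    using h c by (subst integral_density) (auto split: split_indicator)
  also have "\<dots> = (LINT t:{0..1}|lborel. c * (t ^ k * g t))"
    unfolding set_lebesgue_integral_def
    by (intro Bochner_Integration.integral_cong) (auto simp: h_def split: split_indicator)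
  also have "\<dots> = integral {0..1} (\<lambda>t. c * (t ^ k * g t))"
  proof (rule set_borel_integral_eq_integral(2))
    show "set_integrable lborel {0..1} (\<lambda>t. c * (t ^ k * g t))"
      unfolding set_integrable_def
      by (intro borel_integrable_compact continuous_intros g) simp
  qed
  also have "\<dots> = c * integral {0..1} (\<lambda>t. t ^ k * g t)"
    by simp
  finally show ?thesis
    by (simp add: B_def c_def)
qed

text \<open>Green's second identity: \<open>W\<close> is the boundary term. It vanishes at 0 through
  the power of \<open>r\<close> and at 1 because Green potentials do.\<close>

lemma green_self_adjoint:
  assumes g: "continuous_on {0..1} g" and h: "continuous_on {0..1} h"
  shows "integral {0..1} (\<lambda>t. t ^ k * (green k g t * h t)) = integral {0..1} (\<lambda>t. t ^ k * (g t * green k h t))"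
proof -
  define W where "W r = green k g r * (r ^ (k + 1) * avg k h r) - green k h r * (r ^ (k + 1) * avg k g r)" for r
  have "((\<lambda>t. t ^ k * (green k g t * h t) - t ^ k * (g t * green k h t)) has_integral W 1 - W 0) {0..1}"
  proof (rule fundamental_theorem_of_calculus_interior)
    show "continuous_on {0..1} W"
      unfolding W_def[abs_def] by (intro continuous_intros continuous_on_green continuous_on_avg g h)
    fix r :: real assume "r \<in> {0<..<1}"
    then have r: "0 < r" "r < 1" by auto
    have "(W has_real_derivative
        (- (r * avg k g r) * (r ^ (k + 1) * avg k h r) + (r ^ k * h r) * green k g r)
        - (- (r * avg k h r) * (r ^ (k + 1) * avg k g r) + (r ^ k * g r) * green k h r)) (at r)"
      unfolding W_def[abs_def]
      by (intro DERIV_diff DERIV_mult green_deriv power_avg_deriv g h r)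
    then show "(W has_vector_derivative r ^ k * (green k g r * h r) - r ^ k * (g r * green k h r)) (at r)"
      unfolding has_real_derivative_iff_has_vector_derivative[symmetric]
      by (rule DERIV_cong) (simp add: algebra_simps)
  qed simp
  then have "integral {0..1} (\<lambda>t. t ^ k * (green k g t * h t) - t ^ k * (g t * green k h t)) = 0"
    by (simp add: integral_unique W_def)
  moreover have "integral {0..1} (\<lambda>t. t ^ k * (green k g t * h t) - t ^ k * (g t * green k h t))
      = integral {0..1} (\<lambda>t. t ^ k * (green k g t * h t)) - integral {0..1} (\<lambda>t. t ^ k * (g t * green k h t))"
    by (intro Henstock_Kurzweil_Integration.integral_diff integrable_continuous_real continuous_intros
        continuous_on_green g h)
  ultimately show ?thesis by simp
qed

lemma set_integrable_mult_bounded: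
  fixes v h :: "real ^ 'n \<Rightarrow> real"
  assumes v: "set_integrable lebesgue (ball 0 1) v" and h: "continuous_on (ball 0 1) h"
    and C: "\<And>x. x \<in> ball 0 1 \<Longrightarrow> \<bar>h x\<bar> \<le> C"
  shows "set_integrable lebesgue (ball 0 1) (\<lambda>x. v x * h x)"
proof -
  have "(\<lambda>x. indicator (ball 0 1) x *\<^sub>R h x) \<in> borel_measurable lebesgue"
    using borel_measurable_continuous_on_indicator[OF _ h] by (intro measurable_completion) simp
  moreover have "(\<lambda>x. indicator (ball 0 1) x *\<^sub>R v x) \<in> borel_measurable lebesgue"
    using v unfolding set_integrable_def by (rule borel_measurable_integrable)
  ultimately have "(\<lambda>x. (indicator (ball 0 1) x *\<^sub>R v x) * (indicator (ball 0 1) x *\<^sub>R h x)) \<in> borel_measurable lebesgue"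
    by measurable
  moreover have "(\<lambda>x. (indicator (ball 0 1) x *\<^sub>R v x) * (indicator (ball 0 1) x *\<^sub>R h x))
      = (\<lambda>x. indicator (ball 0 1) x *\<^sub>R (v x * h x))"
    by (auto split: split_indicator)
  ultimately have m: "(\<lambda>x. indicator (ball 0 1) x *\<^sub>R (v x * h x)) \<in> borel_measurable lebesgue"
    by simp
  have "integrable lebesgue (\<lambda>x. C * (indicator (ball 0 1) x *\<^sub>R v x))"
    using v unfolding set_integrable_def by simp
  then show ?thesis
    unfolding set_integrable_def
  proof (rule Bochner_Integration.integrable_bound[OF _ m], intro AE_I2)
    fix x :: "real ^ 'n"
    show "norm (indicator (ball 0 1) x *\<^sub>R (v x * h x)) \<le> norm (C * (indicator (ball 0 1) x *\<^sub>R v x))"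
    proof (cases "x \<in> ball 0 1")
      case True
      then have "\<bar>h x\<bar> \<le> \<bar>C\<bar>" using C by force
      then show ?thesis
        using True by (simp add: abs_mult mult.commute mult_right_mono)
    qed simp
  qed
qed

lemma set_integrable_radial:
  fixes g :: "real \<Rightarrow> real"
  assumes "continuous_on {0..1} g"
  shows "set_integrable lebesgue (ball 0 1) (\<lambda>x :: real ^ 'n. g (norm x))"
proof -
  have c: "continuous_on (cball 0 1) (\<lambda>x :: real ^ 'n. g (norm x))"
    by (rule continuous_on_compose_norm[OF assms])
  have "set_integrable lebesgue (cball 0 1) (\<lambda>x :: real ^ 'n. g (norm x))"
    unfolding set_integrable_def
    using borel_integrable_compact[OF compact_cball c] borel_measurable_continuous_on_indicator[OF _ c]
    by (subst integrable_completion) auto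
  then show ?thesis
    by (rule set_integrable_subset) auto
qed

text \<open>\<open>weak_solution\<close> controls \<open>f (u x)\<close> only with the weight
  \<open>1 - norm x\<close>; this bound lets that weight absorb a Green potential.\<close>

lemma green_le_boundary_distance:
  assumes "continuous_on {0..1} g" "\<And>t. t \<in> {0..1} \<Longrightarrow> 0 \<le> g t"
  obtains C where "\<And>r. r \<in> {0..1} \<Longrightarrow> \<bar>green k g r\<bar> \<le> C * (1 - r)"
proof -
  have "compact ((\<lambda>s. s * avg k g s) ` {0..1})"
    by (intro compact_continuous_image continuous_on_id_avg assms compact_Icc)
  then obtain C where C: "\<And>s. s \<in> {0..1} \<Longrightarrow> s * avg k g s \<le> C"
    using bounded_imp_bdd_above compact_imp_bounded by (metis (no_types, lifting) bdd_above.E image_eqI)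
  show ?thesis
  proof
    fix r :: real assume r: "r \<in> {0..1}"
    have "green k g r \<le> integral {r..1} (\<lambda>_. C)"
      unfolding green_def
      by (intro integral_le integrable_continuous_real continuous_on_subset[OF continuous_on_id_avg]
          assms C) (use r in auto)
    then show "\<bar>green k g r\<bar> \<le> C * (1 - r)"
      using r green_nonneg[OF assms(1) r assms(2)] by (simp add: mult.commute)
  qed
qed

section \<open>Tangent lines of the nonlinearity and comparison with weak solutions\<close>

context
  fixes f :: "real \<Rightarrow> real"
  assumes adm: "admissible f"
begin

text \<open>The tangent inequality for convex functions applies at interior points; the endpoint 0
  follows by moving the point of tangency to 0, using continuity of \<open>f'\<close>.\<close>

lemma admissible_tangent:
  assumes deriv: "\<And>t. 0 \<le> t \<Longrightarrow> (f has_real_derivative f' t) (at t within {0..})"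
    and f': "continuous_on {0..} f'" and "0 \<le> x" "0 \<le> y"
  shows "f x + f' x * (y - x) \<le> f y"
proof -
  have pos: "f x + f' x * (y - x) \<le> f y" if "0 < x" for x
    using convex_on_imp_above_tangent[of "{0..}" f x y "f' x"] deriv[of x] that adm \<open>0 \<le> y\<close>
    by (auto simp: admissible_def)
  show ?thesis
  proof (cases "x = 0")
    case True
    have "(f' \<longlongrightarrow> f' 0) (at_right 0)" "(f \<longlongrightarrow> f 0) (at_right 0)"
      using f' admissible_continuous[OF adm] unfolding continuous_on
      by (auto intro: tendsto_within_subset[of _ _ _ "{0..}"])
    then have "((\<lambda>x. f x + f' x * (y - x)) \<longlongrightarrow> f 0 + f' 0 * (y - 0)) (at_right 0)"
      by (intro tendsto_intros)
    then show ?thesis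
      unfolding True
      by (rule tendsto_upperbound) (auto intro: eventually_mono[OF eventually_at_right_less pos])
  qed (use pos assms in auto)
qed

lemma admissible_deriv_mono:
  assumes deriv: "\<And>t. 0 \<le> t \<Longrightarrow> (f has_real_derivative f' t) (at t within {0..})"
    and f': "continuous_on {0..} f'" and "0 \<le> x" "x \<le> y"
  shows "f' x \<le> f' y"
proof (cases "x = y")
  case False
  have "f x + f' x * (y - x) \<le> f y" "f y + f' y * (x - y) \<le> f x"
    using assms by (auto intro!: admissible_tangent[OF deriv f'])
  then have "0 \<le> (f' y - f' x) * (y - x)" by (simp add: algebra_simps)
  then show ?thesis
    using assms False by (simp add: zero_le_mult_iff)
qed simp

lemma admissible_deriv_nonneg:
  assumes deriv: "\<And>t. 0 \<le> t \<Longrightarrow> (f has_real_derivative f' t) (at t within {0..})"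
    and f': "continuous_on {0..} f'" and "0 \<le> x"
  shows "0 \<le> f' x"
proof -
  have pos: "0 \<le> f' y" if "0 < y" for y
  proof -
    have "f y + f' y * (0 - y) \<le> f 0"
      using that by (intro admissible_tangent[OF deriv f']) auto
    moreover have "f 0 \<le> f y" using that by (intro admissible_mono[OF adm]) auto
    ultimately have "0 \<le> f' y * y" by simp
    then show ?thesis using that by (simp add: zero_le_mult_iff)
  qed
  show ?thesis
  proof (cases "x = 0")
    case True
    have "(f' \<longlongrightarrow> f' 0) (at_right 0)"
      using f' unfolding continuous_on
      by (auto intro: tendsto_within_subset[of _ _ _ "{0..}"])
    then show ?thesis
      unfolding True
      by (rule tendsto_lowerbound) (auto intro: eventually_mono[OF eventually_at_right_less pos])
  qed (use pos assms in auto)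
qed

context
  fixes v :: "real ^ 'n \<Rightarrow> real" and l :: real and k :: nat
  assumes k: "k + 1 = CARD('n)" and l: "0 < l" and v: "weak_solution f l v"
begin

text \<open>The test function \<open>green k \<theta>\<close> turns the Laplacian into an arbitrary
  continuous radial weight \<theta>.\<close>

lemma weak_radial_test:
  assumes \<theta>: "continuous_on {0..1} \<theta>"
  shows "(LINT x:ball 0 1|lebesgue. v x * \<theta> (norm x)) = l * (LINT x:ball 0 1|lebesgue. f (v x) * green k \<theta> (norm x))"
proof -
  have "(LINT x:ball 0 1|lebesgue. v x * (- laplacian (\<lambda>x. green k \<theta> (norm x)) x))
      = l * (LINT x:ball 0 1|lebesgue. f (v x) * green k \<theta> (norm x))"
    using v C2_on_closure_green[OF \<theta>] unfolding weak_solution_def by force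
  moreover have "(LINT x:ball 0 1|lebesgue. v x * (- laplacian (\<lambda>x. green k \<theta> (norm x)) x))
      = (LINT x:ball 0 1|lebesgue. v x * \<theta> (norm x))"
    using laplacian_green[OF \<theta> _ k] by (intro set_lebesgue_integral_cong) auto
  ultimately show ?thesis by simp
qed

lemma weak_test_integrable:
  assumes \<theta>: "continuous_on {0..1} \<theta>"
  shows "set_integrable lebesgue (ball 0 1) (\<lambda>x. v x * \<theta> (norm x))"
proof -
  have "bounded (\<theta> ` {0..1})"
    by (intro compact_imp_bounded compact_continuous_image \<theta> compact_Icc)
  then obtain C where "\<And>t. t \<in> {0..1} \<Longrightarrow> \<bar>\<theta> t\<bar> \<le> C"
    unfolding bounded_iff by (metis image_eqI real_norm_def)
  then show ?thesis
    using v by (intro set_integrable_mult_bounded[of v _ C] continuous_on_subset[OF continuous_on_compose_norm[OF \<theta>]])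
      (auto simp: weak_solution_def)
qed

lemma weak_source_integrable:
  assumes \<theta>: "continuous_on {0..1} \<theta>" "\<And>t. t \<in> {0..1} \<Longrightarrow> 0 \<le> \<theta> t"
  shows "set_integrable lebesgue (ball 0 1) (\<lambda>x. f (v x) * green k \<theta> (norm x))"
proof -
  obtain C where C: "\<And>r. r \<in> {0..1} \<Longrightarrow> \<bar>green k \<theta> r\<bar> \<le> C * (1 - r)"
    using green_le_boundary_distance[OF \<theta>] by blast
  have "set_integrable lebesgue (ball 0 1) (\<lambda>x. (f (v x) * (1 - norm x)) * (green k \<theta> (norm x) / (1 - norm x)))"
  proof (rule set_integrable_mult_bounded)
    show "continuous_on (ball 0 1) (\<lambda>x :: real ^ 'n. green k \<theta> (norm x) / (1 - norm x))"
      by (intro continuous_intros continuous_on_subset[OF continuous_on_compose_norm[OF continuous_on_green[OF \<theta>(1)]]])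
        auto
    show "\<bar>green k \<theta> (norm x) / (1 - norm x)\<bar> \<le> C" if "x \<in> ball 0 1" for x :: "real ^ 'n"
      using C[of "norm x"] that by (simp add: abs_divide divide_le_eq)
  qed (use v in \<open>auto simp: weak_solution_def\<close>)
  then show ?thesis
    unfolding set_integrable_def
    by (rule Bochner_Integration.integrable_cong[THEN iffD1, rotated 2]) (auto split: split_indicator)
qed

text \<open>The tangent line of \<open>f\<close> at the radial iterate turns the comparison principle for possibly
  nonradial \<open>v\<close> into statements about radial test functions only.\<close>

lemma weak_ge_iterate:
  "continuous_on {0..1} \<theta> \<Longrightarrow> (\<And>t. t \<in> {0..1} \<Longrightarrow> 0 \<le> \<theta> t) \<Longrightarrow>
    (LINT x:ball (0 :: real ^ 'n) 1|lebesgue. radial_iterate k f l m (norm x) * \<theta> (norm x))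
      \<le> (LINT x:ball 0 1|lebesgue. v x * \<theta> (norm x))"
proof (induction m arbitrary: \<theta>)
  case 0
  have "(LINT x:ball (0 :: real ^ 'n) 1|lebesgue. 0) \<le> (LINT x:ball 0 1|lebesgue. v x * \<theta> (norm x))"
    using v 0(2)
    by (intro set_integral_mono_AE[OF _ weak_test_integrable[OF 0(1)]])
      (auto simp: weak_solution_def set_integrable_def elim!: eventually_mono)
  then show ?case by simp
next
  case (Suc m)
  let ?u = "radial_iterate k f l m" and ?z = "green k \<theta>"
  have l0: "0 \<le> l" using l by simp
  obtain f' where f': "\<And>t. 0 \<le> t \<Longrightarrow> (f has_real_derivative f' t) (at t within {0..})" "continuous_on {0..} f'"
    using admissible_derivE[OF adm] by blast
  note uc = continuous_on_iterate[OF adm l0, of k m] and u0 = iterate_nonneg[OF adm l0, of _ k m]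
  have zc: "continuous_on {0..1} ?z" by (intro continuous_on_green Suc)
  have z0: "0 \<le> ?z t" if "t \<in> {0..1}" for t by (intro green_nonneg Suc that)
  have f'u: "continuous_on {0..1} (\<lambda>r. f' (?u r))"
    by (rule continuous_on_compose2[OF f'(2) uc]) (use u0 in auto)
  \<comment> \<open>The slope of the tangent line times the test function. The induction hypothesis
    is applied with this weight, hence the generalization over \<theta>.\<close>
  define \<theta>' where "\<theta>' r = l * (f' (?u r) * ?z r)" for r
  have \<theta>'c: "continuous_on {0..1} \<theta>'"
    unfolding \<theta>'_def[abs_def] by (intro continuous_intros f'u zc)
  have \<theta>'0: "0 \<le> \<theta>' t" if "t \<in> {0..1}" for t
    using that l0 z0 admissible_deriv_nonneg[OF f' u0] by (auto simp: \<theta>'_def)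
  have fuc: "continuous_on {0..1} (\<lambda>r. l * f (?u r))"
    by (rule continuous_on_iterate_source[OF adm l0])
  let ?I = "\<lambda>g. LINT x:ball (0 :: real ^ 'n) 1|lebesgue. g x"
  let ?a = "\<lambda>x :: real ^ 'n. l * f (?u (norm x)) * ?z (norm x)"
  let ?b = "\<lambda>x. v x * \<theta>' (norm x)"
  let ?c = "\<lambda>x :: real ^ 'n. ?u (norm x) * \<theta>' (norm x)"
  have ia: "set_integrable lebesgue (ball 0 1) ?a"
    by (rule set_integrable_radial) (intro continuous_intros fuc zc)
  have ib: "set_integrable lebesgue (ball 0 1) ?b"
    by (rule weak_test_integrable[OF \<theta>'c])
  have ic: "set_integrable lebesgue (ball 0 1) ?c"
    by (rule set_integrable_radial) (intro continuous_intros uc \<theta>'c)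
  have iv: "set_integrable lebesgue (ball 0 1) (\<lambda>x. l * (f (v x) * ?z (norm x)))"
    using weak_source_integrable[OF Suc.prems] by simp
  have "?I (\<lambda>x. radial_iterate k f l (Suc m) (norm x) * \<theta> (norm x)) = ?I ?a"
  proof -
    have "?I (\<lambda>x. green k (\<lambda>r. l * f (?u r)) (norm x) * \<theta> (norm x)) = ?I (\<lambda>x. l * f (?u (norm x)) * ?z (norm x))"
      using integral_unit_ball_radial[OF k, of "\<lambda>r. green k (\<lambda>r. l * f (?u r)) r * \<theta> r"]
        integral_unit_ball_radial[OF k, of "\<lambda>r. l * f (?u r) * ?z r"]
        green_self_adjoint[OF fuc Suc.prems(1), of k]
      by (simp only: continuous_on_mult continuous_on_green fuc zc Suc.prems(1))
    then show ?thesis by simp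
  qed
  also have "\<dots> \<le> ?I ?a + (?I ?b - ?I ?c)"
    using Suc.IH[OF \<theta>'c \<theta>'0] by simp
  also have "\<dots> = ?I (\<lambda>x. ?a x + (?b x - ?c x))"
    using ia ib ic by (simp add: set_integral_add set_integral_diff)
  also have "\<dots> \<le> ?I (\<lambda>x. l * (f (v x) * ?z (norm x)))"
  proof (rule set_integral_mono_AE[OF _ iv])
    show "set_integrable lebesgue (ball 0 1) (\<lambda>x. ?a x + (?b x - ?c x))"
      using ia ib ic by (intro set_integral_add set_integral_diff)
    have "AE x in lebesgue. x \<in> ball 0 1 \<longrightarrow> v x \<ge> 0"
      using v by (simp add: weak_solution_def)
    then show "AE x\<in>ball 0 1 in lebesgue. ?a x + (?b x - ?c x) \<le> l * (f (v x) * ?z (norm x))"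
    proof eventually_elim
      case (elim x)
      show ?case
      proof
        assume x: "x \<in> ball 0 1"
        then have n: "norm x \<in> {0..1}" by auto
        have "f (?u (norm x)) + f' (?u (norm x)) * (v x - ?u (norm x)) \<le> f (v x)"
          using elim x u0[OF n] by (intro admissible_tangent[OF f']) auto
        then have "(l * ?z (norm x)) * (f (?u (norm x)) + f' (?u (norm x)) * (v x - ?u (norm x)))
            \<le> (l * ?z (norm x)) * f (v x)"
          using l0 z0[OF n] by (intro mult_left_mono) auto
        then show "?a x + (?b x - ?c x) \<le> l * (f (v x) * ?z (norm x))"
          by (simp add: \<theta>'_def algebra_simps)
      qed
    qed
  qed
  also have "\<dots> = ?I (\<lambda>x. v x * \<theta> (norm x))"
    using weak_radial_test[OF Suc.prems(1)] by simp
  finally show ?case .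
qed

text \<open>An iterate decreases in \<open>r\<close>, so its value at \<open>r\<close> is at most
  its mean over the ball of radius \<open>r\<close>; that mean is controlled by the integral of
  \<open>v\<close> through \<open>weak_ge_iterate\<close> with weight 1.\<close>

lemma weak_iterate_locally_bounded:
  assumes r: "0 < r" "r \<le> 1"
  shows "\<exists>K. \<forall>m. radial_iterate k f l m r \<le> K"
proof -
  let ?I = "LINT x:ball 0 1|lebesgue. v x" and ?\<omega> = "measure lborel (ball (0 :: real ^ 'n) 1)"
  have l0: "0 \<le> l" using l by simp
  have \<omega>: "0 < ?\<omega>" using content_ball_pos[of 1 "0 :: real ^ 'n"] by simp
  have "radial_iterate k f l m r \<le> ?I / (?\<omega> * r ^ (k + 1))" for m
  proof -
    let ?u = "radial_iterate k f l m"
    note uc = continuous_on_iterate[OF adm l0, of k m]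
    have "avg k (\<lambda>_. ?u r) r \<le> avg k ?u r"
    proof -
      have "integral {0..1} (\<lambda>t. t ^ k * ?u r) \<le> integral {0..1} (\<lambda>t. t ^ k * ?u (r * t))"
      proof (rule integral_le)
        show "(\<lambda>t. t ^ k * ?u r) integrable_on {0..1}"
          by (intro integrable_continuous_real continuous_intros)
        show "(\<lambda>t. t ^ k * ?u (r * t)) integrable_on {0..1}"
          using r by (intro avg_integrable uc) simp
        show "t ^ k * ?u r \<le> t ^ k * ?u (r * t)" if "t \<in> {0..1}" for t
          using r that by (intro mult_left_mono iterate_antimono[OF adm l0]) (auto simp: mult_left_le)
      qed
      then show ?thesis by (simp add: avg_def integral_power_unit)
    qed
    then have "r ^ (k + 1) * (?u r / (real k + 1)) \<le> r ^ (k + 1) * avg k ?u r"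
      using r by (intro mult_left_mono) auto
    also have "\<dots> = integral {0..r} (\<lambda>t. t ^ k * ?u t)"
      using r by (intro power_avg) simp
    also have "\<dots> \<le> integral {0..1} (\<lambda>t. t ^ k * ?u t)"
      using r iterate_nonneg[OF adm l0]
      by (intro integral_subset_le integrable_continuous_real continuous_intros continuous_on_subset[OF uc]) auto
    finally have *: "r ^ (k + 1) * ?u r \<le> (real k + 1) * integral {0..1} (\<lambda>t. t ^ k * ?u t)"
      by (simp add: divide_le_eq mult.commute)
    have "?\<omega> * (r ^ (k + 1) * ?u r) \<le> (real k + 1) * ?\<omega> * integral {0..1} (\<lambda>t. t ^ k * ?u t)"
      using mult_left_mono[OF *, of ?\<omega>] \<omega> by (simp add: mult_ac)
    also have "\<dots> \<le> ?I"
      using weak_ge_iterate[of "\<lambda>_. 1" m] integral_unit_ball_radial[OF k uc] by simp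
    finally show ?thesis
      using \<omega> r by (simp add: le_divide_eq mult_ac)
  qed
  then show ?thesis by blast
qed

text \<open>The bound from \<open>v\<close> may blow up at the origin. Scaling by
  \<open>b = l' / l\<close> evaluates it at \<open>sqrt (1 - b)\<close> instead.\<close>

lemma weak_iterates_bounded:
  assumes "0 < l'" "l' < l"
  shows "iterates_bounded k f l'"
proof -
  define b where "b = l' / l"
  have b: "0 < b" "b < 1" "b * l = l'" using assms by (auto simp: b_def)
  obtain K where K: "\<And>m. radial_iterate k f l m (sqrt (1 - b)) \<le> K"
    using weak_iterate_locally_bounded[of "sqrt (1 - b)"] b by auto
  have "radial_iterate k f l' m 0 \<le> radial_iterate k f l m (sqrt (1 - b))" for m
    using iterate_scaling[OF adm _ b(1,2), of l 0 k m] l b by simp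
  then show ?thesis
    using K unfolding iterates_bounded_def by (meson order_trans)
qed

end

end

section \<open>The singular profile\<close>

lemma continuous_on_Ioc_iff:
  fixes h :: "real \<Rightarrow> real"
  shows "continuous_on {0<..1} h \<longleftrightarrow> (\<forall>e. 0 < e \<longrightarrow> e \<le> 1 \<longrightarrow> continuous_on {e..1} h)" (is "?L \<longleftrightarrow> ?R")
proof
  show ?R if ?L by (auto intro: continuous_on_subset[OF that])
next
  assume R: ?R
  show ?L
    unfolding continuous_on_eq_continuous_within
  proof
    fix x :: real assume x: "x \<in> {0<..1}"
    then have "continuous_on {x/2..1} h" using R by auto
    then have "continuous (at x within {x/2..1}) h"
      using x by (auto simp: continuous_on_eq_continuous_within)
    moreover have "at x within {x/2..1} = at x within {0<..1}"
      by (rule at_within_nhd[of _ "{x/2<..}"]) (use x in auto)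
    ultimately show "continuous (at x within {0<..1}) h"
      by (simp add: continuous_within)
  qed
qed

lemma continuous_on_Icc_extend_zero:
  fixes h :: "real \<Rightarrow> real"
  assumes h: "continuous_on {0<..1} h" "h 0 = 0" and C: "\<And>t. 0 < t \<Longrightarrow> t \<le> 1 \<Longrightarrow> \<bar>h t\<bar> \<le> C * t"
  shows "continuous_on {0..1} h"
  unfolding continuous_on_eq_continuous_within
proof
  fix x :: real assume x: "x \<in> {0..1}"
  show "continuous (at x within {0..1}) h"
  proof (cases "x = 0")
    case True
    have "((\<lambda>t. t) \<longlongrightarrow> (0::real)) (at 0 within {0..1})" by (rule tendsto_ident_at)
    then have "(h \<longlongrightarrow> 0) (at 0 within {0..1})"
      by (rule tendsto_0_le[where K=C]) (use C in \<open>auto simp: eventually_at_filter mult.commute\<close>)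
    then show ?thesis using h True by (simp add: continuous_within)
  next
    case False
    then have "continuous (at x within {0<..1}) h"
      using x h by (auto simp: continuous_on_eq_continuous_within)
    moreover have "at x within {0<..1} = at x within {0..1}"
      by (rule at_within_nhd[of _ "{0<..}"]) (use x False in auto)
    ultimately show ?thesis by (simp add: continuous_within)
  qed
qed

text \<open>Here \<open>k = N - 1\<close>, so \<open>real k - 1\<close> is \<open>N - 2\<close>, and
  \<open>p\<close> is the radial profile of \<Psi>.\<close>

locale singular_potential =
  fixes k :: nat and p :: "real \<Rightarrow> real"
  assumes k: "10 \<le> k"
    and p_cont: "continuous_on {0<..1} p"
    and p_anti: "\<And>r s. 0 < r \<Longrightarrow> r \<le> s \<Longrightarrow> s \<le> 1 \<Longrightarrow> p s \<le> p r"
    and p_lower: "\<And>r. 0 < r \<Longrightarrow> r \<le> 1 \<Longrightarrow> 2 * (real k - 1) / r\<^sup>2 \<le> p r"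
    and p_upper: "\<And>r. 0 < r \<Longrightarrow> r \<le> 1 \<Longrightarrow> p r \<le> (real k - 1)\<^sup>2 / (4 * r\<^sup>2)"
begin

text \<open>Any \<open>\<kappa>\<close> strictly between the two exponents solving \<open>\<kappa> (k - 3 - \<kappa>) = (k - 1) (k - 9) / 4\<close>
  and below their mean \<open>(k - 3) / 2\<close> would do.\<close>

definition kap :: real
  where "kap = (real k - 5) / 2"

lemma kap_pos: "0 < kap" and real_k: "real k = 2 * kap + 5"
  using k by (auto simp: kap_def field_simps)

lemma p_pos: "0 < r \<Longrightarrow> r \<le> 1 \<Longrightarrow> 0 < p r"
  using p_lower[of r] k by (auto intro: less_le_trans[rotated])

text \<open>What is left of \<open>p\<close> above the potential for which \<open>1 / r\<close>
  solves the linearized equation. Its sign makes the Picard iteration below monotone.\<close>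

definition excess :: "real \<Rightarrow> real"
  where "excess r = p r - 2 * (real k - 1) / r\<^sup>2"

lemma excess_nonneg: "0 < r \<Longrightarrow> r \<le> 1 \<Longrightarrow> 0 \<le> excess r"
  using p_lower by (simp add: excess_def)

text \<open>The upper bound on \<open>p\<close> gives \<open>(kap + 2) * (kap - 2)\<close>. The
  larger constant \<open>kap * (kap + 2)\<close> equals \<open>kap * (k - 3 - kap)\<close>, for
  which \<open>r powr (- kap)\<close> is an exact solution and hence a barrier.\<close>

lemma excess_le:
  assumes "0 < r" "r \<le> 1"
  shows "excess r \<le> kap * (kap + 2) / r\<^sup>2"
proof -
  have "excess r \<le> (real k - 1)\<^sup>2 / (4 * r\<^sup>2) - 2 * (real k - 1) / r\<^sup>2"
    using p_upper[OF assms] by (simp add: excess_def)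
  also have "\<dots> = ((kap + 2) * (kap - 2)) / r\<^sup>2"
    using assms by (simp add: real_k field_simps power2_eq_square)
  also have "\<dots> \<le> (kap * (kap + 2)) / r\<^sup>2"
    using kap_pos by (intro divide_right_mono) (auto simp: algebra_simps)
  finally show ?thesis .
qed

section \<open>The Volterra equation for the less singular solution\<close>

definition subcritical :: "(real \<Rightarrow> real) \<Rightarrow> bool"
  where "subcritical h \<longleftrightarrow> continuous_on {0<..1} h \<and> (\<forall>r. 0 < r \<longrightarrow> r \<le> 1 \<longrightarrow> 0 \<le> h r \<and> h r \<le> r powr (- kap))"

definition weighted :: "(real \<Rightarrow> real) \<Rightarrow> real \<Rightarrow> real"
  where "weighted h t = t ^ (k - 2) * excess t * h t"

definition flux :: "(real \<Rightarrow> real) \<Rightarrow> real \<Rightarrow> real"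
  where "flux h s = integral {0..s} (weighted h)"

text \<open>Two integrations of \<open>(r ^ (k - 2) * y')' = - weighted y\<close>: the flux
  \<open>- r ^ (k - 2) * y'\<close> starts from 0 at the origin, and the normalization is
  \<open>y 1 = 1\<close>. The multiplicative constant fixed here is the one that stays free in the
  uniqueness claim.\<close>

definition volterra :: "(real \<Rightarrow> real) \<Rightarrow> real \<Rightarrow> real"
  where "volterra h r = 1 + integral {r..1} (\<lambda>s. flux h s / s ^ (k - 2))"

lemma power_powr: "0 < t \<Longrightarrow> t ^ (k - 2) = t powr (2 * kap + 3)"
  using k real_k by (simp add: powr_realpow[symmetric] of_nat_diff add.commute)

lemma weighted_zero [simp]: "weighted h 0 = 0"
  using k by (simp add: weighted_def)

lemma weighted_bounds:
  assumes "subcritical h" "0 < t" "t \<le> 1"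
  shows "0 \<le> weighted h t" "weighted h t \<le> kap * (kap + 2) * t powr (kap + 1)"
proof -
  have h: "0 \<le> h t" "h t \<le> t powr (- kap)"
    using assms by (auto simp: subcritical_def)
  show "0 \<le> weighted h t"
    using h excess_nonneg[OF assms(2,3)] assms by (simp add: weighted_def)
  have "excess t * h t \<le> kap * (kap + 2) / t\<^sup>2 * t powr (- kap)"
    using h excess_nonneg[OF assms(2,3)] excess_le[OF assms(2,3)] kap_pos by (intro mult_mono) auto
  then have "weighted h t \<le> t ^ (k - 2) * (kap * (kap + 2) / t\<^sup>2 * t powr (- kap))"
    using assms unfolding weighted_def mult.assoc by (intro mult_left_mono) auto
  also have "\<dots> = kap * (kap + 2) * (t powr (2 * kap + 3) * t powr (- 2) * t powr (- kap))"
    using assms by (simp add: power_powr powr_minus_divide)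
  also have "t powr (2 * kap + 3) * t powr (- 2) * t powr (- kap) = t powr (kap + 1)"
    by (simp add: powr_add[symmetric])
  finally show "weighted h t \<le> kap * (kap + 2) * t powr (kap + 1)" .
qed

lemma continuous_on_weighted:
  assumes "subcritical h"
  shows "continuous_on {0..1} (weighted h)"
proof (rule continuous_on_Icc_extend_zero[where C="kap * (kap + 2)"])
  show "continuous_on {0<..1} (weighted h)"
    using assms unfolding weighted_def[abs_def] excess_def[abs_def] subcritical_def
    by (intro continuous_intros p_cont) auto
  fix t :: real assume t: "0 < t" "t \<le> 1"
  have "t powr (kap + 1) \<le> t powr 1"
    using t kap_pos by (intro powr_mono') auto
  then have "kap * (kap + 2) * t powr (kap + 1) \<le> kap * (kap + 2) * t"
    using kap_pos t by (intro mult_left_mono) auto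
  then show "\<bar>weighted h t\<bar> \<le> kap * (kap + 2) * t"
    using weighted_bounds[OF assms t] by simp
qed simp

lemma weighted_integrable: "subcritical h \<Longrightarrow> 0 \<le> s \<Longrightarrow> s \<le> 1 \<Longrightarrow> weighted h integrable_on {0..s}"
  by (intro integrable_continuous_real continuous_on_subset[OF continuous_on_weighted]) auto

lemma flux_bounds:
  assumes h: "subcritical h" and s: "0 < s" "s \<le> 1"
  shows "0 \<le> flux h s" "flux h s \<le> kap * s powr (kap + 2)"
proof -
  have w: "0 \<le> weighted h t \<and> weighted h t \<le> kap * (kap + 2) * t powr (kap + 1)" if "t \<in> {0..s}" for t
    using weighted_bounds[OF h, of t] that s by (cases "t = 0") auto
  show "0 \<le> flux h s"
    unfolding flux_def using w s by (intro integral_nonneg weighted_integrable h) auto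
  have "((\<lambda>t. t powr (kap + 1)) has_integral s powr (kap + 1 + 1) / (kap + 1 + 1)) {0..s}"
    using kap_pos s by (intro has_integral_powr_from_0) auto
  from has_integral_mult_right[OF this, of "kap * (kap + 2)"]
  have I: "((\<lambda>t. kap * (kap + 2) * t powr (kap + 1)) has_integral kap * s powr (kap + 2)) {0..s}"
    by (rule has_integral_eq_rhs) (use kap_pos in \<open>simp add: add.assoc\<close>)
  have "flux h s \<le> integral {0..s} (\<lambda>t. kap * (kap + 2) * t powr (kap + 1))"
    unfolding flux_def using w s
    by (intro integral_le weighted_integrable h has_integral_integrable[OF I]) auto
  then show "flux h s \<le> kap * s powr (kap + 2)"
    unfolding integral_unique[OF I] .
qed

lemma flux_div_bounds:
  assumes h: "subcritical h" and s: "0 < s" "s \<le> 1"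
  shows "0 \<le> flux h s / s ^ (k - 2)" "flux h s / s ^ (k - 2) \<le> kap * s powr (- kap - 1)"
proof -
  show "0 \<le> flux h s / s ^ (k - 2)" using flux_bounds[OF assms] s by simp
  have "flux h s / s ^ (k - 2) \<le> kap * s powr (kap + 2) / s powr (2 * kap + 3)"
    using flux_bounds[OF assms] s by (simp add: power_powr divide_right_mono)
  also have "\<dots> = kap * s powr (- kap - 1)"
    using powr_diff[of s "kap + 2" "2 * kap + 3"] by simp
  finally show "flux h s / s ^ (k - 2) \<le> kap * s powr (- kap - 1)" .
qed

lemma continuous_on_flux:
  assumes "subcritical h"
  shows "continuous_on {0..1} (flux h)"
  unfolding flux_def[abs_def]
  by (rule indefinite_integral_continuous_1) (rule weighted_integrable[OF assms], auto)

lemma continuous_on_flux_div: "subcritical h \<Longrightarrow> 0 < r \<Longrightarrow> continuous_on {r..1} (\<lambda>s. flux h s / s ^ (k - 2))"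
  by (intro continuous_intros continuous_on_subset[OF continuous_on_flux]) auto

lemma flux_div_integrable: "subcritical h \<Longrightarrow> 0 < r \<Longrightarrow> (\<lambda>s. flux h s / s ^ (k - 2)) integrable_on {r..1}"
  by (intro integrable_continuous_real continuous_on_flux_div)

lemma integral_kap_powr:
  assumes "0 < r" "r \<le> 1"
  shows "((\<lambda>s. kap * s powr (- kap - 1)) has_integral r powr (- kap) - 1) {r..1}"
proof -
  have "((\<lambda>s. kap * s powr (- kap - 1)) has_integral (- (1 powr (- kap))) - (- (r powr (- kap)))) {r..1}"
    using assms by (intro fundamental_theorem_of_calculus)
      (auto simp flip: has_real_derivative_iff_has_vector_derivative intro!: derivative_eq_intros)
  then show ?thesis by simp
qed

lemma volterra_ge_1:
  assumes h: "subcritical h" and r: "0 < r" "r \<le> 1"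
  shows "1 \<le> volterra h r"
  unfolding volterra_def using flux_div_bounds[OF h] r
  by (auto intro!: integral_nonneg flux_div_integrable h)

text \<open>The flux bound makes the integrand at most \<open>kap * s powr (- kap - 1)\<close>,
  minus the derivative of the barrier. Its integral \<open>r powr (- kap) - 1\<close> and the
  leading 1 of \<open>volterra\<close> add up to the barrier exactly.\<close>

lemma subcritical_volterra:
  assumes h: "subcritical h"
  shows "subcritical (volterra h)"
  unfolding subcritical_def
proof (intro conjI allI impI)
  show "continuous_on {0<..1} (volterra h)"
    unfolding continuous_on_Ioc_iff volterra_def[abs_def]
    by (intro allI impI continuous_intros indefinite_integral_continuous_1' flux_div_integrable h)
  fix r :: real assume r: "0 < r" "r \<le> 1"
  show "0 \<le> volterra h r" using volterra_ge_1[OF h r] by simp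
  have "integral {r..1} (\<lambda>s. flux h s / s ^ (k - 2)) \<le> integral {r..1} (\<lambda>s. kap * s powr (- kap - 1))"
    using r by (intro integral_le flux_div_integrable h has_integral_integrable[OF integral_kap_powr] flux_div_bounds) auto
  then show "volterra h r \<le> r powr (- kap)"
    using integral_unique[OF integral_kap_powr[OF r]] by (simp add: volterra_def)
qed

lemma volterra_mono:
  assumes h: "subcritical h" "subcritical h'" and r: "0 < r" "r \<le> 1"
    and le: "\<And>t. 0 < t \<Longrightarrow> t \<le> 1 \<Longrightarrow> h t \<le> h' t"
  shows "volterra h r \<le> volterra h' r"
proof -
  have "weighted h t \<le> weighted h' t" if "t \<in> {0..1}" for t
  proof (cases "t = 0")
    case False
    then show ?thesis
      using that le[of t] excess_nonneg[of t] unfolding weighted_def by (intro mult_left_mono) auto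
  qed simp
  then have "flux h s \<le> flux h' s" if "0 \<le> s" "s \<le> 1" for s
    unfolding flux_def using that by (intro integral_le weighted_integrable h) auto
  then show ?thesis
    unfolding volterra_def using r
    by (auto intro!: integral_le flux_div_integrable h divide_right_mono)
qed

primrec picard :: "nat \<Rightarrow> real \<Rightarrow> real" where
  "picard 0 = (\<lambda>_. 1)"
| "picard (Suc m) = volterra (picard m)"

lemma subcritical_picard: "subcritical (picard m)"
proof (induction m)
  case 0
  have "1 \<le> r powr (- kap)" if "0 < r" "r \<le> 1" for r
    using powr_mono'[of "- kap" 0 r] that kap_pos by simp
  then show ?case by (simp add: subcritical_def)
qed (simp add: subcritical_volterra)

lemma picard_le_Suc: "0 < r \<Longrightarrow> r \<le> 1 \<Longrightarrow> picard m r \<le> picard (Suc m) r"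
proof (induction m arbitrary: r)
  case 0
  then show ?case using volterra_ge_1[OF subcritical_picard[of 0]] by simp
next
  case (Suc m)
  have "volterra (picard m) r \<le> volterra (picard (Suc m)) r"
    using Suc by (intro volterra_mono subcritical_picard)
  then show ?case by simp
qed

text \<open>The Picard iterates increase and stay below the barrier. The fixed point equation is
  obtained by dominated convergence before continuity is known; continuity is then read off from the
  integral.\<close>

lemma volterra_fixed_point:
  obtains y where "subcritical y" "\<And>r. 0 < r \<Longrightarrow> r \<le> 1 \<Longrightarrow> y r = volterra y r"
proof -
  define y where "y r = lim (\<lambda>m. picard m r)" for r
  have lim: "(\<lambda>m. picard m r) \<longlonglongrightarrow> y r" if r: "0 < r" "r \<le> 1" for r
  proof -
    have "picard m r \<le> r powr (- kap)" for m
      using subcritical_picard[of m] r by (auto simp: subcritical_def)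
    then have "\<exists>L. (\<lambda>m. picard m r) \<longlonglongrightarrow> L"
      using incseq_convergent[of "\<lambda>m. picard m r" "r powr (- kap)"] picard_le_Suc[OF r]
      by (metis incseq_SucI)
    then show ?thesis
      by (simp add: y_def convergent_def convergent_LIMSEQ_iff[symmetric])
  qed
  have wlim: "(\<lambda>m. weighted (picard m) t) \<longlonglongrightarrow> weighted y t" if "t \<in> {0..1}" for t
  proof (cases "t = 0")
    case False
    then show ?thesis
      using that unfolding weighted_def by (intro tendsto_mult_left lim) auto
  qed simp
  have flim: "(\<lambda>m. flux (picard m) s) \<longlonglongrightarrow> flux y s" if s: "0 < s" "s \<le> 1" for s
    unfolding flux_def
  proof (rule dominated_convergence(2)[where h="\<lambda>_. kap * (kap + 2)"])
    show "weighted (picard m) integrable_on {0..s}" for m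
      using s by (intro weighted_integrable subcritical_picard) auto
    show "norm (weighted (picard m) t) \<le> kap * (kap + 2)" if "t \<in> {0..s}" for m t
    proof (cases "t = 0")
      case True then show ?thesis using kap_pos by simp
    next
      case False
      then have t: "0 < t" "t \<le> 1" using that s by auto
      have "t powr (kap + 1) \<le> 1" using t kap_pos by (intro powr_le1) auto
      then have "kap * (kap + 2) * t powr (kap + 1) \<le> kap * (kap + 2)"
        using kap_pos by (simp add: mult_left_le)
      then show ?thesis using weighted_bounds[OF subcritical_picard t, of m] by simp
    qed
    show "(\<lambda>m. weighted (picard m) t) \<longlonglongrightarrow> weighted y t" if "t \<in> {0..s}" for t
      using that s by (intro wlim) auto
  qed (rule integrable_const_ivl)
  have int: "(\<lambda>s. flux y s / s ^ (k - 2)) integrable_on {r..1}"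
    and vlim: "(\<lambda>m. volterra (picard m) r) \<longlonglongrightarrow> volterra y r" if r: "0 < r" "r \<le> 1" for r
  proof -
    have 1: "(\<lambda>s. flux (picard m) s / s ^ (k - 2)) integrable_on {r..1}" for m
      by (intro flux_div_integrable subcritical_picard r)
    have 2: "norm (flux (picard m) s / s ^ (k - 2)) \<le> kap * s powr (- kap - 1)" if "s \<in> {r..1}" for m s
      using flux_div_bounds[OF subcritical_picard, of s m] that r by simp
    have 3: "(\<lambda>m. flux (picard m) s / s ^ (k - 2)) \<longlonglongrightarrow> flux y s / s ^ (k - 2)" if "s \<in> {r..1}" for s
      using that r by (intro tendsto_divide flim tendsto_const) auto
    note conv = dominated_convergence[OF 1 has_integral_integrable[OF integral_kap_powr[OF r]] 2 3]
    show "(\<lambda>s. flux y s / s ^ (k - 2)) integrable_on {r..1}" by (rule conv)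
    show "(\<lambda>m. volterra (picard m) r) \<longlonglongrightarrow> volterra y r"
      unfolding volterra_def by (intro tendsto_add tendsto_const conv(2))
  qed
  have fixp: "y r = volterra y r" if "0 < r" "r \<le> 1" for r
    using LIMSEQ_unique[OF LIMSEQ_Suc[OF lim[OF that]]] vlim[OF that] by simp
  have "continuous_on {0<..1} (volterra y)"
    unfolding continuous_on_Ioc_iff volterra_def[abs_def]
    by (intro allI impI continuous_intros indefinite_integral_continuous_1' int)
  then have "continuous_on {0<..1} y"
    by (rule continuous_on_eq) (simp add: fixp)
  moreover have "0 \<le> y r \<and> y r \<le> r powr (- kap)" if r: "0 < r" "r \<le> 1" for r
    using subcritical_picard r
    by (auto simp: subcritical_def intro!: LIMSEQ_le_const[OF lim[OF r]] LIMSEQ_le_const2[OF lim[OF r]])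
  ultimately show ?thesis
    using that fixp by (auto simp: subcritical_def)
qed

end

text \<open>The singular radial solution \<open>u\<close>, with \<open>\<eta> = - u'\<close> and \<open>F = - \<Delta> u\<close>.\<close>

locale singular_profile = singular_potential +
  fixes u \<eta> F :: "real \<Rightarrow> real"
  assumes u_cont: "continuous_on {0<..1} u" and \<eta>_cont: "continuous_on {0<..1} \<eta>"
    and F_cont: "continuous_on {0<..1} F"
    and u_deriv: "\<And>r. 0 < r \<Longrightarrow> r < 1 \<Longrightarrow> (u has_real_derivative - \<eta> r) (at r)"
    and \<eta>_deriv: "\<And>r. 0 < r \<Longrightarrow> r < 1 \<Longrightarrow> ((\<lambda>r. r ^ k * \<eta> r) has_real_derivative r ^ k * F r) (at r)"
    and F_deriv: "\<And>r. 0 < r \<Longrightarrow> r < 1 \<Longrightarrow> (F has_real_derivative - (p r * \<eta> r)) (at r)"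
    and u_one: "u 1 = 0"
    and \<eta>_pos: "\<And>r. 0 < r \<Longrightarrow> r \<le> 1 \<Longrightarrow> 0 < \<eta> r" and F_pos: "\<And>r. 0 < r \<Longrightarrow> r \<le> 1 \<Longrightarrow> 0 < F r"
    and \<eta>_le: "\<And>r. 0 < r \<Longrightarrow> r \<le> 1 \<Longrightarrow> \<eta> r \<le> r powr (- kap - 1)"
    and F_le: "\<And>r. 0 < r \<Longrightarrow> r \<le> 1 \<Longrightarrow> F r \<le> (real k - 1) * r powr (- kap - 2)"
    and u_le: "\<And>r. 0 < r \<Longrightarrow> r \<le> 1 \<Longrightarrow> u r \<le> r powr (- kap) / kap"
    and u_ge: "\<And>r. 0 < r \<Longrightarrow> r \<le> 1 \<Longrightarrow> - ln r \<le> u r"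

text \<open>Writing \<open>\<eta> = y / r\<close>, the linearized equation \<open>\<eta>'' + (k / r) \<eta>' + (p - k / r\<^sup>2) \<eta> = 0\<close> becomes
  \<open>(r\<^bsup>k - 2\<^esup> y')' = - r\<^bsup>k - 2\<^esup> (p - 2 (k - 1) / r\<^sup>2) y\<close>, whose less singular solution is the fixed
  point of the Volterra operator.\<close>

lemma (in singular_potential) profile_exists:
  obtains u \<eta> F where "singular_profile k p u \<eta> F"
proof -
  obtain y where y: "subcritical y" "\<And>r. 0 < r \<Longrightarrow> r \<le> 1 \<Longrightarrow> y r = volterra y r"
    using volterra_fixed_point by blast
  define P where "P = flux y"
  have yc: "continuous_on {0<..1} y" and y_le: "\<And>r. 0 < r \<Longrightarrow> r \<le> 1 \<Longrightarrow> y r \<le> r powr (- kap)"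
    using y by (auto simp: subcritical_def)
  have y_ge: "1 \<le> y r" if "0 < r" "r \<le> 1" for r
    using y(2)[OF that] volterra_ge_1[OF y(1) that] by simp
  have y1: "y 1 = 1" using y(2)[of 1] by (simp add: volterra_def)
  have Pc: "continuous_on {0<..1} P"
    unfolding P_def by (rule continuous_on_subset[OF continuous_on_flux[OF y(1)]]) auto
  have P: "0 \<le> P r" "P r \<le> kap * r powr (kap + 2)" if "0 < r" "r \<le> 1" for r
    using flux_bounds[OF y(1) that] by (auto simp: P_def)
  have P_deriv: "(P has_real_derivative r ^ (k - 2) * excess r * y r) (at r)" if r: "0 < r" "r < 1" for r
    using integral_has_real_derivative[OF continuous_on_weighted[OF y(1)], of r] at_within_Icc_at[of 0 r 1] r
    unfolding P_def flux_def[abs_def] weighted_def by simp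
  have y_deriv: "(y has_real_derivative - (P r / r ^ (k - 2))) (at r)" if r: "0 < r" "r < 1" for r
  proof -
    have c: "continuous_on {r/2..1} (\<lambda>s. flux y s / s ^ (k - 2))"
      using r by (intro continuous_on_flux_div y) auto
    from integral_has_real_derivative'[OF c, of r]
    have "((\<lambda>x. integral {x..1} (\<lambda>s. flux y s / s ^ (k - 2))) has_real_derivative - (flux y r / r ^ (k - 2))) (at r)"
      using at_within_Icc_at[of "r/2" r 1] r by simp
    then have "((\<lambda>x. 1 + integral {x..1} (\<lambda>s. flux y s / s ^ (k - 2))) has_real_derivative 0 + - (flux y r / r ^ (k - 2))) (at r)"
      by (intro DERIV_add DERIV_const)
    then have "((\<lambda>x. 1 + integral {x..1} (\<lambda>s. flux y s / s ^ (k - 2))) has_real_derivative - (P r / r ^ (k - 2))) (at r)"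
      by (simp add: P_def)
    then show ?thesis
      by (rule has_field_derivative_transform_within_open[where S="{0<..<1}"])
        (use r y(2) in \<open>auto simp: volterra_def\<close>)
  qed
  define \<eta> where "\<eta> r = y r / r" for r
  \<comment> \<open>This is \<open>(r ^ (k - 1) * y)' / r ^ k\<close> with
    \<open>y' = - P / r ^ (k - 2)\<close>, that is, minus the Laplacian of the radial function with
    slope \<open>- \<eta>\<close>.\<close>
  define F where "F r = (real k - 1) * y r / r\<^sup>2 - P r / r ^ (k - 1)" for r
  define u where "u r = integral {r..1} \<eta>" for r
  have \<eta>c: "continuous_on {0<..1} \<eta>"
    unfolding \<eta>_def[abs_def] by (intro continuous_intros yc) auto
  have Fc: "continuous_on {0<..1} F"
    unfolding F_def[abs_def] by (intro continuous_intros yc Pc) auto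
  have \<eta>c': "continuous_on {r..1} \<eta>" if "0 < r" for r
    by (rule continuous_on_subset[OF \<eta>c]) (use that in auto)
  have kk: "k = Suc (Suc (k - 2))" "k - 1 = Suc (k - 2)" using k by auto
  have F_deriv: "(F has_real_derivative - (p r * \<eta> r)) (at r)" if r: "0 < r" "r < 1" for r
  proof -
    let ?z = "r ^ (k - 2)"
    have "((\<lambda>r. (real k - 1) * y r / r\<^sup>2) has_real_derivative
        ((real k - 1) * - (P r / ?z) * r\<^sup>2 - (real k - 1) * y r * (2 * r)) / (r\<^sup>2 * r\<^sup>2)) (at r)"
      using r DERIV_pow[of 2 r] by (intro DERIV_divide DERIV_cmult y_deriv) auto
    moreover have "((\<lambda>r. P r / r ^ (k - 1)) has_real_derivative
        ((?z * excess r * y r) * r ^ (k - 1) - P r * (real (k - 1) * r ^ (k - 1 - Suc 0))) / (r ^ (k - 1) * r ^ (k - 1))) (at r)"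
      using r by (intro DERIV_divide P_deriv DERIV_pow) auto
    ultimately have "(F has_real_derivative
        ((real k - 1) * - (P r / ?z) * r\<^sup>2 - (real k - 1) * y r * (2 * r)) / (r\<^sup>2 * r\<^sup>2) -
        ((?z * excess r * y r) * r ^ (k - 1) - P r * (real (k - 1) * r ^ (k - 1 - Suc 0))) / (r ^ (k - 1) * r ^ (k - 1))) (at r)"
      unfolding F_def[abs_def] by (intro DERIV_diff)
    moreover have "((real k - 1) * - (P r / ?z) * r\<^sup>2 - (real k - 1) * y r * (2 * r)) / (r\<^sup>2 * r\<^sup>2) -
        ((?z * excess r * y r) * r ^ (k - 1) - P r * (real (k - 1) * r ^ (k - 1 - Suc 0))) / (r ^ (k - 1) * r ^ (k - 1))
        = - (p r * \<eta> r)"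
    proof -
      have k1: "real (k - 1) = real k - 1" using k by simp
      have pw: "r ^ (k - 1) = r * ?z" "r ^ (k - 1 - Suc 0) = ?z"
        using kk by (metis power_Suc) (use kk in simp)
      have z: "?z \<noteq> 0" using r by simp
      show ?thesis
        unfolding pw k1 \<eta>_def excess_def using r z
        by (simp add: divide_simps) (simp add: algebra_simps eval_nat_numeral)
    qed
    ultimately show ?thesis by simp
  qed
  have \<eta>_deriv: "((\<lambda>r. r ^ k * \<eta> r) has_real_derivative r ^ k * F r) (at r)" if r: "0 < r" "r < 1" for r
  proof -
    let ?z = "r ^ (k - 2)"
    have "((\<lambda>r. r ^ (k - 1) * y r) has_real_derivative
        (real (k - 1) * r ^ (k - 1 - Suc 0)) * y r + - (P r / ?z) * r ^ (k - 1)) (at r)"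
      by (intro DERIV_mult DERIV_pow y_deriv r)
    moreover have "(real (k - 1) * r ^ (k - 1 - Suc 0)) * y r + - (P r / ?z) * r ^ (k - 1) = r ^ k * F r"
    proof -
      have k1: "real (k - 1) = real k - 1" using k by simp
      have pw: "r ^ (k - 1) = r * ?z" "r ^ (k - 1 - Suc 0) = ?z" "r ^ k = r * (r * ?z)"
        using kk by (metis power_Suc) (use kk in simp, metis kk(1) power_Suc)
      have z: "?z \<noteq> 0" using r by simp
      show ?thesis
        unfolding pw k1 F_def using r z
        by (simp add: divide_simps) (simp add: algebra_simps power2_eq_square)
    qed
    ultimately have "((\<lambda>r. r ^ (k - 1) * y r) has_real_derivative r ^ k * F r) (at r)" by simp
    then show ?thesis
    proof (rule has_field_derivative_transform_within_open[where S="{0<..<1}"])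
      fix s :: real assume "s \<in> {0<..<1}"
      then show "s ^ (k - 1) * y s = s ^ k * \<eta> s"
        using kk by (metis \<eta>_def greaterThanLessThan_iff less_irrefl nonzero_mult_div_cancel_left
            power_Suc times_divide_eq_left times_divide_eq_right)
    qed (use r in auto)
  qed
  \<comment> \<open>\<open>F 1 = k - 1 - P 1\<close>, where \<open>k - 1 = 2 * kap + 4\<close> and
    \<open>P 1 \<le> kap\<close>. Since \<open>F\<close> decreases, positivity at 1 is all that is
    needed.\<close>
  have F1: "0 < F 1"
    using P(2)[of 1] kap_pos y1 by (simp add: F_def real_k)
  have F_pos: "0 < F r" if r: "0 < r" "r \<le> 1" for r
  proof -
    have "F 1 \<le> F r"
    proof (rule DERIV_nonpos_imp_decreasing_open[of r 1 F])
      fix s assume s: "r < s" "s < 1"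
      then have "0 \<le> p s * \<eta> s"
        using r p_pos[of s] y_ge[of s] by (auto simp: \<eta>_def intro!: mult_nonneg_nonneg divide_nonneg_nonneg)
      then show "\<exists>D. (F has_real_derivative D) (at s) \<and> D \<le> 0"
        using F_deriv[of s] s r by (intro exI[of _ "- (p s * \<eta> s)"]) auto
    qed (use r in \<open>auto intro: continuous_on_subset[OF Fc]\<close>)
    then show ?thesis using F1 by simp
  qed
  have \<eta>_le: "\<eta> r \<le> r powr (- kap - 1)" if "0 < r" "r \<le> 1" for r
    using y_le[OF that] that by (simp add: \<eta>_def powr_diff divide_right_mono)
  have "singular_profile k p u \<eta> F"
  proof
    show "continuous_on {0<..1} u"
      unfolding continuous_on_Ioc_iff u_def[abs_def]
      by (intro allI impI indefinite_integral_continuous_1' integrable_continuous_real \<eta>c')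
    show "(u has_real_derivative - \<eta> r) (at r)" if r: "0 < r" "r < 1" for r
      using integral_has_real_derivative'[OF \<eta>c'[of "r/2"], of r] at_within_Icc_at[of "r/2" r 1] r
      unfolding u_def[abs_def] by simp
    show "u 1 = 0" by (simp add: u_def)
    fix r :: real assume r: "0 < r" "r \<le> 1"
    show "0 < \<eta> r" using y_ge[OF r] r by (simp add: \<eta>_def)
    show "F r \<le> (real k - 1) * r powr (- kap - 2)"
    proof -
      have "F r \<le> (real k - 1) * y r / r\<^sup>2"
        using P(1)[OF r] r by (simp add: F_def)
      also have "\<dots> \<le> (real k - 1) * r powr (- kap) / r\<^sup>2"
        using y_le[OF r] k r by (intro divide_right_mono mult_left_mono) auto
      also have "\<dots> = (real k - 1) * r powr (- kap - 2)"
        using r by (simp add: powr_diff)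
      finally show ?thesis .
    qed
    have \<eta>i: "\<eta> integrable_on {r..1}"
      by (intro integrable_continuous_real \<eta>c' r)
    have I: "((\<lambda>s. s powr (- kap - 1)) has_integral (r powr (- kap) - 1) / kap) {r..1}"
      using has_integral_mult_right[OF integral_kap_powr[OF r], of "1 / kap"] kap_pos by simp
    have "u r \<le> integral {r..1} (\<lambda>s. s powr (- kap - 1))"
      unfolding u_def using r by (intro integral_le \<eta>i has_integral_integrable[OF I] \<eta>_le) auto
    also have "\<dots> \<le> r powr (- kap) / kap"
      unfolding integral_unique[OF I] using kap_pos by (intro divide_right_mono) auto
    finally show "u r \<le> r powr (- kap) / kap" .
    have J: "((\<lambda>s. 1 / s) has_integral (ln 1 - ln r)) {r..1}"
      using r by (intro fundamental_theorem_of_calculus)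
        (auto simp flip: has_real_derivative_iff_has_vector_derivative intro!: derivative_eq_intros)
    have "integral {r..1} (\<lambda>s. 1 / s) \<le> u r"
      unfolding u_def using r y_ge
      by (intro integral_le \<eta>i has_integral_integrable[OF J]) (auto simp: \<eta>_def divide_right_mono)
    then show "- ln r \<le> u r"
      using integral_unique[OF J] by simp
  qed (use \<eta>c Fc F_deriv \<eta>_deriv F_pos \<eta>_le in auto)
  then show ?thesis by (rule that)
qed

section \<open>The nonlinearity and its extremal solution\<close>

lemma tendsto_zero_linear:
  fixes g :: "real \<Rightarrow> real"
  assumes "\<And>r. 0 < r \<Longrightarrow> r \<le> 1 \<Longrightarrow> \<bar>g r\<bar> \<le> C * r"
  shows "(g \<longlongrightarrow> 0) (at_right 0)"
proof (rule tendsto_0_le[where K=C])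
  show "((\<lambda>r. r) \<longlongrightarrow> (0::real)) (at_right 0)" by (rule tendsto_ident_at)
  show "\<forall>\<^sub>F r in at_right 0. norm (g r) \<le> norm r * C"
    unfolding eventually_at_right_field
    by (intro exI[of _ 1]) (use assms in \<open>auto simp: mult.commute\<close>)
qed

lemma halfline_deriv_unique:
  assumes "(f has_real_derivative a) (at t within {0..})" "(f has_real_derivative b) (at t within {0..})" "0 \<le> t"
  shows "a = b"
proof (rule vector_derivative_unique_within)
  have "at t within {t<..} \<noteq> bot" by simp
  moreover have "at t within {t<..} \<le> at t within {0..}"
    using assms by (intro at_le) auto
  ultimately show "at t within {0..} \<noteq> bot"
    by (metis bot.extremum_uniqueI)
qed (use assms in \<open>auto simp: has_real_derivative_iff_has_vector_derivative\<close>)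

lemma at_within_halfline: "at t within {0..} = at t within {0..b}" if "t < b" for t b :: real
  by (rule at_within_nhd[of _ "{..<b}"]) (use that in auto)

lemma convex_on_halfline_deriv_mono:
  assumes f: "\<And>t. 0 \<le> t \<Longrightarrow> (f has_real_derivative f' t) (at t within {0..})"
    and mono: "\<And>s t. 0 \<le> s \<Longrightarrow> s \<le> t \<Longrightarrow> f' s \<le> f' t"
  shows "convex_on {0..} f"
proof (rule convex_on_linorderI)
  fix t x y :: real
  assume t: "0 < t" "t < 1" and xy: "x \<in> {0..}" "y \<in> {0..}" "x < y"
  define z where "z = (1 - t) * x + t * y"
  have zx: "z - x = t * (y - x)" and yz: "y - z = (1 - t) * (y - x)"
    by (auto simp: z_def algebra_simps)
  have "0 < t * (y - x)" "0 < (1 - t) * (y - x)" using t xy by auto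
  then have z: "x < z" "z < y" by (simp_all flip: zx yz)
  have cont: "continuous_on {0..} f" by (rule DERIV_continuous_on[OF f]) simp
  have d: "(f has_derivative (\<lambda>h. f' s * h)) (at s)" if "0 < s" for s
    using f[of s] that at_within_interior[of s "{0..}"] by (simp add: has_field_derivative_def)
  obtain a where a: "x < a" "a < z" "f z - f x = f' a * (z - x)"
  proof (rule mvt[OF z(1), of f "\<lambda>s h. f' s * h"])
    show "continuous_on {x..z} f" using xy by (auto intro: continuous_on_subset[OF cont])
  qed (use xy d in auto)
  obtain b where b: "z < b" "b < y" "f y - f z = f' b * (y - z)"
  proof (rule mvt[OF z(2), of f "\<lambda>s h. f' s * h"])
    show "continuous_on {z..y} f" using xy z by (auto intro: continuous_on_subset[OF cont])
  qed (use xy z d in auto)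
  have "f' a \<le> f' b" using a b xy by (intro mono) auto
  then have "t * (1 - t) * (y - x) * f' a \<le> t * (1 - t) * (y - x) * f' b"
    using t xy by (intro mult_left_mono) auto
  moreover have "(1 - t) * (f z - f x) = t * (1 - t) * (y - x) * f' a"
    using a(3) zx by simp
  moreover have "t * (f y - f z) = t * (1 - t) * (y - x) * f' b"
    using b(3) yz by simp
  ultimately have "f z \<le> (1 - t) * f x + t * f y" by (simp add: algebra_simps)
  then show "f ((1 - t) *\<^sub>R x + t *\<^sub>R y) \<le> (1 - t) * f x + t * f y"
    by (simp add: z_def)
qed simp

context singular_profile
begin

section \<open>The inverse of the profile and the construction of the nonlinearity\<close>

lemma u_strict_decreasing:
  assumes "0 < r" "r < s" "s \<le> 1"
  shows "u s < u r"
proof (rule DERIV_neg_imp_decreasing_open[of r s u])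
  show "\<exists>D. (u has_real_derivative D) (at t) \<and> D < 0" if "r < t" "t < s" for t
    using u_deriv[of t] \<eta>_pos[of t] that assms by (intro exI[of _ "- \<eta> t"]) auto
qed (use assms in \<open>auto intro: continuous_on_subset[OF u_cont]\<close>)

lemma u_decreasing: "0 < r \<Longrightarrow> r \<le> s \<Longrightarrow> s \<le> 1 \<Longrightarrow> u s \<le> u r"
  using u_strict_decreasing[of r s] by (cases "r = s") auto

lemma u_nonneg: "0 < r \<Longrightarrow> r \<le> 1 \<Longrightarrow> 0 \<le> u r"
  using u_decreasing[of r 1] u_one by simp

lemma u_inj: "0 < r \<Longrightarrow> r \<le> 1 \<Longrightarrow> 0 < s \<Longrightarrow> s \<le> 1 \<Longrightarrow> u r = u s \<Longrightarrow> r = s"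
  using u_strict_decreasing[of r s] u_strict_decreasing[of s r] by (cases r s rule: linorder_cases) auto

lemma u_surj:
  assumes "0 \<le> t"
  shows "\<exists>r. 0 < r \<and> r \<le> 1 \<and> u r = t"
proof -
  have e: "0 < exp (- t)" "exp (- t) \<le> 1" using assms by auto
  have "t \<le> u (exp (- t))" using u_ge[OF e] by simp
  then have "\<exists>r. exp (- t) \<le> r \<and> r \<le> 1 \<and> u r = t"
    using e assms by (intro IVT2' continuous_on_subset[OF u_cont]) (auto simp: u_one intro: order_less_le_trans[OF e(1)])
  then obtain r where "exp (- t) \<le> r" "r \<le> 1" "u r = t" by blast
  then show ?thesis
    by (intro exI[of _ r] conjI order_less_le_trans[OF e(1)])
qed

definition u_inv :: "real \<Rightarrow> real"
  where "u_inv t = (SOME r. 0 < r \<and> r \<le> 1 \<and> u r = t)"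

lemma u_inv: "0 \<le> t \<Longrightarrow> 0 < u_inv t \<and> u_inv t \<le> 1 \<and> u (u_inv t) = t"
  unfolding u_inv_def using u_surj by (rule someI_ex)

lemma u_inv_u: "0 < r \<Longrightarrow> r \<le> 1 \<Longrightarrow> u_inv (u r) = r"
  using u_inv[of "u r"] u_nonneg[of r] by (auto intro: u_inj)

lemma u_inv_antimono:
  assumes "0 \<le> s" "s \<le> t"
  shows "u_inv t \<le> u_inv s"
  using u_strict_decreasing[of "u_inv s" "u_inv t"] u_inv[of s] u_inv[of t] assms by force

lemma continuous_on_p_u_inv: "continuous_on {0..b} (\<lambda>t. p (u_inv t))" if b: "0 \<le> b"
proof -
  define a where "a = u_inv b"
  have a: "0 < a" "a \<le> 1" "u a = b" using u_inv[OF b] by (auto simp: a_def)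
  have "{0..b} \<subseteq> u ` {a..1}"
  proof
    fix t assume t: "t \<in> {0..b}"
    then show "t \<in> u ` {a..1}"
      using u_inv[of t] u_inv_antimono[of t b] by (intro image_eqI[of _ _ "u_inv t"]) (auto simp: a_def)
  qed
  moreover have "continuous_on (u ` {a..1}) u_inv"
    using a by (intro continuous_on_inv continuous_on_subset[OF u_cont]) (auto intro: u_inv_u)
  ultimately have "continuous_on {0..b} u_inv"
    by (rule continuous_on_subset[rotated])
  then show ?thesis
    by (rule continuous_on_compose2[OF p_cont]) (use u_inv in auto)
qed

text \<open>Integrating the prescribed derivative from \<open>u 1 = 0\<close> gives
  differentiability up to the endpoint and convexity without differentiating \<open>u_inv\<close>;
  the relation to \<open>F\<close> is checked afterwards.\<close>

definition nonlin :: "real \<Rightarrow> real"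
  where "nonlin t = F 1 + integral {0..t} (\<lambda>s. p (u_inv s))"

lemma nonlin_deriv:
  assumes "0 \<le> t"
  shows "(nonlin has_real_derivative p (u_inv t)) (at t within {0..})"
proof -
  have "((\<lambda>t. F 1 + integral {0..t} (\<lambda>s. p (u_inv s))) has_real_derivative 0 + p (u_inv t)) (at t within {0..t + 1})"
    using assms by (intro DERIV_add DERIV_const integral_has_real_derivative continuous_on_p_u_inv) auto
  then show ?thesis
    unfolding nonlin_def[abs_def] at_within_halfline[of t "t + 1", simplified] by simp
qed

lemma continuous_on_nonlin: "continuous_on {0..} nonlin"
  by (rule DERIV_continuous_on[OF nonlin_deriv]) simp

text \<open>Along \<open>u\<close> both sides have the derivative \<open>- p r * \<eta> r\<close>,
  and they agree at 1.\<close>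

lemma nonlin_u:
  assumes r: "0 < r" "r \<le> 1"
  shows "nonlin (u r) = F r"
proof (cases "r = 1")
  case True
  then show ?thesis by (simp add: nonlin_def u_one)
next
  case False
  have "nonlin (u 1) - F 1 = nonlin (u r) - F r"
  proof (rule DERIV_isconst_end[of r 1 "\<lambda>r. nonlin (u r) - F r"])
    show "r < 1" using False r by simp
    show "continuous_on {r..1} (\<lambda>r. nonlin (u r) - F r)"
      using r u_nonneg
      by (intro continuous_intros continuous_on_compose2[OF continuous_on_nonlin, where f=u]
          continuous_on_subset[OF u_cont] continuous_on_subset[OF F_cont]) auto
    fix s assume s: "r < s" "s < 1"
    then have s': "0 < s" "0 < u s" "u_inv (u s) = s"
      using r u_strict_decreasing[of s 1] u_one by (auto intro: u_inv_u)
    then have "(nonlin has_real_derivative p s) (at (u s))"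
      using nonlin_deriv[of "u s"] at_within_interior[of "u s" "{0..}"] by simp
    from DERIV_diff[OF DERIV_chain2[OF this u_deriv] F_deriv] s s'
    show "((\<lambda>r. nonlin (u r) - F r) has_real_derivative 0) (at s)" by simp
  qed
  then show ?thesis by (simp add: nonlin_def u_one)
qed

lemma nonlin_deriv_u: "0 < r \<Longrightarrow> r \<le> 1 \<Longrightarrow> (nonlin has_real_derivative p r) (at (u r) within {0..})"
  using nonlin_deriv[OF u_nonneg] by (simp add: u_inv_u)

lemma p_u_inv_mono: "0 \<le> s \<Longrightarrow> s \<le> t \<Longrightarrow> p (u_inv s) \<le> p (u_inv t)"
  using u_inv[of s] u_inv[of t] u_inv_antimono[of s t] by (intro p_anti) auto

lemma p_u_inv_unbounded: "\<exists>s\<ge>0. Z \<le> p (u_inv s)"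
proof -
  define r where "r = min 1 (1 / (1 + \<bar>Z\<bar>))"
  have r: "0 < r" "r \<le> 1" by (auto simp: r_def)
  have "Z \<le> 1 / r"
    by (auto simp: r_def min_def field_simps)
  also have "\<dots> \<le> 1 / r\<^sup>2"
    using r by (intro divide_left_mono) (auto simp: power2_eq_square mult_le_cancel_left1)
  also have "\<dots> \<le> 2 * (real k - 1) / r\<^sup>2"
    using k by (intro divide_right_mono) auto
  also have "\<dots> \<le> p r" by (rule p_lower[OF r])
  finally show ?thesis
    using r by (intro exI[of _ "u r"]) (simp add: u_inv_u u_nonneg)
qed

lemma nonlin_admissible: "admissible nonlin"
proof -
  have pos: "0 < p (u_inv t)" if "0 \<le> t" for t
    using u_inv[OF that] by (intro p_pos) auto
  have d: "(nonlin has_real_derivative p (u_inv t)) (at t)" if "0 < t" for t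
    using nonlin_deriv[of t] at_within_interior[of t "{0..}"] that by simp
  have mono: "nonlin s \<le> nonlin t" if "0 \<le> s" "s \<le> t" for s t
  proof (rule DERIV_nonneg_imp_increasing_open[OF that(2)])
    show "\<exists>D. (nonlin has_real_derivative D) (at x) \<and> 0 \<le> D" if "s < x" "x < t" for x
      using d[of x] pos[of x] that \<open>0 \<le> s\<close> by (intro exI[of _ "p (u_inv x)"]) auto
  qed (use that in \<open>auto intro: continuous_on_subset[OF continuous_on_nonlin]\<close>)
  have C1: "C1_halfline nonlin"
    unfolding C1_halfline_def
  proof (intro exI conjI allI impI)
    show "continuous_on {0..} (\<lambda>t. p (u_inv t))"
      unfolding continuous_on_eq_continuous_within
    proof
      fix t :: real assume t: "t \<in> {0..}"
      then have "continuous (at t within {0..t + 1}) (\<lambda>t. p (u_inv t))"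
        using continuous_on_p_u_inv[of "t + 1"] by (auto simp: continuous_on_eq_continuous_within)
      then show "continuous (at t within {0..}) (\<lambda>t. p (u_inv t))"
        by (simp add: at_within_halfline[of t "t + 1"])
    qed
  qed (rule nonlin_deriv)
  have convex: "convex_on {0..} nonlin"
    by (rule convex_on_halfline_deriv_mono[OF nonlin_deriv p_u_inv_mono])
  have tangent: "nonlin s + p (u_inv s) * (t - s) \<le> nonlin t" if "0 < s" "0 \<le> t" for s t
    using convex_on_imp_above_tangent[OF convex, of s t "p (u_inv s)"] nonlin_deriv[of s] that by simp
  have lim: "filterlim (\<lambda>t. nonlin t / t) at_top at_top"
    unfolding filterlim_at_top
  proof
    fix Z
    \<comment> \<open>The factor 2 compensates that for \<open>t \<ge> 2 * s\<close> the tangent at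
      \<open>s\<close> is only guaranteed to run over a length of \<open>t / 2\<close>.\<close>
    obtain s0 where s0: "0 \<le> s0" "2 * \<bar>Z\<bar> \<le> p (u_inv s0)"
      using p_u_inv_unbounded by blast
    define s where "s = s0 + 1"
    have s: "0 < s" "2 * \<bar>Z\<bar> \<le> p (u_inv s)"
      using s0 p_u_inv_mono[of s0 s] by (auto simp: s_def)
    show "\<forall>\<^sub>F t in at_top. Z \<le> nonlin t / t"
      using eventually_ge_at_top[of "2 * s"]
    proof eventually_elim
      case (elim t)
      have "0 \<le> nonlin s" using mono[of 0 s] s F_pos[of 1] by (simp add: nonlin_def)
      moreover have "2 * \<bar>Z\<bar> * (t / 2) \<le> p (u_inv s) * (t - s)"
        using s elim by (intro mult_mono) auto
      ultimately have "\<bar>Z\<bar> * t \<le> nonlin t"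
        using tangent[of s t] s elim by simp
      moreover have "Z * t \<le> \<bar>Z\<bar> * t" using s elim by (intro mult_right_mono) auto
      ultimately have "Z * t \<le> nonlin t" by simp
      then show ?case using s elim by (simp add: le_divide_eq)
    qed
  qed
  show ?thesis
    unfolding admissible_def
    using C1 convex lim mono F_pos[of 1] by (auto simp: mono_on_def nonlin_def)
qed

section \<open>Behaviour at the origin and comparison with the singular profile\<close>

lemma powr_le_id: "0 < r \<Longrightarrow> r \<le> 1 \<Longrightarrow> 1 \<le> c \<Longrightarrow> r powr c \<le> r" for r c :: real
  using powr_mono'[of 1 c r] by simp

lemma power_k: "0 < r \<Longrightarrow> r ^ k = r powr (2 * kap + 5)"
  by (simp add: powr_realpow[symmetric] real_k[symmetric])

lemma flux_\<eta>_pos: "0 < r \<Longrightarrow> r \<le> 1 \<Longrightarrow> 0 < r ^ k * \<eta> r"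
  by (simp add: \<eta>_pos)

lemma flux_\<eta>_le:
  assumes r: "0 < r" "r \<le> 1"
  shows "r ^ k * \<eta> r \<le> r" "r ^ k * \<eta> r * F r \<le> (real k - 1) * r"
proof -
  have E: "r ^ k * \<eta> r \<le> r powr (kap + 4)"
  proof -
    have "r ^ k * \<eta> r \<le> r powr (2 * kap + 5) * r powr (- kap - 1)"
      using r \<eta>_le[OF r] by (simp add: power_k mult_left_mono)
    also have "\<dots> = r powr (kap + 4)" by (simp add: powr_add[symmetric])
    finally show ?thesis .
  qed
  also have "r powr (kap + 4) \<le> r" using r kap_pos by (intro powr_le_id) auto
  finally show "r ^ k * \<eta> r \<le> r" .
  have "r ^ k * \<eta> r * F r \<le> r powr (kap + 4) * ((real k - 1) * r powr (- kap - 2))"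
    using E F_le[OF r] F_pos[OF r] by (intro mult_mono) auto
  also have "\<dots> = (real k - 1) * r powr 2" by (simp add: powr_add[symmetric])
  also have "\<dots> \<le> (real k - 1) * r"
    using r k by (intro mult_left_mono powr_le_id) auto
  finally show "r ^ k * \<eta> r * F r \<le> (real k - 1) * r" .
qed

lemma flux_\<eta>_tendsto_0: "((\<lambda>r. r ^ k * \<eta> r) \<longlongrightarrow> 0) (at_right 0)"
  by (rule tendsto_zero_linear[where C=1]) (use flux_\<eta>_pos flux_\<eta>_le(1) in \<open>simp add: less_imp_le abs_of_pos\<close>)

text \<open>A comparison principle in which the larger function may be singular at the origin, so
  that the maximum principle on the ball does not apply: the fluxes are compared starting from 0,
  where both vanish, and the resulting slopes are integrated inwards from 1.\<close>

lemma green_le_u: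
  assumes g: "continuous_on {0..1} g" and le: "\<And>r. 0 < r \<Longrightarrow> r \<le> 1 \<Longrightarrow> g r \<le> F r"
    and r: "0 < r" "r \<le> 1"
  shows "r * avg k g r \<le> \<eta> r" "green k g r \<le> u r"
proof -
  have *: "r * avg k g r \<le> \<eta> r" if r: "0 < r" "r \<le> 1" for r
  proof -
    have "0 \<le> r ^ k * \<eta> r - r ^ (k + 1) * avg k g r"
    proof (rule incseq_from_zero[OF _ _ _ r])
      show "continuous_on {0<..1} (\<lambda>r. r ^ k * \<eta> r - r ^ (k + 1) * avg k g r)"
        by (intro continuous_intros \<eta>_cont continuous_on_subset[OF continuous_on_avg[OF g]]) auto
      show "((\<lambda>r. r ^ k * \<eta> r - r ^ (k + 1) * avg k g r) \<longlongrightarrow> 0) (at_right 0)"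
        using tendsto_diff[OF flux_\<eta>_tendsto_0 power_avg_tendsto_0[OF g, of k]] by simp
      show "\<exists>D. ((\<lambda>r. r ^ k * \<eta> r - r ^ (k + 1) * avg k g r) has_real_derivative D) (at t) \<and> 0 \<le> D"
        if t: "0 < t" "t < 1" for t
      proof (intro exI conjI)
        show "((\<lambda>r. r ^ k * \<eta> r - r ^ (k + 1) * avg k g r) has_real_derivative t ^ k * F t - t ^ k * g t) (at t)"
          by (intro DERIV_diff \<eta>_deriv power_avg_deriv g t)
        show "0 \<le> t ^ k * F t - t ^ k * g t"
          using le[of t] t by (simp add: mult_left_mono)
      qed
    qed
    then have "r ^ k * (r * avg k g r) \<le> r ^ k * \<eta> r" by (simp add: mult_ac)
    then show ?thesis using r by simp
  qed
  then show "r * avg k g r \<le> \<eta> r" using r by blast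
  have "u 1 - green k g 1 \<le> u r - green k g r"
  proof (rule DERIV_nonpos_imp_decreasing_open[of r 1 "\<lambda>r. u r - green k g r"])
    show "continuous_on {r..1} (\<lambda>r. u r - green k g r)"
      using r by (intro continuous_intros continuous_on_subset[OF u_cont] continuous_on_subset[OF continuous_on_green[OF g]]) auto
    show "\<exists>D. ((\<lambda>r. u r - green k g r) has_real_derivative D) (at t) \<and> D \<le> 0" if t: "r < t" "t < 1" for t
    proof (intro exI conjI)
      show "((\<lambda>r. u r - green k g r) has_real_derivative - \<eta> t - - (t * avg k g t)) (at t)"
        using t r by (intro DERIV_diff u_deriv green_deriv g) auto
      show "- \<eta> t - - (t * avg k g t) \<le> 0" using *[of t] t r by simp
    qed
  qed (use r in auto)
  then show "green k g r \<le> u r" by (simp add: u_one)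
qed

lemma iterate_le_u:
  assumes l: "0 \<le> l" "l \<le> 1"
  shows "0 < r \<Longrightarrow> r \<le> 1 \<Longrightarrow> radial_iterate k nonlin l m r \<le> u r"
proof (induction m arbitrary: r)
  case 0
  then show ?case by (simp add: u_nonneg)
next
  case (Suc m)
  have "l * nonlin (radial_iterate k nonlin l m t) \<le> F t" if t: "0 < t" "t \<le> 1" for t
  proof -
    have n: "0 \<le> radial_iterate k nonlin l m t"
      using t by (intro iterate_nonneg[OF nonlin_admissible l(1)]) auto
    have "l * nonlin (radial_iterate k nonlin l m t) \<le> 1 * nonlin (radial_iterate k nonlin l m t)"
      using l admissible_pos[OF nonlin_admissible n] by (intro mult_right_mono) auto
    also have "\<dots> \<le> nonlin (u t)"
      using Suc.IH[OF t] admissible_mono[OF nonlin_admissible n] by simp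
    finally show ?thesis using nonlin_u[OF t] by simp
  qed
  then show ?case
    using Suc.prems continuous_on_iterate_source[OF nonlin_admissible l(1), of l k m] green_le_u(2) by simp
qed

text \<open>Scaling the parameter 1 by \<open>b = l\<close> moves the origin to
  \<open>sqrt (1 - l)\<close>, where \<open>u\<close> is finite.\<close>

lemma iterates_bounded_below_1:
  assumes "0 < l" "l < 1"
  shows "iterates_bounded k nonlin l"
  unfolding iterates_bounded_def
proof (intro exI allI)
  fix m
  have "radial_iterate k nonlin l m 0 \<le> radial_iterate k nonlin 1 m (sqrt (1 - l))"
    using iterate_scaling[OF nonlin_admissible _ assms, of 1 0 k m] by simp
  also have "\<dots> \<le> u (sqrt (1 - l))"
    using assms by (intro iterate_le_u) auto
  finally show "radial_iterate k nonlin l m 0 \<le> u (sqrt (1 - l))" .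
qed

text \<open>Hardy's inequality in disguise: \<open>r\<^bsup>- a\<^esup>\<close> with \<open>a = (k - 1) / 2\<close> solves
  \<open>- \<Delta> \<psi> = (a / r)\<^sup>2 \<psi>\<close>, and \<open>p \<le> (a / r)\<^sup>2\<close>. The function \<open>K\<close> below is the Wronskian of \<open>u - z\<close> and \<open>\<psi>\<close>.\<close>

lemma u_minus_limit_le:
  assumes l: "0 < l" "l \<le> 1" and bdd: "iterates_bounded k nonlin l" and r: "0 < r" "r \<le> 1"
  shows "(u r - radial_limit k nonlin l r) * r powr (kap + 2) \<le> (1 - l) * (real k - 1)"
proof -
  define z where "z = radial_limit k nonlin l"
  define G where "G r = l * nonlin (z r)" for r
  define a where "a = kap + 2"
  define c where "c = (1 - l) * (real k - 1)"
  have l0: "0 \<le> l" using l by simp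
  have c: "0 \<le> c" using l k by (simp add: c_def)
  have a: "0 < a" using kap_pos by (simp add: a_def)
  have zc: "continuous_on {0..1} z" and zg: "\<And>r. r \<in> {0..1} \<Longrightarrow> z r = green k G r"
    using radial_limit_regular[OF nonlin_admissible l0 bdd] by (auto simp: z_def G_def[abs_def])
  have z0: "0 \<le> z r" if "r \<in> {0..1}" for r
    using radial_limit_nonneg[OF nonlin_admissible l0 bdd that] by (simp add: z_def)
  have Gc: "continuous_on {0..1} G"
    unfolding G_def[abs_def] by (intro continuous_on_source[OF nonlin_admissible] zc z0)
  have G0: "0 \<le> G r" if "r \<in> {0..1}" for r
    using z0[OF that] l0 admissible_pos[OF nonlin_admissible, of "z r"] by (simp add: G_def)
  have z_le: "z r \<le> u r" if "0 < r" "r \<le> 1" for r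
    unfolding z_def
    by (rule LIMSEQ_le_const2[OF iterates_tendsto[OF nonlin_admissible l0 bdd]])
      (use that l in \<open>auto intro!: exI[of _ 0] iterate_le_u\<close>)
  \<comment> \<open>With \<psi> the power \<open>r powr (- a)\<close>, the flux \<open>r ^ k\<close>
    times the derivative of \<psi> is \<open>- a * r powr a\<close>, because
    \<open>k = 2 * a + 1\<close>.\<close>
  define K where "K r = - ((r ^ k * \<eta> r - r ^ (k + 1) * avg k G r) * r powr (- a)) + a * ((u r - green k G r) * r powr a)" for r
  \<comment> \<open>The tangent at \<open>u r\<close> bounds the difference of the nonlinear terms
    by \<open>p r * (u r - z r)\<close>; lowering the parameter from 1 to \<open>l\<close> costs at
    most \<open>(1 - l) * F r\<close>.\<close>
  have FG: "F r - G r \<le> a\<^sup>2 / r\<^sup>2 * (u r - z r) + (1 - l) * F r" if r: "0 < r" "r \<le> 1" for r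
  proof -
    obtain f' where f': "\<And>t. 0 \<le> t \<Longrightarrow> (nonlin has_real_derivative f' t) (at t within {0..})" "continuous_on {0..} f'"
      using admissible_derivE[OF nonlin_admissible] by blast
    have "f' (u r) = p r"
      by (rule halfline_deriv_unique[OF f'(1)[OF u_nonneg[OF r]] nonlin_deriv_u[OF r] u_nonneg[OF r]])
    then have "F r + p r * (z r - u r) \<le> nonlin (z r)"
      using admissible_tangent[OF nonlin_admissible f', of "u r" "z r"] u_nonneg[OF r] z0[of r] r
      by (simp add: nonlin_u)
    moreover have "real k - 1 = 2 * a" by (simp add: a_def real_k)
    then have "p r \<le> a\<^sup>2 / r\<^sup>2"
      using p_upper[OF r] by (simp add: power_mult_distrib)
    then have "p r * (u r - z r) \<le> a\<^sup>2 / r\<^sup>2 * (u r - z r)"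
      using z_le[OF r] by (intro mult_right_mono) auto
    moreover have "(1 - l) * nonlin (z r) \<le> (1 - l) * F r"
      using l z_le[OF r] z0[of r] r nonlin_u[OF r] admissible_mono[OF nonlin_admissible, of "z r" "u r"]
      by (intro mult_left_mono) auto
    ultimately show ?thesis by (simp add: G_def algebra_simps)
  qed
  \<comment> \<open>Each term of \<open>K\<close> is at most a multiple of \<open>r\<close>: the
    growth of \<open>u\<close> and \<eta> is governed by \<open>kap = a - 2\<close>, which leaves a
    factor \<open>r powr 2\<close> to spare.\<close>
  have K0: "(K \<longlongrightarrow> 0) (at_right 0)"
  proof (rule tendsto_zero_linear)
    fix r :: real assume r: "0 < r" "r \<le> 1"
    have "G t \<le> G s" if "0 \<le> s" "s \<le> t" "t \<le> 1" for s t
      using that radial_limit_antimono[OF nonlin_admissible l0 bdd that] z0[of t]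
      by (auto simp: G_def z_def intro!: mult_left_mono l0 admissible_mono[OF nonlin_admissible])
    then have A: "0 \<le> avg k G r" "avg k G r \<le> avg k G 0"
      using r by (auto intro!: avg_nonneg Gc G0 simp del: avg_at_zero) (intro avg_antimono Gc; auto)
    have 1: "\<bar>r ^ k * \<eta> r * r powr (- a)\<bar> \<le> r"
    proof -
      have "r ^ k * \<eta> r * r powr (- a) \<le> r powr (2 * kap + 5) * r powr (- kap - 1) * r powr (- a)"
        using r \<eta>_le[OF r] by (intro mult_right_mono) (auto simp: power_k mult_left_mono)
      also have "\<dots> = r powr 2" by (simp add: powr_add[symmetric] a_def)
      also have "\<dots> \<le> r" using r by (intro powr_le_id) auto
      finally show ?thesis using \<eta>_pos[OF r] r by simp
    qed
    have 2: "\<bar>r ^ (k + 1) * avg k G r * r powr (- a)\<bar> \<le> avg k G 0 * r"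
    proof -
      have "r ^ (k + 1) * r powr (- a) = r powr (kap + 4)"
        using r by (simp add: power_k a_def powr_add[symmetric] powr_mult_base)
      also have "\<dots> \<le> r" using r kap_pos by (intro powr_le_id) auto
      finally have "avg k G r * (r ^ (k + 1) * r powr (- a)) \<le> avg k G 0 * r"
        using A r by (intro mult_mono) auto
      then show ?thesis using A r by (simp add: mult_ac)
    qed
    have 3: "\<bar>(u r - green k G r) * r powr a\<bar> \<le> (1 / kap) * r"
    proof -
      have "(u r - green k G r) * r powr a \<le> (r powr (- kap) / kap) * r powr a"
        using u_le[OF r] z0[of r] zg[of r] r by (intro mult_right_mono) auto
      also have "\<dots> = r powr 2 / kap" by (simp add: powr_add[symmetric] a_def)
      also have "\<dots> \<le> r / kap" using r kap_pos by (intro divide_right_mono powr_le_id) auto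
      finally show ?thesis using z_le[OF r] zg[of r] r by simp
    qed
    have "\<bar>K r\<bar> \<le> \<bar>r ^ k * \<eta> r * r powr (- a)\<bar> + \<bar>r ^ (k + 1) * avg k G r * r powr (- a)\<bar> + a * \<bar>(u r - green k G r) * r powr a\<bar>"
    proof -
      have "K r = - (r ^ k * \<eta> r * r powr (- a)) + r ^ (k + 1) * avg k G r * r powr (- a) + a * ((u r - green k G r) * r powr a)"
        by (simp add: K_def algebra_simps)
      moreover have "\<bar>a * ((u r - green k G r) * r powr a)\<bar> = a * \<bar>(u r - green k G r) * r powr a\<bar>"
        using a by (simp add: abs_mult)
      ultimately show ?thesis by linarith
    qed
    also have "\<dots> \<le> r + avg k G 0 * r + a * ((1 / kap) * r)"
      using 1 2 3 a by (intro add_mono mult_left_mono) auto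
    finally show "\<bar>K r\<bar> \<le> (1 + avg k G 0 + a / kap) * r" by (simp add: algebra_simps)
  qed
  have Kge: "- (c * r) \<le> K r" if r: "0 < r" "r \<le> 1" for r
  proof -
    have "0 \<le> K r + c * r"
    proof (rule incseq_from_zero[OF _ _ _ r])
      show "continuous_on {0<..1} (\<lambda>r. K r + c * r)"
        unfolding K_def[abs_def]
        by (intro continuous_intros \<eta>_cont u_cont continuous_on_subset[OF continuous_on_avg[OF Gc]]
            continuous_on_subset[OF continuous_on_green[OF Gc]]) auto
      show "((\<lambda>r. K r + c * r) \<longlongrightarrow> 0) (at_right 0)"
        using tendsto_add[OF K0 tendsto_mult_right[OF tendsto_ident_at, of c 0]] by (simp add: mult.commute)
      fix t :: real assume t: "0 < t" "t < 1"
      define D where "D = - ((t ^ k * F t - t ^ k * G t) * t powr (- a) +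
          - a * t powr (- a - 1) * (t ^ k * \<eta> t - t ^ (k + 1) * avg k G t))
          + a * ((- \<eta> t - - (t * avg k G t)) * t powr a + a * t powr (a - 1) * (u t - green k G t))"
      have "(K has_real_derivative D) (at t)"
        unfolding K_def[abs_def] D_def
        using t by (intro DERIV_add DERIV_minus DERIV_mult DERIV_cmult DERIV_diff \<eta>_deriv u_deriv
            power_avg_deriv green_deriv Gc has_real_derivative_powr) auto
      then have "((\<lambda>r. K r + c * r) has_real_derivative D + c) (at t)"
        using DERIV_add[OF _ DERIV_cmult_Id] by blast
      moreover have "0 \<le> D + c"
      proof -
        have tk: "t ^ k = t powr (a + a + 1)"
          using t by (simp add: power_k a_def add.commute)
        have e: "t powr (a + a + 1) * t powr (- a) = t powr (a + 1)" "t powr (- a - 1) * t powr (a + a + 1) = t powr a"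
          by (simp_all add: powr_add[symmetric])
        have "D = - (t powr (a + a + 1) * t powr (- a) * (F t - G t))
            + a * (t powr (- a - 1) * t powr (a + a + 1)) * (\<eta> t - t * avg k G t)
            - a * (\<eta> t - t * avg k G t) * t powr a + a\<^sup>2 * t powr (a - 1) * (u t - green k G t)"
          by (simp add: D_def tk algebra_simps power2_eq_square)
        also have "\<dots> = a\<^sup>2 * t powr (a - 1) * (u t - z t) - t powr (a + 1) * (F t - G t)"
          unfolding e using zg[of t] t by (simp add: algebra_simps)
        also have "a\<^sup>2 * t powr (a - 1) = t powr (a + 1) * (a\<^sup>2 / t\<^sup>2)"
          using t powr_add[of t "a - 1" 2] by (simp add: add.commute)
        finally have D: "D = t powr (a + 1) * (a\<^sup>2 / t\<^sup>2 * (u t - z t) - (F t - G t))"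
          by (simp add: algebra_simps)
        have "t powr (a + 1) * - ((1 - l) * F t) \<le> D"
          unfolding D using FG[of t] t by (intro mult_left_mono) auto
        moreover have "(1 - l) * (t powr (a + 1) * F t) \<le> (1 - l) * ((real k - 1) * 1)"
        proof -
          have "t powr (a + 1) * F t \<le> t powr (a + 1) * ((real k - 1) * t powr (- kap - 2))"
            using F_le[of t] t by (intro mult_left_mono) auto
          also have "\<dots> = (real k - 1) * (t powr (a + 1) * t powr (- kap - 2))" by simp
          also have "t powr (a + 1) * t powr (- kap - 2) = t"
            using t by (simp add: powr_add[symmetric] a_def)
          also have "(real k - 1) * t \<le> (real k - 1) * 1"
            using t k by (intro mult_left_mono) auto
          finally show ?thesis using l by (intro mult_left_mono) auto
        qed
        ultimately show ?thesis by (simp add: c_def algebra_simps)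
      qed
      ultimately show "\<exists>D. ((\<lambda>r. K r + c * r) has_real_derivative D) (at t) \<and> 0 \<le> D" by blast
    qed
    then show ?thesis by simp
  qed
  \<comment> \<open>The first summand is the quotient of \<open>u - z\<close> by \<psi>. Its
    derivative is \<open>K r / r\<close>, since \<open>r ^ k\<close> times the square of \<psi> is
    \<open>r\<close>; the term \<open>c * r\<close> compensates the lower bound on
    \<open>K\<close>.\<close>
  define H where "H r = (u r - green k G r) * r powr a + c * r" for r
  have "H r \<le> H 1"
  proof (rule DERIV_nonneg_imp_increasing_open[OF r(2)])
    show "continuous_on {r..1} H"
      unfolding H_def[abs_def] using r
      by (intro continuous_intros continuous_on_subset[OF u_cont] continuous_on_subset[OF continuous_on_green[OF Gc]]) auto
    fix t assume "r < t" "t < 1"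
    then have t: "0 < t" "t < 1" using r by auto
    have "(H has_real_derivative ((- \<eta> t - - (t * avg k G t)) * t powr a + a * t powr (a - 1) * (u t - green k G t)) + c) (at t)"
      unfolding H_def[abs_def] using t
      by (intro DERIV_add DERIV_mult DERIV_cmult_Id DERIV_diff u_deriv green_deriv Gc has_real_derivative_powr) auto
    moreover have "((- \<eta> t - - (t * avg k G t)) * t powr a + a * t powr (a - 1) * (u t - green k G t)) = K t / t"
    proof -
      have "t ^ k * t powr (- a) = t * t powr a"
        using t by (simp add: power_k a_def powr_add[symmetric] powr_mult_base add.commute)
      then have 1: "(t ^ k * \<eta> t - t ^ (k + 1) * avg k G t) * t powr (- a) = t * (t powr a * (\<eta> t - t * avg k G t))"
        by (simp add: algebra_simps)
      have 2: "t powr a = t * t powr (a - 1)"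
        using t by (simp add: powr_mult_base)
      show ?thesis
        unfolding K_def 1 using t by (simp add: field_simps 2)
    qed
    moreover have "- c \<le> K t / t"
      using Kge[of t] t by (simp add: le_divide_eq)
    ultimately show "\<exists>D. (H has_real_derivative D) (at t) \<and> 0 \<le> D"
      by (intro exI[of _ "K t / t + c"]) auto
  qed
  then have "(u r - z r) * r powr a + c * r \<le> c"
    using zg[of r] r by (simp add: H_def u_one)
  moreover have "0 \<le> c * r" using c r by simp
  ultimately have "(u r - z r) * r powr a \<le> c" by linarith
  then show ?thesis
    by (simp add: z_def a_def c_def)
qed

text \<open>At \<open>l = 1\<close> the right side of \<open>u_minus_limit_le\<close> is 0, so a
  bounded radial limit would dominate \<open>u\<close>, which is at least
  \<open>- ln r\<close>.\<close>

lemma not_iterates_bounded_1: "\<not> iterates_bounded k nonlin 1"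
proof
  assume bdd: "iterates_bounded k nonlin 1"
  define M where "M = radial_limit k nonlin 1 0"
  define r where "r = exp (- M - 1)"
  have "0 \<le> M" by (auto simp: M_def intro!: radial_limit_nonneg[OF nonlin_admissible _ bdd])
  then have r: "0 < r" "r \<le> 1" by (auto simp: r_def)
  have "(u r - radial_limit k nonlin 1 r) * r powr (kap + 2) \<le> 0"
    using u_minus_limit_le[OF _ _ bdd r] by simp
  then have "u r \<le> radial_limit k nonlin 1 r"
    using r by (simp add: mult_le_0_iff)
  also have "\<dots> \<le> M"
    unfolding M_def using r by (intro radial_limit_antimono[OF nonlin_admissible _ bdd]) auto
  finally show False
    using u_ge[OF r] by (simp add: r_def)
qed

lemma not_iterates_bounded_ge_1:
  assumes "1 \<le> l"
  shows "\<not> iterates_bounded k nonlin l"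
proof
  assume "iterates_bounded k nonlin l"
  then obtain K where "\<And>m. radial_iterate k nonlin l m 0 \<le> K"
    by (auto simp: iterates_bounded_def)
  then have "iterates_bounded k nonlin 1"
    using iterate_mono_parameter[OF nonlin_admissible, of 1 l 0 k] assms
    unfolding iterates_bounded_def by (meson atLeastAtMost_iff order.refl order.trans zero_le_one)
  then show False using not_iterates_bounded_1 by simp
qed

section \<open>Convergence of the minimal solutions to the singular profile\<close>

lemma radial_limit_le_u:
  assumes "0 < l" "l < 1" "0 < r" "r \<le> 1"
  shows "radial_limit k nonlin l r \<le> u r"
  by (rule LIMSEQ_le_const2[OF iterates_tendsto[OF nonlin_admissible _ iterates_bounded_below_1[OF assms(1,2)]]])
    (use assms in \<open>auto intro!: exI[of _ 0] iterate_le_u\<close>)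

lemma eventually_at_left_1: "\<forall>\<^sub>F l in at_left (1::real). 0 < l \<and> l < 1"
  unfolding eventually_at_left_field by (intro exI[of _ 0]) auto

lemma radial_limit_tendsto_u:
  assumes r: "0 < r" "r \<le> 1"
  shows "((\<lambda>l. radial_limit k nonlin l r) \<longlongrightarrow> u r) (at_left 1)"
proof (rule tendsto_sandwich)
  show "\<forall>\<^sub>F l in at_left 1. u r - (1 - l) * (real k - 1) / r powr (kap + 2) \<le> radial_limit k nonlin l r"
    using eventually_at_left_1
  proof eventually_elim
    case (elim l)
    then show ?case
      using u_minus_limit_le[OF _ _ iterates_bounded_below_1 r, of l] r
      by (simp add: field_simps)
  qed
  show "\<forall>\<^sub>F l in at_left 1. radial_limit k nonlin l r \<le> u r"
    using eventually_at_left_1 by eventually_elim (simp add: radial_limit_le_u r)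
  have "((\<lambda>l. u r - (1 - l) * (real k - 1) / r powr (kap + 2)) \<longlongrightarrow> u r - (1 - 1) * (real k - 1) / r powr (kap + 2)) (at_left 1)"
    using r by (intro tendsto_intros) auto
  then show "((\<lambda>l. u r - (1 - l) * (real k - 1) / r powr (kap + 2)) \<longlongrightarrow> u r) (at_left 1)" by simp
qed simp

lemma radial_limit_tendsto_infinity: "((\<lambda>l. ereal (radial_limit k nonlin l 0)) \<longlongrightarrow> \<infinity>) (at_left 1)"
  unfolding tendsto_PInfty
proof
  fix M :: real
  define r where "r = exp (- \<bar>M\<bar> - 1)"
  have r: "0 < r" "r \<le> 1" by (auto simp: r_def)
  have "M < u r" using u_ge[OF r] by (simp add: r_def)
  then have "\<forall>\<^sub>F l in at_left 1. M < radial_limit k nonlin l r"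
    by (rule order_tendstoD(1)[OF radial_limit_tendsto_u[OF r]])
  then show "\<forall>\<^sub>F l in at_left 1. ereal M < ereal (radial_limit k nonlin l 0)"
    using eventually_at_left_1
  proof eventually_elim
    case (elim l)
    then show ?case
      using radial_limit_antimono[OF nonlin_admissible _ iterates_bounded_below_1, of l 0 r] r by simp
  qed
qed

lemma extremal_parameter_nonlin:
  assumes n: "k + 1 = CARD('n)"
  shows "extremal_parameter TYPE('n::finite) nonlin 1"
  unfolding extremal_parameter_def
proof (intro conjI allI impI notI)
  fix l :: real assume "0 < l \<and> l < 1"
  then show "\<exists>u :: real ^ 'n \<Rightarrow> real. minimal_solution nonlin l u"
    using radial_limit_minimal[OF nonlin_admissible n _ iterates_bounded_below_1] by blast
next
  fix l :: real assume l: "1 < l" and "\<exists>v :: real ^ 'n \<Rightarrow> real. classical_solution nonlin l v \<or> weak_solution nonlin l v"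
  then obtain v :: "real ^ 'n \<Rightarrow> real" where "classical_solution nonlin l v \<or> weak_solution nonlin l v" by blast
  then show False
  proof
    assume "classical_solution nonlin l v"
    then show False
      using classical_iterates_bounded[OF nonlin_admissible n, of l v] not_iterates_bounded_ge_1[of l] l by simp
  next
    assume "weak_solution nonlin l v"
    then show False
      using weak_iterates_bounded[OF nonlin_admissible n, of l v 1] not_iterates_bounded_1 l by simp
  qed
qed simp

lemma extremal_solution_nonlin:
  assumes n: "k + 1 = CARD('n)"
  shows "extremal_solution nonlin 1 (\<lambda>x :: real ^ 'n. if x = 0 then \<infinity> else ereal (u (norm x)))"
  unfolding extremal_solution_def
proof (intro exI[of _ "\<lambda>l x. radial_limit k nonlin l (norm x)"] conjI allI impI ballI)
  fix l :: real assume "0 < l \<and> l < 1"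
  then show "minimal_solution nonlin l (\<lambda>x :: real ^ 'n. radial_limit k nonlin l (norm x))"
    using radial_limit_minimal[OF nonlin_admissible n _ iterates_bounded_below_1] by blast
next
  fix x :: "real ^ 'n" assume "x \<in> cball 0 1"
  then show "((\<lambda>l. ereal (radial_limit k nonlin l (norm x))) \<longlongrightarrow> (if x = 0 then \<infinity> else ereal (u (norm x)))) (at_left 1)"
    using radial_limit_tendsto_infinity radial_limit_tendsto_u[of "norm x"] by auto
qed

end

section \<open>Uniqueness\<close>

context singular_profile
begin

definition source :: "(real \<Rightarrow> real) \<Rightarrow> real \<Rightarrow> real \<Rightarrow> real"
  where "source g l r = l * g (radial_limit k g l r)"

text \<open>For the fluxes \<open>E = r ^ k * \<eta> r\<close> and
  \<open>A = r ^ (k + 1) * avg k (source g l) r\<close> this is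
  \<open>(A' * E - A * E') / r ^ k\<close>, because \<open>E' = r ^ k * F r\<close> and
  \<open>A' = r ^ k * source g l r\<close>.\<close>

definition wronskian :: "(real \<Rightarrow> real) \<Rightarrow> real \<Rightarrow> real \<Rightarrow> real"
  where "wronskian g l r = source g l r * (r ^ k * \<eta> r) - (r ^ (k + 1) * avg k (source g l) r) * F r"

text \<open>The quotient of the slope of the minimal solution by that of \<open>u\<close>, taken at
  the boundary, where it is largest. Its limit as \<open>l\<close> tends to 1 will be the constant
  \<alpha>.\<close>

definition slope :: "(real \<Rightarrow> real) \<Rightarrow> real \<Rightarrow> real"
  where "slope g l = avg k (source g l) 1 / \<eta> 1"

lemma flux_\<eta>_mono:
  assumes "0 < r" "r \<le> s" "s \<le> 1"
  shows "r ^ k * \<eta> r \<le> s ^ k * \<eta> s"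
proof (rule DERIV_nonneg_imp_increasing_open[OF assms(2)])
  show "continuous_on {r..s} (\<lambda>r. r ^ k * \<eta> r)"
    using assms by (intro continuous_intros continuous_on_subset[OF \<eta>_cont]) auto
  show "\<exists>D. ((\<lambda>r. r ^ k * \<eta> r) has_real_derivative D) (at t) \<and> 0 \<le> D" if "r < t" "t < s" for t
    using \<eta>_deriv[of t] F_pos[of t] that assms by (intro exI[of _ "t ^ k * F t"]) auto
qed

section \<open>Sturm comparison for a competing nonlinearity\<close>

context
  fixes g g' V :: "real \<Rightarrow> real"
  assumes adm: "admissible g"
    and g': "\<And>t. 0 \<le> t \<Longrightarrow> (g has_real_derivative g' t) (at t within {0..})" "continuous_on {0..} g'"
    and bdd: "\<And>l. 0 < l \<Longrightarrow> l < 1 \<Longrightarrow> iterates_bounded k g l"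
    and V: "\<And>r. 0 < r \<Longrightarrow> r \<le> 1 \<Longrightarrow> ((\<lambda>l. radial_limit k g l r) \<longlongrightarrow> V r) (at_left 1)"
    and V0: "\<And>r. 0 < r \<Longrightarrow> r \<le> 1 \<Longrightarrow> 0 \<le> V r"
    and gV: "\<And>r. 0 < r \<Longrightarrow> r \<le> 1 \<Longrightarrow> (g has_real_derivative p r) (at (V r) within {0..})"
begin

lemma radial_limit_mono_parameter:
  assumes "0 < l" "l \<le> l'" "l' < 1" "r \<in> {0..1}"
  shows "radial_limit k g l r \<le> radial_limit k g l' r"
  using assms
  by (intro LIMSEQ_le[OF iterates_tendsto[OF adm _ bdd] iterates_tendsto[OF adm _ bdd]])
    (auto intro!: exI[of _ 0] iterate_mono_parameter[OF adm])

lemma radial_limit_le_V: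
  assumes l: "0 < l" "l < 1" and r: "0 < r" "r \<le> 1"
  shows "radial_limit k g l r \<le> V r"
proof (rule tendsto_lowerbound[OF V[OF r]])
  show "\<forall>\<^sub>F l' in at_left 1. radial_limit k g l r \<le> radial_limit k g l' r"
    unfolding eventually_at_left_field using l r
    by (intro exI[of _ l]) (auto intro!: radial_limit_mono_parameter)
qed simp

lemma g'_V: "0 < r \<Longrightarrow> r \<le> 1 \<Longrightarrow> g' (V r) = p r"
  using halfline_deriv_unique[OF g'(1) gV] V0 by blast

context
  fixes l :: real
  assumes l: "0 < l" "l < 1"
begin

lemma limit_nonneg: "r \<in> {0..1} \<Longrightarrow> 0 \<le> radial_limit k g l r"
  using radial_limit_nonneg[OF adm _ bdd] l by simp

lemma limit_cont: "continuous_on {0..1} (radial_limit k g l)"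
  using radial_limit_regular(1)[OF adm _ bdd] l by simp

lemma limit_eq_green: "r \<in> {0..1} \<Longrightarrow> radial_limit k g l r = green k (source g l) r"
  using radial_limit_regular(2)[OF adm _ bdd, of l r] l by (simp add: source_def[abs_def])

lemma source_cont: "continuous_on {0..1} (source g l)"
  unfolding source_def[abs_def] by (intro continuous_on_source[OF adm] limit_cont limit_nonneg)

lemma source_pos: "r \<in> {0..1} \<Longrightarrow> 0 < source g l r"
  using l admissible_pos[OF adm limit_nonneg] by (simp add: source_def)

lemma source_antimono: "0 \<le> r \<Longrightarrow> r \<le> s \<Longrightarrow> s \<le> 1 \<Longrightarrow> source g l s \<le> source g l r"
  using l radial_limit_antimono[OF adm _ bdd, of l r s]
  by (auto simp: source_def intro!: mult_left_mono admissible_mono[OF adm] limit_nonneg)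

lemma avg_source_nonneg: "r \<in> {0..1} \<Longrightarrow> 0 \<le> avg k (source g l) r"
  by (intro avg_nonneg source_cont) (auto intro: less_imp_le[OF source_pos])

lemma avg_source_antimono: "0 \<le> r \<Longrightarrow> r \<le> s \<Longrightarrow> s \<le> 1 \<Longrightarrow> avg k (source g l) s \<le> avg k (source g l) r"
  by (intro avg_antimono source_cont source_antimono)

lemma slope_nonneg: "0 \<le> slope g l"
  using avg_source_nonneg[of 1] \<eta>_pos[of 1] by (simp add: slope_def)

text \<open>Minimal solutions lie below \<open>V\<close>, and \<open>g'\<close> is monotone with
  \<open>g' (V r) = p r\<close>. This gives the sign that makes the Wronskian nondecreasing.\<close>

lemma derivative_gap:
  assumes r: "0 < r" "r \<le> 1"
  shows "0 \<le> g' (radial_limit k g l r)" "l * g' (radial_limit k g l r) \<le> p r"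
proof -
  have z: "0 \<le> radial_limit k g l r" using limit_nonneg[of r] r by simp
  show *: "0 \<le> g' (radial_limit k g l r)"
    by (rule admissible_deriv_nonneg[OF adm g' z])
  have "g' (radial_limit k g l r) \<le> g' (V r)"
    using radial_limit_le_V[OF l r] z by (intro admissible_deriv_mono[OF adm g'])
  moreover have "l * g' (radial_limit k g l r) \<le> 1 * g' (radial_limit k g l r)"
    using l * by (intro mult_right_mono) auto
  ultimately show "l * g' (radial_limit k g l r) \<le> p r"
    using g'_V[OF r] by simp
qed

lemma source_deriv:
  assumes r: "0 < r" "r < 1"
  shows "(source g l has_real_derivative - (l * g' (radial_limit k g l r) * (r * avg k (source g l) r))) (at r)"
proof -
  have z: "0 \<le> radial_limit k g l r" using limit_nonneg[of r] r by simp
  have "(green k (source g l) has_real_derivative - (r * avg k (source g l) r)) (at r within {0..1})"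
    using r by (intro green_deriv_within source_cont) auto
  then have zd: "(radial_limit k g l has_real_derivative - (r * avg k (source g l) r)) (at r within {0..1})"
    by (rule has_field_derivative_transform_within[where d=1]) (use r in \<open>auto simp: limit_eq_green\<close>)
  have "(g has_real_derivative g' (radial_limit k g l r)) (at (radial_limit k g l r) within radial_limit k g l ` {0..1})"
    by (rule DERIV_subset[OF g'(1)[OF z]]) (auto intro: limit_nonneg)
  from DERIV_cmult[OF DERIV_image_chain[OF this zd], of l] show ?thesis
    using r at_within_Icc_at[of 0 r 1] by (simp add: source_def[abs_def] o_def mult.assoc)
qed

lemma wronskian_deriv:
  assumes r: "0 < r" "r < 1"
  shows "(wronskian g l has_real_derivative
    r ^ k * \<eta> r * (r * avg k (source g l) r) * (p r - l * g' (radial_limit k g l r))) (at r)"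
proof -
  have "(wronskian g l has_real_derivative
      (- (l * g' (radial_limit k g l r) * (r * avg k (source g l) r)) * (r ^ k * \<eta> r) + (r ^ k * F r) * source g l r)
      - ((r ^ k * source g l r) * F r + - (p r * \<eta> r) * (r ^ (k + 1) * avg k (source g l) r))) (at r)"
    unfolding wronskian_def[abs_def]
    by (intro DERIV_diff DERIV_mult source_deriv \<eta>_deriv F_deriv power_avg_deriv source_cont r)
  then show ?thesis
    by (rule DERIV_cong) (simp add: algebra_simps)
qed

lemma wronskian_deriv_nonneg:
  assumes r: "0 < r" "r \<le> 1"
  shows "0 \<le> r ^ k * \<eta> r * (r * avg k (source g l) r) * (p r - l * g' (radial_limit k g l r))"
  using derivative_gap[OF r] avg_source_nonneg[of r] \<eta>_pos[OF r] r
  by (intro mult_nonneg_nonneg) auto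

lemma wronskian_cont: "continuous_on {0<..1} (wronskian g l)"
  unfolding wronskian_def[abs_def]
  by (intro continuous_intros \<eta>_cont F_cont continuous_on_subset[OF continuous_on_avg[OF source_cont]]
      continuous_on_subset[OF source_cont]) auto

lemma wronskian_mono:
  assumes "0 < r" "r \<le> s" "s \<le> 1"
  shows "wronskian g l r \<le> wronskian g l s"
proof (rule DERIV_nonneg_imp_increasing_open[OF assms(2)])
  show "continuous_on {r..s} (wronskian g l)"
    using assms by (intro continuous_on_subset[OF wronskian_cont]) auto
  show "\<exists>D. (wronskian g l has_real_derivative D) (at t) \<and> 0 \<le> D" if "r < t" "t < s" for t
    using wronskian_deriv[of t] wronskian_deriv_nonneg[of t] that assms by (intro exI conjI) auto
qed

text \<open>The initial value at the origin is 0: the minimal solution is regular there, while the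
  weighted \<eta> and \<open>F\<close> are bounded by multiples of \<open>t\<close>.\<close>

lemma wronskian_nonneg:
  assumes r: "0 < r" "r \<le> 1"
  shows "0 \<le> wronskian g l r"
proof (rule incseq_from_zero[OF wronskian_cont _ _ r])
  show "\<exists>D. (wronskian g l has_real_derivative D) (at t) \<and> 0 \<le> D" if "0 < t" "t < 1" for t
    using wronskian_deriv[of t] wronskian_deriv_nonneg[of t] that by (intro exI conjI) auto
  show "(wronskian g l \<longlongrightarrow> 0) (at_right 0)"
  proof (rule tendsto_zero_linear)
    fix t :: real assume t: "0 < t" "t \<le> 1"
    let ?a = "avg k (source g l) t"
    have a: "0 \<le> ?a" "?a \<le> avg k (source g l) 0"
      using avg_source_nonneg[of t] avg_source_antimono[of 0 t] t by auto
    have 1: "0 \<le> source g l t * (t ^ k * \<eta> t)" "source g l t * (t ^ k * \<eta> t) \<le> source g l 0 * t"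
      using source_pos[of t] source_pos[of 0] source_antimono[of 0 t] \<eta>_pos[OF t] flux_\<eta>_le(1)[OF t] t
      by (auto intro!: mult_mono mult_nonneg_nonneg)
    have "t ^ (k + 1) * F t \<le> t ^ (k + 1) * ((real k - 1) * t powr (- kap - 2))"
      using F_le[OF t] t by (intro mult_left_mono) auto
    also have "\<dots> = (real k - 1) * t powr (kap + 4)"
      using t by (simp add: power_k powr_mult_base powr_add[symmetric])
    also have "\<dots> \<le> (real k - 1) * t"
      using t k kap_pos by (intro mult_left_mono powr_le_id) auto
    finally have "t ^ (k + 1) * F t \<le> (real k - 1) * t" .
    then have "?a * (t ^ (k + 1) * F t) \<le> avg k (source g l) 0 * ((real k - 1) * t)"
      by (rule mult_mono[OF a(2)]) (use a F_pos[OF t] t in auto)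
    moreover have "0 \<le> ?a * (t ^ (k + 1) * F t)" using a F_pos[OF t] t by simp
    moreover have "wronskian g l t = source g l t * (t ^ k * \<eta> t) - ?a * (t ^ (k + 1) * F t)"
      by (simp add: wronskian_def)
    ultimately show "\<bar>wronskian g l t\<bar> \<le> (source g l 0 + avg k (source g l) 0 * (real k - 1)) * t"
      using 1 source_pos[of 0] unfolding distrib_right by (simp only: mult.assoc)
  qed
qed

lemma ratio_deriv:
  assumes r: "0 < r" "r < 1"
  shows "((\<lambda>r. (r ^ (k + 1) * avg k (source g l) r) / (r ^ k * \<eta> r)) has_real_derivative
    r ^ k * wronskian g l r / (r ^ k * \<eta> r)\<^sup>2) (at r)"
proof -
  have "((\<lambda>r. (r ^ (k + 1) * avg k (source g l) r) / (r ^ k * \<eta> r)) has_real_derivative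
      ((r ^ k * source g l r) * (r ^ k * \<eta> r) - (r ^ (k + 1) * avg k (source g l) r) * (r ^ k * F r))
        / ((r ^ k * \<eta> r) * (r ^ k * \<eta> r))) (at r)"
    using flux_\<eta>_pos[of r] r by (intro DERIV_divide power_avg_deriv source_cont \<eta>_deriv) auto
  then show ?thesis
    by (rule DERIV_cong) (simp add: wronskian_def power2_eq_square right_diff_distrib mult_ac)
qed

lemma ratio_cont: "continuous_on {0<..1} (\<lambda>r. (r ^ (k + 1) * avg k (source g l) r) / (r ^ k * \<eta> r))"
  using flux_\<eta>_pos
  by (intro continuous_intros \<eta>_cont continuous_on_subset[OF continuous_on_avg[OF source_cont]]) force+

lemma ratio_le_slope:
  assumes r: "0 < r" "r \<le> 1"
  shows "r * avg k (source g l) r \<le> slope g l * \<eta> r"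
proof -
  let ?R = "\<lambda>r. (r ^ (k + 1) * avg k (source g l) r) / (r ^ k * \<eta> r)"
  have "?R r \<le> ?R 1"
  proof (rule DERIV_nonneg_imp_increasing_open[OF r(2), of ?R])
    show "continuous_on {r..1} ?R" using r by (intro continuous_on_subset[OF ratio_cont]) auto
    show "\<exists>D. (?R has_real_derivative D) (at t) \<and> 0 \<le> D" if "r < t" "t < 1" for t
    proof (intro exI conjI)
      show "(?R has_real_derivative t ^ k * wronskian g l t / (t ^ k * \<eta> t)\<^sup>2) (at t)"
        using that r by (intro ratio_deriv) auto
      show "0 \<le> t ^ k * wronskian g l t / (t ^ k * \<eta> t)\<^sup>2"
        using that r wronskian_nonneg[of t] by simp
    qed
  qed
  moreover have "?R 1 = slope g l" by (simp add: slope_def)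
  moreover have "?R r = (r * avg k (source g l) r) / \<eta> r" using r by simp
  ultimately show ?thesis
    using \<eta>_pos[OF r] by (simp add: divide_le_eq)
qed

text \<open>The converse of \<open>ratio_le_slope\<close> up to an error. On \<open>{r..1}\<close>
  the quotient of the fluxes grows at a rate of at most \<open>wronskian g l 1\<close> over the
  square of the flux of \<eta> at \<open>r\<close>, since both the Wronskian and that flux are
  nondecreasing.\<close>

lemma slope_le_ratio:
  assumes r: "0 < r" "r \<le> s" "s \<le> 1"
  shows "(slope g l - wronskian g l 1 / (r ^ k * \<eta> r)\<^sup>2) * \<eta> s \<le> s * avg k (source g l) s"
proof -
  let ?R = "\<lambda>r. (r ^ (k + 1) * avg k (source g l) r) / (r ^ k * \<eta> r)"
  define c where "c = wronskian g l 1 / (r ^ k * \<eta> r)\<^sup>2"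
  have c0: "0 \<le> c" using wronskian_nonneg[of 1] by (simp add: c_def)
  have s: "0 < s" using r by simp
  have "?R 1 - c * 1 \<le> ?R s - c * s"
  proof (rule DERIV_nonpos_imp_decreasing_open[OF r(3), of "\<lambda>s. ?R s - c * s"])
    show "continuous_on {s..1} (\<lambda>s. ?R s - c * s)"
      using r by (intro continuous_intros continuous_on_subset[OF ratio_cont]) auto
    fix t assume "s < t" "t < 1"
    then have t: "0 < t" "t < 1" "r \<le> t" using r by auto
    have "t ^ k * wronskian g l t / (t ^ k * \<eta> t)\<^sup>2 \<le> 1 * wronskian g l 1 / (r ^ k * \<eta> r)\<^sup>2"
    proof (rule frac_le)
      show "t ^ k * wronskian g l t \<le> 1 * wronskian g l 1"
        using t wronskian_nonneg[of t] wronskian_mono[of t 1] by (intro mult_mono power_le_one) auto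
      show "(r ^ k * \<eta> r)\<^sup>2 \<le> (t ^ k * \<eta> t)\<^sup>2"
        using t r by (intro power_mono flux_\<eta>_mono less_imp_le[OF flux_\<eta>_pos]) auto
      show "0 < (r ^ k * \<eta> r)\<^sup>2"
        using flux_\<eta>_pos[of r] r by (intro zero_less_power) auto
    qed (use wronskian_nonneg[of 1] in simp)
    moreover have "((\<lambda>s. ?R s - c * s) has_real_derivative t ^ k * wronskian g l t / (t ^ k * \<eta> t)\<^sup>2 - c) (at t)"
      by (intro DERIV_diff ratio_deriv DERIV_cmult_Id t)
    ultimately show "\<exists>D. ((\<lambda>s. ?R s - c * s) has_real_derivative D) (at t) \<and> D \<le> 0"
      by (intro exI conjI) (auto simp: c_def)
  qed
  moreover have "?R 1 = slope g l" by (simp add: slope_def)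
  moreover have "?R s = (s * avg k (source g l) s) / \<eta> s" using s by simp
  moreover have "0 \<le> c * s" using c0 s by simp
  ultimately have "slope g l - c \<le> (s * avg k (source g l) s) / \<eta> s" by linarith
  then show ?thesis
    using \<eta>_pos[OF s r(3)] by (simp add: le_divide_eq c_def)
qed

text \<open>By \<open>derivative_gap\<close> and \<open>ratio_le_slope\<close> the difference of
  \<open>source g l\<close> and \<open>slope g l * F\<close> is nondecreasing, and at 1 the source
  is \<open>l * g 0\<close>. The bound depends on \<open>l\<close> only through the slope, as needed
  near the origin.\<close>

lemma source_le:
  assumes r: "0 < r" "r \<le> 1"
  shows "source g l r \<le> g 0 + slope g l * F r"
proof -
  have "source g l r - slope g l * F r \<le> source g l 1 - slope g l * F 1"
  proof (rule DERIV_nonneg_imp_increasing_open[OF r(2), of "\<lambda>r. source g l r - slope g l * F r"])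
    show "continuous_on {r..1} (\<lambda>r. source g l r - slope g l * F r)"
      using r by (intro continuous_intros continuous_on_subset[OF source_cont] continuous_on_subset[OF F_cont]) auto
    fix t assume "r < t" "t < 1"
    then have t: "0 < t" "t < 1" "t \<le> 1" using r by auto
    have "((\<lambda>r. source g l r - slope g l * F r) has_real_derivative
        - (l * g' (radial_limit k g l t) * (t * avg k (source g l) t)) - slope g l * - (p t * \<eta> t)) (at t)"
      by (intro DERIV_diff DERIV_cmult source_deriv F_deriv t)
    moreover have "l * g' (radial_limit k g l t) * (t * avg k (source g l) t) \<le> p t * (slope g l * \<eta> t)"
      by (rule mult_mono[OF derivative_gap(2)[OF t(1,3)] ratio_le_slope[OF t(1,3)]])
        (use avg_source_nonneg[of t] p_pos[OF t(1,3)] t in auto)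
    ultimately show "\<exists>D. ((\<lambda>r. source g l r - slope g l * F r) has_real_derivative D) (at t) \<and> 0 \<le> D"
      by (intro exI conjI) (auto simp: algebra_simps)
  qed
  moreover have "source g l 1 \<le> 1 * g 0"
    using l limit_eq_green[of 1] admissible_pos[OF adm, of 0]
    unfolding source_def by (intro mult_mono) auto
  moreover have "0 \<le> slope g l * F 1"
    using slope_nonneg F_pos[of 1] by simp
  ultimately show ?thesis by linarith
qed

lemma limit_between:
  assumes r: "0 < r" "r \<le> 1"
  shows "radial_limit k g l r \<le> slope g l * u r"
    "(slope g l - wronskian g l 1 / (r ^ k * \<eta> r)\<^sup>2) * u r \<le> radial_limit k g l r"
proof -
  let ?z = "green k (source g l)"
  have cont: "continuous_on {r..1} (\<lambda>t. c * u t - ?z t)" for c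
    using r by (intro continuous_intros continuous_on_subset[OF u_cont] continuous_on_subset[OF continuous_on_green[OF source_cont]]) auto
  have d: "((\<lambda>t. c * u t - ?z t) has_real_derivative c * - \<eta> t - - (t * avg k (source g l) t)) (at t)"
    if "r < t" "t < 1" for c t
    using that r by (intro DERIV_diff DERIV_cmult u_deriv green_deriv source_cont) auto
  have "slope g l * u 1 - ?z 1 \<le> slope g l * u r - ?z r"
  proof (rule DERIV_nonpos_imp_decreasing_open[OF r(2) _ cont])
    fix t assume t: "r < t" "t < 1"
    show "\<exists>D. ((\<lambda>t. slope g l * u t - ?z t) has_real_derivative D) (at t) \<and> D \<le> 0"
      using d[OF t, of "slope g l"] ratio_le_slope[of t] t r by (intro exI conjI) auto
  qed
  then show "radial_limit k g l r \<le> slope g l * u r"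
    using limit_eq_green[of r] r by (simp add: u_one)
  define c where "c = slope g l - wronskian g l 1 / (r ^ k * \<eta> r)\<^sup>2"
  have "c * u r - ?z r \<le> c * u 1 - ?z 1"
  proof (rule DERIV_nonneg_imp_increasing_open[OF r(2) _ cont])
    fix t assume t: "r < t" "t < 1"
    show "\<exists>D. ((\<lambda>t. c * u t - ?z t) has_real_derivative D) (at t) \<and> 0 \<le> D"
      using d[OF t, of c] slope_le_ratio[OF r(1), of t] t r by (intro exI conjI) (auto simp: c_def)
  qed
  then show "(slope g l - wronskian g l 1 / (r ^ k * \<eta> r)\<^sup>2) * u r \<le> radial_limit k g l r"
    using limit_eq_green[of r] r by (simp add: u_one c_def)
qed

text \<open>Averages decrease in the radius, so on \<open>{1/2..1}\<close> they are at least the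
  boundary one, and the integral of \<open>s\<close> over this interval is \<open>3 / 8\<close>. The
  bound does not depend on \<open>l\<close>, since \<open>V (1 / 2)\<close> is finite.\<close>

lemma slope_bounded: "slope g l * \<eta> 1 * (3 / 8) \<le> V (1 / 2)"
proof -
  define A where "A = avg k (source g l) 1"
  have "green k (\<lambda>_. A * (real k + 1)) (1 / 2) \<le> green k (source g l) (1 / 2)"
    unfolding green_def
  proof (intro integral_le integrable_continuous_real continuous_on_subset[OF continuous_on_id_avg] source_cont)
    fix s :: real assume s: "s \<in> {1/2..1}"
    then show "s * avg k (\<lambda>_. A * (real k + 1)) s \<le> s * avg k (source g l) s"
      using avg_source_antimono[of s 1] by (simp add: A_def)
  qed auto
  also have "green k (\<lambda>_. A * (real k + 1)) (1 / 2) = A * (3 / 8)"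
    by (simp add: green_const field_simps power2_eq_square)
  also have "green k (source g l) (1 / 2) \<le> V (1 / 2)"
    using radial_limit_le_V[OF l, of "1 / 2"] limit_eq_green[of "1 / 2"] by simp
  finally show ?thesis
    using \<eta>_pos[of 1] by (simp add: slope_def A_def)
qed

text \<open>Splitting at \<open>d\<close> separates two kinds of smallness: the value at
  \<open>d\<close> is of order \<open>d\<close> uniformly in \<open>l\<close>, and on
  \<open>{d..1}\<close> the integrand is a fixed bounded weight times the gap
  \<open>p - l * g'\<close>, which disappears in the limit.\<close>

lemma wronskian_one_le:
  assumes d: "0 < d" "d < 1" and a: "slope g l \<le> a"
  shows "wronskian g l 1 \<le> (g 0 + a * (real k - 1)) * d
    + integral {d..1} (\<lambda>t. t ^ k * \<eta> t * (a * \<eta> t) * (p t - l * g' (radial_limit k g l t)))"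
proof -
  let ?I = "\<lambda>t. t ^ k * \<eta> t * (t * avg k (source g l) t) * (p t - l * g' (radial_limit k g l t))"
  let ?J = "\<lambda>t. t ^ k * \<eta> t * (a * \<eta> t) * (p t - l * g' (radial_limit k g l t))"
  have a0: "0 \<le> a" using a slope_nonneg by simp
  have gz: "continuous_on {d..1} (\<lambda>t. g' (radial_limit k g l t))"
    using d limit_nonneg by (intro continuous_on_compose2[OF g'(2) continuous_on_subset[OF limit_cont]]) auto
  have sub: "{d..1} \<subseteq> {0<..1}" "{d..1} \<subseteq> {0..1}" using d by auto
  have "(?I has_integral wronskian g l 1 - wronskian g l d) {d..1}"
  proof (rule fundamental_theorem_of_calculus_interior)
    show "(wronskian g l has_vector_derivative ?I t) (at t)" if "t \<in> {d<..<1}" for t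
      using wronskian_deriv[of t] that d by (simp add: has_real_derivative_iff_has_vector_derivative)
  qed (use d in \<open>auto intro: continuous_on_subset[OF wronskian_cont]\<close>)
  then have "wronskian g l 1 - wronskian g l d = integral {d..1} ?I" "?I integrable_on {d..1}"
    by (auto simp: integral_unique)
  moreover have "integral {d..1} ?I \<le> integral {d..1} ?J"
  proof (rule integral_le[OF \<open>?I integrable_on {d..1}\<close>])
    show "?J integrable_on {d..1}"
      by (intro integrable_continuous_real continuous_intros gz
          continuous_on_subset[OF \<eta>_cont sub(1)] continuous_on_subset[OF p_cont sub(1)])
    fix t assume "t \<in> {d..1}"
    then have t: "0 < t" "t \<le> 1" using d by auto
    have "t * avg k (source g l) t \<le> a * \<eta> t"
      using ratio_le_slope[OF t] mult_right_mono[OF a less_imp_le[OF \<eta>_pos[OF t]]] by (rule order_trans)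
    then show "?I t \<le> ?J t"
      using derivative_gap[OF t] flux_\<eta>_pos[OF t] by (intro mult_right_mono mult_left_mono) auto
  qed
  moreover have "wronskian g l d \<le> (g 0 + a * (real k - 1)) * d"
  proof -
    have d': "0 < d" "d \<le> 1" using d by auto
    have "wronskian g l d \<le> source g l d * (d ^ k * \<eta> d)"
      using avg_source_nonneg[of d] F_pos[OF d'] d' by (simp add: wronskian_def)
    also have "\<dots> \<le> (g 0 + a * F d) * (d ^ k * \<eta> d)"
    proof (rule mult_right_mono)
      show "source g l d \<le> g 0 + a * F d"
        using source_le[OF d'] mult_right_mono[OF a less_imp_le[OF F_pos[OF d']]] by linarith
    qed (use flux_\<eta>_pos[OF d'] in simp)
    also have "\<dots> = g 0 * (d ^ k * \<eta> d) + a * (d ^ k * \<eta> d * F d)"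
      by (simp add: algebra_simps)
    also have "\<dots> \<le> g 0 * d + a * ((real k - 1) * d)"
      using flux_\<eta>_le[OF d'] a0 admissible_pos[OF adm, of 0] by (intro add_mono mult_left_mono) auto
    finally show ?thesis by (simp add: algebra_simps)
  qed
  ultimately show ?thesis by linarith
qed

end

lemma slope_mono:
  assumes "0 < l" "l \<le> l'" "l' < 1"
  shows "slope g l \<le> slope g l'"
proof -
  have l: "0 < l" "l < 1" "0 < l'" "l' < 1" using assms by auto
  have "avg k (source g l) 1 \<le> avg k (source g l') 1"
  proof (intro avg_mono source_cont l)
    fix t :: real assume t: "t \<in> {0..1}"
    show "source g l t \<le> source g l' t"
      using assms l t radial_limit_mono_parameter[OF assms t] limit_nonneg[OF l(1,2) t] limit_nonneg[OF l(3,4) t]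
      unfolding source_def
      by (intro mult_mono admissible_mono[OF adm]) (auto intro: less_imp_le admissible_pos[OF adm])
  qed simp
  then show ?thesis
    using \<eta>_pos[of 1] by (simp add: slope_def divide_right_mono)
qed

lemma profile_unique:
  "\<exists>\<alpha>>0. \<forall>r. 0 < r \<longrightarrow> r \<le> 1 \<longrightarrow> V r = \<alpha> * u r \<and> g (V r) = \<alpha> * F r"
proof -
  \<comment> \<open>A sequence, as dominated convergence asks for one; the shift by 2 starts it at
    \<open>1 / 2\<close> and keeps it inside the open unit interval.\<close>
  define L where "L j = 1 - 1 / (real j + 2)" for j
  have L: "0 < L j" "L j < 1" for j by (auto simp: L_def field_simps)
  have L_mono: "L i \<le> L j" if "i \<le> j" for i j using that by (auto simp: L_def field_simps)
  have L_lim: "L \<longlonglongrightarrow> 1"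
  proof -
    have "(\<lambda>j. 1 / (real j + 2)) \<longlonglongrightarrow> 0"
      using LIMSEQ_ignore_initial_segment[OF lim_1_over_n, of 2] by (simp add: add.commute)
    from tendsto_diff[OF tendsto_const this, of 1] show ?thesis by (simp add: L_def[abs_def])
  qed
  then have L_left: "filterlim L (at_left 1) sequentially"
    using L(2) by (simp add: filterlim_at less_imp_neq)
  have Z_lim: "(\<lambda>j. radial_limit k g (L j) r) \<longlonglongrightarrow> V r" if "0 < r" "r \<le> 1" for r
    by (rule filterlim_compose[OF V[OF that] L_left])
  have "slope g (L j) \<le> V (1 / 2) / (\<eta> 1 * (3 / 8))" for j
    using slope_bounded[OF L, of j] \<eta>_pos[of 1] by (simp add: field_simps)
  then have "\<exists>a. (\<lambda>j. slope g (L j)) \<longlonglongrightarrow> a"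
    using incseq_convergent[of "\<lambda>j. slope g (L j)"] slope_mono[OF L(1) L_mono L(2)]
    by (metis (mono_tags, lifting) incseq_def)
  then obtain a where a: "(\<lambda>j. slope g (L j)) \<longlonglongrightarrow> a" by blast
  have a_ge: "slope g (L j) \<le> a" for j
    by (rule incseq_le[OF _ a]) (use slope_mono[OF L(1) L_mono L(2)] in \<open>auto simp: incseq_def\<close>)
  have a_pos: "0 < a"
  proof -
    have "0 < source g (L 0) 1" by (intro source_pos L) simp
    then have "0 < source g (L 0) 1 / (real k + 1)" by simp
    also have "\<dots> \<le> avg k (source g (L 0)) 1"
      using avg_mono[of "\<lambda>_. source g (L 0) 1" "source g (L 0)" 1 k] source_cont[OF L] source_antimono[OF L]
      by auto
    finally have "0 < slope g (L 0)"
      using \<eta>_pos[of 1] by (simp add: slope_def)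
    then show ?thesis using a_ge[of 0] by simp
  qed
  define Wr where "Wr j = wronskian g (L j) 1" for j
  have Wr0: "0 \<le> Wr j" for j using wronskian_nonneg[OF L, of 1 j] by (simp add: Wr_def)
  have Wr_lim: "Wr \<longlonglongrightarrow> 0"
  proof (rule LIMSEQ_I)
    fix e :: real assume e: "0 < e"
    define C where "C = g 0 + a * (real k - 1)"
    have C: "0 < C"
      using admissible_pos[OF adm, of 0] a_pos k by (auto simp: C_def intro!: add_pos_nonneg)
    \<comment> \<open>Makes the contribution from near the origin at most \<open>e / 2\<close>,
      before \<open>j\<close> is chosen for the integral over \<open>{d..1}\<close>.\<close>
    define d where "d = min (1 / 2) (e / (2 * C))"
    have d: "0 < d" "d < 1" "C * d \<le> e / 2"
      using e C by (auto simp: d_def min_def field_simps)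
    have sub: "{d..1} \<subseteq> {0<..1}" "{d..1} \<subseteq> {0..1}" using d by auto
    let ?J = "\<lambda>j t. t ^ k * \<eta> t * (a * \<eta> t) * (p t - L j * g' (radial_limit k g (L j) t))"
    have "(\<lambda>j. integral {d..1} (?J j)) \<longlonglongrightarrow> integral {d..1} (\<lambda>_. 0)"
    proof (rule dominated_convergence(2)[where h="\<lambda>t. t ^ k * \<eta> t * (a * \<eta> t) * p t"])
      show "?J j integrable_on {d..1}" for j
        using d limit_nonneg[OF L, of _ j]
        by (intro integrable_continuous_real continuous_intros continuous_on_subset[OF \<eta>_cont sub(1)]
            continuous_on_subset[OF p_cont sub(1)]
            continuous_on_compose2[OF g'(2) continuous_on_subset[OF limit_cont[OF L] sub(2)]]) auto
      show "(\<lambda>t. t ^ k * \<eta> t * (a * \<eta> t) * p t) integrable_on {d..1}"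
        by (intro integrable_continuous_real continuous_intros continuous_on_subset[OF \<eta>_cont sub(1)]
            continuous_on_subset[OF p_cont sub(1)])
      fix t assume "t \<in> {d..1}"
      then have t: "0 < t" "t \<le> 1" using d by auto
      show "norm (?J j t) \<le> t ^ k * \<eta> t * (a * \<eta> t) * p t" for j
      proof -
        have gap: "0 \<le> p t - L j * g' (radial_limit k g (L j) t)" "p t - L j * g' (radial_limit k g (L j) t) \<le> p t"
          using derivative_gap[OF L t, of j] L[of j] by auto
        have nonneg: "0 \<le> t ^ k * \<eta> t * (a * \<eta> t)"
          using flux_\<eta>_pos[OF t] \<eta>_pos[OF t] a_pos by auto
        have "norm (?J j t) = ?J j t"
          unfolding real_norm_def by (rule abs_of_nonneg[OF mult_nonneg_nonneg[OF nonneg gap(1)]])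
        also have "\<dots> \<le> t ^ k * \<eta> t * (a * \<eta> t) * p t"
          by (rule mult_left_mono[OF gap(2) nonneg])
        finally show ?thesis .
      qed
      have "(\<lambda>j. g' (radial_limit k g (L j) t)) \<longlonglongrightarrow> g' (V t)"
        using limit_nonneg[OF L, of t] t V0[OF t]
        by (intro continuous_on_tendsto_compose[OF g'(2) Z_lim[OF t]]) auto
      then have "(\<lambda>j. ?J j t) \<longlonglongrightarrow> t ^ k * \<eta> t * (a * \<eta> t) * (p t - 1 * g' (V t))"
        by (intro tendsto_intros L_lim)
      then show "(\<lambda>j. ?J j t) \<longlonglongrightarrow> 0" using g'_V[OF t] by simp
    qed
    then have "(\<lambda>j. integral {d..1} (?J j)) \<longlonglongrightarrow> 0" by simp
    from order_tendstoD(2)[OF this, of "e / 2"] e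
    obtain n where n: "\<And>j. j \<ge> n \<Longrightarrow> integral {d..1} (?J j) < e / 2"
      by (auto simp: eventually_sequentially)
    show "\<exists>n. \<forall>j\<ge>n. norm (Wr j - 0) < e"
    proof (intro exI[of _ n] allI impI)
      fix j assume "n \<le> j"
      then show "norm (Wr j - 0) < e"
        using wronskian_one_le[OF L d(1,2) a_ge, of j] n[of j] d(3) Wr0[of j] by (simp add: Wr_def C_def)
    qed
  qed
  have "V r = a * u r \<and> g (V r) = a * F r" if r: "0 < r" "r \<le> 1" for r
  proof
    let ?E = "r ^ k * \<eta> r"
    have E: "0 < ?E" by (rule flux_\<eta>_pos[OF r])
    have lower: "(\<lambda>j. slope g (L j) - Wr j / ?E\<^sup>2) \<longlonglongrightarrow> a"
    proof -
      have "(\<lambda>j. slope g (L j) - Wr j / ?E\<^sup>2) \<longlonglongrightarrow> a - 0 / ?E\<^sup>2"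
        using \<eta>_pos[OF r] r by (intro tendsto_diff a tendsto_divide Wr_lim tendsto_const) auto
      then show ?thesis by simp
    qed
    have "(\<lambda>j. radial_limit k g (L j) r) \<longlonglongrightarrow> a * u r"
    proof (rule tendsto_sandwich)
      show "(\<lambda>j. (slope g (L j) - Wr j / ?E\<^sup>2) * u r) \<longlonglongrightarrow> a * u r"
        by (intro tendsto_mult_right lower)
      show "(\<lambda>j. slope g (L j) * u r) \<longlonglongrightarrow> a * u r"
        by (intro tendsto_mult_right a)
    qed (use limit_between[OF L r] in \<open>auto simp: Wr_def\<close>)
    then show "V r = a * u r"
      using LIMSEQ_unique Z_lim[OF r] by blast
    have r1: "r \<in> {0..1}" using r by simp
    have "(\<lambda>j. source g (L j) r) \<longlonglongrightarrow> 1 * g (V r)"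
      unfolding source_def using limit_nonneg[OF L r1] V0[OF r]
      by (intro tendsto_mult L_lim continuous_on_tendsto_compose[OF admissible_continuous[OF adm] Z_lim[OF r]]) auto
    then have "(\<lambda>j. source g (L j) r * ?E) \<longlonglongrightarrow> g (V r) * ?E"
      by (intro tendsto_mult_right) simp
    \<comment> \<open>The vanishing Wronskian expresses the limit of the sources through that of the
      slopes, which identifies \<open>g (V r)\<close> without differentiating
      \<open>V\<close>.\<close>
    moreover have "(\<lambda>j. source g (L j) r * ?E) \<longlonglongrightarrow> 0 + r ^ k * (a * \<eta> r) * F r"
    proof -
      have "(\<lambda>j. wronskian g (L j) r) \<longlonglongrightarrow> 0"
      proof (rule tendsto_sandwich[OF _ _ tendsto_const Wr_lim])
        show "\<forall>\<^sub>F j in sequentially. 0 \<le> wronskian g (L j) r"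
          using wronskian_nonneg[OF L r] by simp
        show "\<forall>\<^sub>F j in sequentially. wronskian g (L j) r \<le> Wr j"
          using wronskian_mono[OF L r] by (simp add: Wr_def)
      qed
      moreover have "(\<lambda>j. r * avg k (source g (L j)) r) \<longlonglongrightarrow> a * \<eta> r"
      proof (rule tendsto_sandwich)
        show "(\<lambda>j. (slope g (L j) - Wr j / ?E\<^sup>2) * \<eta> r) \<longlonglongrightarrow> a * \<eta> r"
          by (intro tendsto_mult_right lower)
        show "(\<lambda>j. slope g (L j) * \<eta> r) \<longlonglongrightarrow> a * \<eta> r"
          by (intro tendsto_mult_right a)
      qed (use ratio_le_slope[OF L r] slope_le_ratio[OF L r(1) order_refl r(2)] in \<open>auto simp: Wr_def\<close>)
      ultimately have "(\<lambda>j. wronskian g (L j) r + r ^ k * (r * avg k (source g (L j)) r) * F r)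
          \<longlonglongrightarrow> 0 + r ^ k * (a * \<eta> r) * F r"
        by (intro tendsto_add tendsto_mult_right[where c="F r"] tendsto_mult_left[where c="r ^ k"])
      moreover have "wronskian g (L j) r + r ^ k * (r * avg k (source g (L j)) r) * F r = source g (L j) r * ?E" for j
        by (simp add: wronskian_def algebra_simps)
      ultimately show ?thesis by simp
    qed
    ultimately have "g (V r) * ?E = r ^ k * (a * \<eta> r) * F r"
      using LIMSEQ_unique by fastforce
    then have "(g (V r) - a * F r) * ?E = 0" by (simp add: algebra_simps)
    then show "g (V r) = a * F r" using \<eta>_pos[OF r] r by simp
  qed
  then show ?thesis using a_pos by blast
qed

end

end

section \<open>From radial profiles back to functions on the ball\<close>

theorem theorem1p4:
  fixes \<Psi> :: "real ^ 'n \<Rightarrow> real"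
  assumes "CARD('n) \<ge> 11"
    and "continuous_on (cball 0 1 - {0}) \<Psi>"
    and radial: "\<And>x y. x \<in> cball 0 1 - {0} \<Longrightarrow> y \<in> cball 0 1 - {0} \<Longrightarrow> norm x = norm y \<Longrightarrow> \<Psi> x = \<Psi> y"
    and decreasing: "\<And>x y. x \<in> cball 0 1 - {0} \<Longrightarrow> y \<in> cball 0 1 - {0} \<Longrightarrow> norm x \<le> norm y \<Longrightarrow> \<Psi> y \<le> \<Psi> x"
    and lower: "\<And>x. x \<in> cball 0 1 - {0} \<Longrightarrow> 2 * (real CARD('n) - 2) / (norm x)\<^sup>2 \<le> \<Psi> x"
    and upper: "\<And>x. x \<in> cball 0 1 - {0} \<Longrightarrow> \<Psi> x \<le> (real CARD('n) - 2)\<^sup>2 / (4 * (norm x)\<^sup>2)"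
  shows "\<exists>f (U :: real ^ 'n \<Rightarrow> ereal).
    admissible f \<and> extremal_parameter TYPE('n) f 1 \<and> extremal_solution f 1 U \<and>
    derivative_along f U \<Psi> \<and>
    (\<forall>g (V :: real ^ 'n \<Rightarrow> ereal).
      admissible g \<and> extremal_parameter TYPE('n) g 1 \<and> extremal_solution g 1 V \<and>
      derivative_along g V \<Psi> \<longrightarrow>
      (\<exists>\<alpha>>0. (\<forall>t\<ge>0. g t = \<alpha> * f (t / \<alpha>)) \<and>
        extremal_solution g 1 (\<lambda>x. ereal \<alpha> * U x)))"
proof -
  define k where "k = CARD('n) - 1"
  have n: "k + 1 = CARD('n)" by (simp add: k_def)
  then have rn: "real CARD('n) - 2 = real k - 1" by linarith
  obtain i :: 'n where True by blast
  define e :: "real ^ 'n" where "e = axis i 1"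
  have e: "norm (r *\<^sub>R e) = r" if "0 < r" for r using that by (simp add: e_def)
  have e_in: "r *\<^sub>R e \<in> cball 0 1 - {0}" if "0 < r" "r \<le> 1" for r
    using e[OF that(1)] that by auto
  define p where "p r = \<Psi> (r *\<^sub>R e)" for r
  have \<Psi>p: "\<Psi> x = p (norm x)" if "x \<in> cball 0 1 - {0}" for x
    unfolding p_def using that e[of "norm x"] by (intro radial e_in) auto
  have "singular_potential k p"
  proof
    show "10 \<le> k" using assms(1) n by linarith
    show "continuous_on {0<..1} p"
      unfolding p_def by (rule continuous_on_compose2[OF assms(2)]) (use e_in in \<open>auto intro!: continuous_intros\<close>)
    show "p s \<le> p r" if "0 < r" "r \<le> s" "s \<le> 1" for r s
      unfolding p_def using that e[of r] e[of s] by (intro decreasing e_in) auto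
    show "2 * (real k - 1) / r\<^sup>2 \<le> p r" "p r \<le> (real k - 1)\<^sup>2 / (4 * r\<^sup>2)" if "0 < r" "r \<le> 1" for r
      using lower[OF e_in[OF that]] upper[OF e_in[OF that]] e[OF that(1)] by (auto simp: p_def rn)
  qed
  then obtain u \<eta> F where "singular_profile k p u \<eta> F"
    by (rule singular_potential.profile_exists)
  then interpret singular_profile k p u \<eta> F .
  let ?U = "\<lambda>x :: real ^ 'n. if x = 0 then \<infinity> else ereal (u (norm x))"
  have along: "derivative_along nonlin ?U \<Psi>"
    unfolding derivative_along_def
  proof
    fix x :: "real ^ 'n" assume x: "x \<in> cball 0 1 - {0}"
    then show "\<exists>t\<ge>0. ?U x = ereal t \<and> (nonlin has_real_derivative \<Psi> x) (at t within {0..})"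
      using nonlin_deriv_u[of "norm x"] u_nonneg[of "norm x"] \<Psi>p[OF x] by (intro exI[of _ "u (norm x)"]) auto
  qed
  have unique: "\<exists>\<alpha>>0. (\<forall>t\<ge>0. g t = \<alpha> * nonlin (t / \<alpha>)) \<and> extremal_solution g 1 (\<lambda>x. ereal \<alpha> * ?U x)"
    if adm: "admissible g" and sol: "extremal_solution g 1 V" and der: "derivative_along g V \<Psi>"
    for g and V :: "real ^ 'n \<Rightarrow> ereal"
  proof -
    obtain w where w: "\<And>l. 0 < l \<Longrightarrow> l < 1 \<Longrightarrow> minimal_solution g l (w l)"
      and wV: "\<And>x. x \<in> cball 0 1 \<Longrightarrow> ((\<lambda>l. ereal (w l x)) \<longlongrightarrow> V x) (at_left 1)"
      using sol unfolding extremal_solution_def by blast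
    have bdd: "iterates_bounded k g l" if "0 < l" "l < 1" for l
      using minimal_solution_radial(1)[OF adm n that(1) w[OF that]] .
    have ZV: "((\<lambda>l. ereal (radial_limit k g l (norm x))) \<longlongrightarrow> V x) (at_left 1)" if x: "x \<in> cball 0 1" for x
    proof (rule Lim_transform_eventually[OF wV[OF x]])
      show "\<forall>\<^sub>F l in at_left 1. ereal (w l x) = ereal (radial_limit k g l (norm x))"
        using eventually_at_left_1
        by eventually_elim (use minimal_solution_radial(2)[OF adm n _ w x] in auto)
    qed
    define v where "v r = real_of_ereal (V (r *\<^sub>R e))" for r
    have v: "V (r *\<^sub>R e) = ereal (v r)" "0 \<le> v r" "(g has_real_derivative p r) (at (v r) within {0..})"
      if r: "0 < r" "r \<le> 1" for r
    proof -
      obtain t where "0 \<le> t" "V (r *\<^sub>R e) = ereal t" "(g has_real_derivative p r) (at t within {0..})"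
        using der e_in[OF r] unfolding derivative_along_def p_def by blast
      then show "V (r *\<^sub>R e) = ereal (v r)" "0 \<le> v r" "(g has_real_derivative p r) (at (v r) within {0..})"
        by (simp_all add: v_def)
    qed
    have Zv: "((\<lambda>l. radial_limit k g l r) \<longlongrightarrow> v r) (at_left 1)" if r: "0 < r" "r \<le> 1" for r
      using ZV[of "r *\<^sub>R e"] e_in[OF r] v(1)[OF r] e[OF r(1)] by simp
    obtain g' where g': "\<And>t. 0 \<le> t \<Longrightarrow> (g has_real_derivative g' t) (at t within {0..})" "continuous_on {0..} g'"
      using admissible_derivE[OF adm] by blast
    obtain \<alpha> where \<alpha>: "0 < \<alpha>" "\<And>r. 0 < r \<Longrightarrow> r \<le> 1 \<Longrightarrow> v r = \<alpha> * u r \<and> g (v r) = \<alpha> * F r"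
      using profile_unique[OF adm g' bdd Zv v(2,3)] by blast
    have "g t = \<alpha> * nonlin (t / \<alpha>)" if "0 \<le> t" for t
    proof -
      have "0 \<le> t / \<alpha>" using \<alpha>(1) that by simp
      \<comment> \<open>Since \<open>u\<close> takes every nonnegative value, the identity along the
        profile determines \<open>g\<close> on the whole half-line.\<close>
      then obtain r where r: "0 < r" "r \<le> 1" "u r = t / \<alpha>"
        using u_surj by blast
      have "v r = t" "g (v r) = \<alpha> * F r"
        using \<alpha>(2)[OF r(1,2)] r(3) \<alpha>(1) by auto
      then show ?thesis
        using nonlin_u[OF r(1,2)] r(3) by simp
    qed
    moreover have "extremal_solution g 1 (\<lambda>x. ereal \<alpha> * ?U x)"
      unfolding extremal_solution_def
    proof (intro exI[of _ w] conjI allI impI ballI)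
      fix x :: "real ^ 'n" assume x: "x \<in> cball 0 1"
      have "V x = ereal \<alpha> * ?U x"
      proof (cases "x = 0")
        case False
        then have r: "0 < norm x" "norm x \<le> 1" using x by auto
        have "((\<lambda>l. ereal (radial_limit k g l (norm x))) \<longlongrightarrow> ereal (v (norm x))) (at_left 1)"
          using Zv[OF r] by simp
        then have "V x = ereal (v (norm x))"
          using tendsto_unique[OF _ ZV[OF x]] by simp
        then show ?thesis using \<alpha>(2)[OF r] False by simp
      next
        case True
        \<comment> \<open>\<open>derivative_along\<close> says nothing about the origin. There
          \<open>V\<close> is bounded below by its values at radii where \<open>u\<close> is large,
          because each minimal solution is largest at 0.\<close>
        have "ereal M \<le> V 0" for M
        proof -
          obtain r where r: "0 < r" "r \<le> 1" "u r = \<bar>M\<bar> / \<alpha>"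
            using u_surj[of "\<bar>M\<bar> / \<alpha>"] \<alpha>(1) by auto
          have "ereal M \<le> ereal (v r)" using \<alpha>(2)[OF r(1,2)] r(3) \<alpha>(1) by simp
          also have "\<dots> \<le> V 0"
          proof (rule tendsto_le[OF _ ZV[of 0] ])
            show "((\<lambda>l. ereal (radial_limit k g l r)) \<longlongrightarrow> ereal (v r)) (at_left 1)"
              using Zv[OF r(1,2)] by simp
            show "\<forall>\<^sub>F l in at_left 1. ereal (radial_limit k g l r) \<le> ereal (radial_limit k g l (norm (0 :: real ^ 'n)))"
              using eventually_at_left_1
              by eventually_elim (use radial_limit_antimono[OF adm _ bdd, of _ 0 r] r in auto)
          qed auto
          finally show ?thesis .
        qed
        then have "V 0 = \<infinity>" by (meson ereal_top)
        then show ?thesis using True \<alpha>(1) by simp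
      qed
      then show "((\<lambda>l. ereal (w l x)) \<longlongrightarrow> ereal \<alpha> * ?U x) (at_left 1)"
        using wV[OF x] by simp
    qed (use w in auto)
    ultimately show ?thesis using \<alpha>(1) by blast
  qed
  show ?thesis
    using nonlin_admissible extremal_parameter_nonlin[OF n] extremal_solution_nonlin[OF n] along unique
    by blast
qed

end
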